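(* For every $\mathbf{r}=(r_1,r_2)$ with $r_1,r_2>0$ there is a constant $C(\mathbf{r})>0$, depending only on $\mathbf{r}$, such that for every integer $n>2$ with $\gamma b_n\ge18$ and any function $f\in\mathcal{C}(\mathbb{T}^2)$ which belongs to either $W^{\mathbf{r}}_{\infty,\alpha}$ (for some $\alpha\in\mathbb{R}^2$) or $H^{\mathbf{r}}_\infty$, we have $$\|f-V^n(f)\|_\infty\le C(\mathbf{r})\,b_n^{-g(\mathbf{r})}.$$
   Context: $\mathbb{T}^2=[0,2\pi]^2$ with normalized Lebesgue measure; $\mathcal{C}(\mathbb{T}^2)$ is the space of continuous functions with $\|f\|_\infty=\max_{\mathbf{x}\in\mathbb{T}^2}|f(\mathbf{x})|$; functions in the classes below are $2\pi$-periodic in each variable. $g(\mathbf{r}):=(1/r_1+1/r_2)^{-1}$. Fibonacci numbers: $b_0=b_1=1$, $b_n=b_{n-1}+b_{n-2}$ for $n\ge2$. Fibonacci points: $\mathbf{y}^\nu:=(2\pi\nu/b_n,\,2\pi\{\nu b_{n-1}/b_n\})$, $\nu=1,\dots,b_n$, where $\{a\}$ is the fractional part of $a$. The number $\gamma>0$ is a fixed absolute constant (known to exist) with the following property: for any $n>2$, any $N\in\mathbb{N}$ with $N\le\gamma b_n$ and any trigonometric polynomial $f(\mathbf{x})=\sum_{\mathbf{k}\in\Gamma(N)}c_{\mathbf{k}}e^{i(\mathbf{k},\mathbf{x})}$, where $\Gamma(N):=\{\mathbf{k}\in\mathbb{Z}^2:\max(|k_1|,1)\max(|k_2|,1)\le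 N\}$, one has $b_n^{-1}\sum_{\nu=1}^{b_n}f(\mathbf{y}^\nu)=(2\pi)^{-2}\int_{\mathbb{T}^2}f(\mathbf{x})\,d\mathbf{x}$. For given $n$, $n'\in\mathbb{N}$ is the largest natural number satisfying $2^{n'}\le\gamma b_n/9$. De la Vallée Poussin kernels: $\mathcal{D}_l(x):=\sum_{|k|\le l}e^{ikx}$, $\mathcal{V}_j(x):=j^{-1}\sum_{l=j}^{2j-1}\mathcal{D}_l(x)$ for $j\in\mathbb{N}$, and $\mathcal{V}_{\mathbf{j}}(\mathbf{x}):=\mathcal{V}_{j_1}(x_1)\mathcal{V}_{j_2}(x_2)$ for $\mathbf{j}=(j_1,j_2)$. Recovery operators: for $\mathbf{s}=(s_1,s_2)\in\mathbb{Z}_+^2$ (nonnegative integers), with $2^{\mathbf{s}}:=(2^{s_1},2^{s_2})$ and $\|\mathbf{s}\|_1=s_1+s_2$, let $V_{\mathbf{s}}(f)(\mathbf{x}):=\frac1{b_n}\sum_{\nu=1}^{b_n}f(\mathbf{y}^\nu)\mathcal{V}_{2^{\mathbf{s}}}(\mathbf{x}-\mathbf{y}^\nu)$, $\mathbf{s}^o(f):=\arg\min_{\mathbf{s}:\|\mathbf{s}\|_1=n'}\|f-V_{\mathbf{s}}(f)\|_\infty$ (any minimizer), and $V^n(f):=V_{\mathbf{s}^o(f)}(f)$. Sobolev class: for $r>0$, $\alpha\in\mathbb{R}$ let $F_r(x,\alpha):=1+2\sum_{k=1}^\infty k^{-r}\cos(kx-\alpha\pi/2)$. For $\alpha=(\alpha_1,\alpha_2)\in\mathbb{R}^2$,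 $W^{\mathbf{r}}_{\infty,\alpha}$ is the set of functions $f$ on $\mathbb{T}^2$ that have both representations $$f(\mathbf{x})=(2\pi)^{-1}\int_0^{2\pi}\varphi_1(y,x_2)F_{r_1}(x_1-y,\alpha_1)\,dy,\qquad f(\mathbf{x})=(2\pi)^{-1}\int_0^{2\pi}\varphi_2(x_1,y)F_{r_2}(x_2-y,\alpha_2)\,dy,$$ with $\|\varphi_1\|_\infty\le1$, $\|\varphi_2\|_\infty\le1$. Nikol'skii class: $H^{\mathbf{r}}_\infty$ is the set of $f\in L_\infty$ such that, with $l_j:=[r_j]+1$, $\|f\|_\infty\le1$ and $\|\Delta_h^{l_j,j}f\|_\infty\le|h|^{r_j}$ for all $h$ and $j=1,2$, where $\Delta_h^{l,j}$ is the $l$-th difference with step $h$ in the variable $x_j$. *)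

theory Defs
  imports
    "HOL-Probability.Probability"
    "HOL-Number_Theory.Fib"
begin

text \<open>Functions on the torus are complex-valued functions on the plane, of period \<open>2\<pi>\<close> in each
  variable; real-valued functions are covered as a special case.\<close>

definition T2 :: "(real \<times> real) set" where
  "T2 = {0..2 * pi} \<times> {0..2 * pi}"

definition periodic2 :: "(real \<times> real \<Rightarrow> complex) \<Rightarrow> bool" where
  "periodic2 f \<longleftrightarrow> (\<forall>x y. f (x + 2 * pi, y) = f (x, y) \<and> f (x, y + 2 * pi) = f (x, y))"

definition C_T2 :: "(real \<times> real \<Rightarrow> complex) set" where
  "C_T2 = {f. continuous_on UNIV f \<and> periodic2 f}"

definition sup_norm :: "(real \<times> real \<Rightarrow> complex) \<Rightarrow> real" where
  "sup_norm f = (SUP x\<in>T2. cmod (f x))"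

text \<open>The essential supremum does not depend on the normalization of Lebesgue measure.\<close>

definition Linf_norm :: "(real \<times> real \<Rightarrow> complex) \<Rightarrow> ereal" where
  "Linf_norm f = esssup (lebesgue_on T2) (\<lambda>x. ereal (cmod (f x)))"

definition Linf :: "(real \<times> real \<Rightarrow> complex) set" where
  "Linf = {f. f \<in> borel_measurable (lebesgue_on T2) \<and> Linf_norm f < \<infinity>}"

definition g :: "real \<times> real \<Rightarrow> real" where
  "g r = inverse (1 / fst r + 1 / snd r)"

text \<open>Fibonacci numbers with \<open>b 0 = b 1 = 1\<close>, whereas the library starts with \<open>fib 0 = 0\<close>.\<close>

definition b :: "nat \<Rightarrow> nat" where
  "b n = fib (Suc n)"

definition fib_point :: "nat \<Rightarrow> nat \<Rightarrow> real \<times> real" where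
  "fib_point n \<nu> =
     (2 * pi * real \<nu> / real (b n), 2 * pi * frac (real \<nu> * real (b (n - 1)) / real (b n)))"

definition hyperbolic_cross :: "nat \<Rightarrow> (int \<times> int) set" where
  "hyperbolic_cross N = {(k1, k2). max \<bar>k1\<bar> 1 * max \<bar>k2\<bar> 1 \<le> int N}"

lemma finite_hyperbolic_cross: "finite (hyperbolic_cross N)"
proof (rule finite_subset)
  show "hyperbolic_cross N \<subseteq> {- int N..int N} \<times> {- int N..int N}"
  proof
    fix k assume "k \<in> hyperbolic_cross N"
    then obtain k1 k2 where k: "k = (k1, k2)" and le: "max \<bar>k1\<bar> 1 * max \<bar>k2\<bar> 1 \<le> int N"
      by (auto simp: hyperbolic_cross_def)
    have "max \<bar>k1\<bar> 1 * 1 \<le> max \<bar>k1\<bar> 1 * max \<bar>k2\<bar> 1"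
      by (rule mult_left_mono) auto
    moreover have "1 * max \<bar>k2\<bar> 1 \<le> max \<bar>k1\<bar> 1 * max \<bar>k2\<bar> 1"
      by (rule mult_right_mono) auto
    ultimately have "\<bar>k1\<bar> \<le> int N" "\<bar>k2\<bar> \<le> int N" using le by auto
    then show "k \<in> {- int N..int N} \<times> {- int N..int N}" by (auto simp: k)
  qed
qed simp

definition trig_poly :: "(int \<times> int) set \<Rightarrow> (int \<times> int \<Rightarrow> complex) \<Rightarrow> real \<times> real \<Rightarrow> complex" where
  "trig_poly K c x = (\<Sum>k\<in>K. c k * cis (of_int (fst k) * fst x + of_int (snd k) * snd x))"

text \<open>The defining property of the absolute constant \<open>\<gamma>\<close>.\<close>

definition fib_exact :: "real \<Rightarrow> bool" where
  "fib_exact \<gamma> \<longleftrightarrow>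
     (\<forall>n N c. n > 2 \<longrightarrow> N \<ge> 1 \<longrightarrow> real N \<le> \<gamma> * real (b n) \<longrightarrow>
        (\<Sum>\<nu>=1..b n. trig_poly (hyperbolic_cross N) c (fib_point n \<nu>)) / of_nat (b n)
        = (LINT x|lebesgue_on T2. trig_poly (hyperbolic_cross N) c x) / (2 * pi)^2)"

definition n' :: "real \<Rightarrow> nat \<Rightarrow> nat" where
  "n' \<gamma> n = (GREATEST m. 2 ^ m \<le> \<gamma> * real (b n) / 9)"

definition dirichlet_kernel :: "nat \<Rightarrow> real \<Rightarrow> complex" where
  "dirichlet_kernel l x = (\<Sum>k\<in>{- int l..int l}. cis (of_int k * x))"

definition VP_kernel :: "nat \<Rightarrow> real \<Rightarrow> complex" where
  "VP_kernel j x = (\<Sum>l=j..2 * j - 1. dirichlet_kernel l x) / of_nat j"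

definition VP_kernel2 :: "nat \<times> nat \<Rightarrow> real \<times> real \<Rightarrow> complex" where
  "VP_kernel2 j x = VP_kernel (fst j) (fst x) * VP_kernel (snd j) (snd x)"

definition V :: "nat \<Rightarrow> nat \<times> nat \<Rightarrow> (real \<times> real \<Rightarrow> complex) \<Rightarrow> real \<times> real \<Rightarrow> complex" where
  "V n s f x =
     (\<Sum>\<nu>=1..b n. f (fib_point n \<nu>) * VP_kernel2 (2 ^ fst s, 2 ^ snd s) (x - fib_point n \<nu>))
     / of_nat (b n)"

definition optimal_index ::
    "real \<Rightarrow> nat \<Rightarrow> (real \<times> real \<Rightarrow> complex) \<Rightarrow> nat \<times> nat \<Rightarrow> bool" where
  "optimal_index \<gamma> n f =
     is_arg_min (\<lambda>s. sup_norm (\<lambda>x. f x - V n s f x)) (\<lambda>s. fst s + snd s = n' \<gamma> n)"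

text \<open>As the minimizer need not be unique, \<open>V\<^sup>n(f)\<close> is represented by the set of its possible values,
  one for each choice of the minimizer.\<close>

definition Vn :: "real \<Rightarrow> nat \<Rightarrow> (real \<times> real \<Rightarrow> complex) \<Rightarrow> (real \<times> real \<Rightarrow> complex) set" where
  "Vn \<gamma> n f = {V n s f |s. optimal_index \<gamma> n f s}"

lemma Vn_nonempty: "Vn \<gamma> n f \<noteq> {}"
proof -
  let ?S = "{s :: nat \<times> nat. fst s + snd s = n' \<gamma> n}"
  have "finite ?S"
    by (rule finite_subset[of _ "{..n' \<gamma> n} \<times> {..n' \<gamma> n}"]) auto
  moreover have "(0, n' \<gamma> n) \<in> ?S" by simp
  ultimately obtain s where "is_arg_min (\<lambda>s. sup_norm (\<lambda>x. f x - V n s f x)) (\<lambda>s. s \<in> ?S) s"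
    using ex_is_arg_min_if_finite[of ?S] by blast
  then have "optimal_index \<gamma> n f s" by (simp add: optimal_index_def)
  then show ?thesis unfolding Vn_def by blast
qed

text \<open>The series converges for every \<open>x\<close> that is not a multiple of \<open>2\<pi>\<close>, not absolutely if \<open>r \<le> 1\<close>;
  its value on the remaining null set is irrelevant.\<close>

definition F_kernel :: "real \<Rightarrow> real \<Rightarrow> real \<Rightarrow> real" where
  "F_kernel r \<alpha> x =
     1 + 2 * (\<Sum>k. real (Suc k) powr (- r) * cos (real (Suc k) * x - \<alpha> * pi / 2))"

text \<open>The two representations are equalities in \<open>L\<^sub>\<infinity>\<close>, that is, they hold almost everywhere.\<close>

definition W_class :: "real \<times> real \<Rightarrow> real \<times> real \<Rightarrow> (real \<times> real \<Rightarrow> complex) set" where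
  "W_class r \<alpha> = {f. periodic2 f \<and>
     (\<exists>\<phi>\<in>Linf. Linf_norm \<phi> \<le> 1 \<and>
        (AE x in lebesgue_on T2. f x =
           (LINT y|lebesgue_on {0..2 * pi}.
              \<phi> (y, snd x) * of_real (F_kernel (fst r) (fst \<alpha>) (fst x - y))) / (2 * pi))) \<and>
     (\<exists>\<phi>\<in>Linf. Linf_norm \<phi> \<le> 1 \<and>
        (AE x in lebesgue_on T2. f x =
           (LINT y|lebesgue_on {0..2 * pi}.
              \<phi> (fst x, y) * of_real (F_kernel (snd r) (snd \<alpha>) (snd x - y))) / (2 * pi)))}"

definition diff_step ::
    "real \<times> real \<Rightarrow> (real \<times> real \<Rightarrow> complex) \<Rightarrow> real \<times> real \<Rightarrow> complex" where
  "diff_step v f x = f (x + v) - f x"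

definition H_class :: "real \<times> real \<Rightarrow> (real \<times> real \<Rightarrow> complex) set" where
  "H_class r = {f. periodic2 f \<and> f \<in> Linf \<and> Linf_norm f \<le> 1 \<and>
     (\<forall>h. Linf_norm ((diff_step (h, 0) ^^ (nat \<lfloor>fst r\<rfloor> + 1)) f) \<le> ereal (\<bar>h\<bar> powr fst r)) \<and>
     (\<forall>h. Linf_norm ((diff_step (0, h) ^^ (nat \<lfloor>snd r\<rfloor> + 1)) f) \<le> ereal (\<bar>h\<bar> powr snd r))}"

end

theory Submission
  imports Defs
begin

text \<open>Two facts about a fixed level \<open>s\<close> carry the theorem. By exactness of the Fibonacci rule, \<open>V n s\<close>
reproduces every trigonometric polynomial \<open>t\<close> with frequencies in the box \<open>\<bar>k\<^sub>j\<bar> \<le> 2 ^ s\<^sub>j\<close>: the products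
that occur have frequencies below \<open>3 * 2 ^ s\<^sub>j\<close>, hence lie in the hyperbolic cross of order
\<open>9 * 2 ^ n'\<close>. Moreover \<open>V n s\<close> has norm at most 9 on continuous functions: a de la Vallee Poussin
kernel has the form \<open>2 * K - K'\<close> with Fejer kernels \<open>K\<close> and \<open>K'\<close>, so its modulus is dominated by the
nonnegative trigonometric polynomial \<open>2 * K + K'\<close> with mean 3, and the averages of the tensor products of these majorants
over the Fibonacci points are again given by exactness. Therefore \<open>f - V n s f\<close> is at most ten times
the distance of \<open>f\<close> from any such \<open>t\<close> (\<open>V_near_best\<close>). The adaptive choice of \<open>s\<close> is at least as
good as any particular one, so it remains to approximate \<open>f\<close> for the level where \<open>2 ^ (r\<^sub>1 * s\<^sub>1)\<close>
and \<open>2 ^ (r\<^sub>2 * s\<^sub>2)\<close> are balanced (\<open>balanced_split\<close>); there both are comparable with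
\<open>2 ^ (n' * g r)\<close>, that is, with \<open>b n powr g r\<close>.

The approximation in two variables reduces to one variable. Sampling at equispaced points with a
de la Vallee Poussin kernel is a linear, bounded operator in one variable whose error is at most
four times the best approximation; applying it in each variable gives \<open>t\<close>
(\<open>approx_two_variables\<close>). Since both \<open>f\<close> and the operator are continuous in the remaining variable,
the one-dimensional approximation is only needed for a dense set of sections of \<open>f\<close>. This matters
for the Sobolev class, whose representations hold only almost everywhere.

For a section of a function of the Sobolev class the approximant is the convolution of \<open>\<phi>\<close> with a
polynomial close to the kernel \<open>F\<^sub>r\<close> in the mean (\<open>potential_approx\<close>). The difference of the two is
a Fourier series whose coefficients first grow linearly and then decay like \<open>k powr (- r)\<close>; summing
by parts twice shows that each of its dyadic blocks is as small as a Fejer kernel away from the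
origin, and the mean values of the blocks add up to a constant times \<open>j powr (- r)\<close>
(\<open>nn_integral_ramp_sum\<close>). For the Nikol'skii class it is a generalized Jackson mean of \<open>f\<close>
(\<open>jackson_differences\<close>). There the integrals against the Jackson kernel are replaced by averages
over fine equispaced grids, so that all its moments are computed algebraically.\<close>

section \<open>Sampling operators\<close>

abbreviation character :: "'a::real_inner \<Rightarrow> 'a \<Rightarrow> complex" where
  "character m x \<equiv> cis (m \<bullet> x)"

definition trig_poly_with :: "'a::real_inner set \<Rightarrow> ('a \<Rightarrow> complex) \<Rightarrow> ('a \<Rightarrow> complex) \<Rightarrow> bool" where
  "trig_poly_with L c f \<longleftrightarrow> finite L \<and> f = (\<lambda>x. \<Sum>m\<in>L. c m * character m x)"

text \<open>Frequencies are vectors of an inner product space, so that the same operators serve polynomials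
in one and in two variables.\<close>

definition trig_polys :: "'a::real_inner set \<Rightarrow> ('a \<Rightarrow> complex) set" where
  "trig_polys L = {f. \<exists>c. trig_poly_with L c f}"

text \<open>Convolution with such a kernel multiplies the frequencies in \<open>\<Lambda>\<close> by \<open>a\<close>. Value \<open>a = 1\<close> gives
a reproducing kernel; \<open>\<Lambda> = {0}\<close> records that the kernel has mean value \<open>a\<close>.\<close>

definition multiplier_kernel :: "'a::real_inner set \<Rightarrow> 'a set \<Rightarrow> complex \<Rightarrow> ('a \<Rightarrow> complex) \<Rightarrow> bool" where
  "multiplier_kernel \<Lambda> L a K \<longleftrightarrow> \<Lambda> \<subseteq> L \<and> (\<exists>v. trig_poly_with L v K \<and> (\<forall>m\<in>\<Lambda>. v m = a))"

text \<open>The equal-weight quadrature at the nodes integrates every character in \<open>L\<close> as the mean over the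
torus does.\<close>

definition exact_nodes :: "'i set \<Rightarrow> ('i \<Rightarrow> 'a::real_inner) \<Rightarrow> 'a set \<Rightarrow> bool" where
  "exact_nodes I p L \<longleftrightarrow> finite I \<and> I \<noteq> {} \<and> (\<forall>m\<in>L. m \<noteq> 0 \<longrightarrow> (\<Sum>i\<in>I. character m (p i)) = 0)"

definition sampling :: "'i set \<Rightarrow> ('i \<Rightarrow> 'a::real_inner) \<Rightarrow> ('a \<Rightarrow> complex) \<Rightarrow> ('a \<Rightarrow> complex) \<Rightarrow> 'a \<Rightarrow> complex" where
  "sampling I p K f x = (\<Sum>i\<in>I. f (p i) * K (x - p i)) / of_nat (card I)"

lemma trig_polysI: "finite L \<Longrightarrow> (\<And>x. f x = (\<Sum>m\<in>L. c m * character m x)) \<Longrightarrow> f \<in> trig_polys L"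
  by (auto simp: trig_polys_def trig_poly_with_def)

lemma trig_polysE:
  assumes "f \<in> trig_polys L"
  obtains c where "finite L" "f = (\<lambda>x. \<Sum>m\<in>L. c m * character m x)"
  using assms by (auto simp: trig_polys_def trig_poly_with_def)

lemma trig_polys_sum:
  assumes "finite L" "\<And>i. i \<in> I \<Longrightarrow> f i \<in> trig_polys L"
  shows "(\<lambda>x. \<Sum>i\<in>I. a i * f i x) \<in> trig_polys L"
proof -
  have "\<forall>i. \<exists>c. i \<in> I \<longrightarrow> f i = (\<lambda>x. \<Sum>m\<in>L. c m * character m x)"
    using assms(2) by (metis trig_polysE)
  then obtain c where c: "\<And>i. i \<in> I \<Longrightarrow> f i = (\<lambda>x. \<Sum>m\<in>L. c i m * character m x)"
    by metis
  show ?thesis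
  proof (rule trig_polysI[OF assms(1), where c="\<lambda>m. \<Sum>i\<in>I. a i * c i m"])
    fix x
    have "(\<Sum>i\<in>I. a i * f i x) = (\<Sum>i\<in>I. \<Sum>m\<in>L. a i * c i m * character m x)"
      by (intro sum.cong) (simp_all add: c sum_distrib_left mult.assoc)
    also have "\<dots> = (\<Sum>m\<in>L. (\<Sum>i\<in>I. a i * c i m) * character m x)"
      by (subst sum.swap) (simp add: sum_distrib_right)
    finally show "(\<Sum>i\<in>I. a i * f i x) = (\<Sum>m\<in>L. (\<Sum>i\<in>I. a i * c i m) * character m x)" .
  qed
qed

lemma trig_polys_add:
  assumes "f \<in> trig_polys L" "h \<in> trig_polys L"
  shows "(\<lambda>x. f x + h x) \<in> trig_polys L"
proof -
  have "finite L" using assms(1) by (rule trig_polysE)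
  then have "(\<lambda>x. \<Sum>i\<in>UNIV. 1 * (if i then f else h) x) \<in> trig_polys L"
    using assms by (intro trig_polys_sum) auto
  then show ?thesis by (simp add: UNIV_bool add.commute)
qed

lemma character_in_trig_polys:
  assumes "finite L" "m \<in> L" shows "(\<lambda>x. c * character m x) \<in> trig_polys L"
  by (rule trig_polysI[where c="\<lambda>k. if k = m then c else 0"])
     (use assms in \<open>simp_all add: if_distrib[of "\<lambda>c. c * _"] cong: if_cong\<close>)

lemma trig_polys_translate:
  assumes "f \<in> trig_polys L"
  shows "(\<lambda>x. f (x - y)) \<in> trig_polys L"
proof -
  obtain c where c: "finite L" "f = (\<lambda>x. \<Sum>m\<in>L. c m * character m x)"
    using assms by (rule trig_polysE)
  show ?thesis
    by (rule trig_polysI[where c="\<lambda>m. c m * cis (- (m \<bullet> y))"])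
       (simp_all add: c inner_diff_right cis_mult mult.assoc)
qed

lemma trig_polys_mono:
  assumes "f \<in> trig_polys L" "L \<subseteq> L'" "finite L'"
  shows "f \<in> trig_polys L'"
proof -
  obtain c where c: "finite L" "f = (\<lambda>x. \<Sum>m\<in>L. c m * character m x)"
    using assms(1) by (rule trig_polysE)
  show ?thesis
    by (rule trig_polysI[where c="\<lambda>m. if m \<in> L then c m else 0"])
       (use assms c in \<open>auto intro!: sum.mono_neutral_cong_left\<close>)
qed

lemma trig_polys_tensor:
  assumes "f \<in> trig_polys L" "h \<in> trig_polys M"
  shows "(\<lambda>x. f (fst x) * h (snd x)) \<in> trig_polys (L \<times> M)"
proof -
  obtain c where c: "finite L" "f = (\<lambda>x. \<Sum>m\<in>L. c m * character m x)"
    using assms(1) by (rule trig_polysE)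
  obtain d where d: "finite M" "h = (\<lambda>x. \<Sum>m\<in>M. d m * character m x)"
    using assms(2) by (rule trig_polysE)
  show ?thesis
    by (rule trig_polysI[where c="\<lambda>m. c (fst m) * d (snd m)"])
       (simp_all add: c d sum_product sum.cartesian_product case_prod_unfold inner_prod_def
          cis_mult[symmetric] mult_ac)
qed

lemma continuous_on_trig_polys:
  assumes "f \<in> trig_polys L" shows "continuous_on S f"
  using assms by (elim trig_polysE) (auto simp: cis_conv_exp intro!: continuous_intros)

lemma multiplier_kernel_imp_trig_polys: "multiplier_kernel \<Lambda> L a K \<Longrightarrow> K \<in> trig_polys L"
  by (auto simp: multiplier_kernel_def trig_polys_def)

lemma multiplier_kernel_sum:
  assumes "\<Lambda> \<subseteq> L" "finite L" "\<And>i. i \<in> I \<Longrightarrow> multiplier_kernel \<Lambda> L (a i) (K i)"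
  shows "multiplier_kernel \<Lambda> L (\<Sum>i\<in>I. w i * a i) (\<lambda>x. \<Sum>i\<in>I. w i * K i x)"
proof -
  have "\<forall>i. \<exists>v. i \<in> I \<longrightarrow> K i = (\<lambda>x. \<Sum>m\<in>L. v m * character m x) \<and> (\<forall>m\<in>\<Lambda>. v m = a i)"
    using assms(3) unfolding multiplier_kernel_def trig_poly_with_def by meson
  then obtain v where v: "\<And>i. i \<in> I \<Longrightarrow> K i = (\<lambda>x. \<Sum>m\<in>L. v i m * character m x)"
      "\<And>i m. i \<in> I \<Longrightarrow> m \<in> \<Lambda> \<Longrightarrow> v i m = a i"
    by metis
  show ?thesis
    unfolding multiplier_kernel_def trig_poly_with_def
  proof (intro conjI exI[of _ "\<lambda>m. \<Sum>i\<in>I. w i * v i m"] ext)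
    fix x
    have "(\<Sum>i\<in>I. w i * K i x) = (\<Sum>i\<in>I. \<Sum>m\<in>L. w i * v i m * character m x)"
      by (intro sum.cong) (simp_all add: v sum_distrib_left mult.assoc)
    also have "\<dots> = (\<Sum>m\<in>L. (\<Sum>i\<in>I. w i * v i m) * character m x)"
      by (subst sum.swap) (simp add: sum_distrib_right)
    finally show "(\<Sum>i\<in>I. w i * K i x) = (\<Sum>m\<in>L. (\<Sum>i\<in>I. w i * v i m) * character m x)" .
  qed (use assms v in \<open>auto intro!: sum.cong\<close>)
qed

lemma multiplier_kernel_tensor:
  assumes "multiplier_kernel \<Lambda> L a K" "multiplier_kernel \<Lambda>' L' a' K'"
  shows "multiplier_kernel (\<Lambda> \<times> \<Lambda>') (L \<times> L') (a * a') (\<lambda>x. K (fst x) * K' (snd x))"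
proof -
  obtain v where v: "finite L" "\<Lambda> \<subseteq> L" "K = (\<lambda>x. \<Sum>m\<in>L. v m * character m x)" "\<And>m. m \<in> \<Lambda> \<Longrightarrow> v m = a"
    using assms(1) by (auto simp: multiplier_kernel_def trig_poly_with_def)
  obtain v' where v': "finite L'" "\<Lambda>' \<subseteq> L'" "K' = (\<lambda>x. \<Sum>m\<in>L'. v' m * character m x)" "\<And>m. m \<in> \<Lambda>' \<Longrightarrow> v' m = a'"
    using assms(2) by (auto simp: multiplier_kernel_def trig_poly_with_def)
  show ?thesis
    unfolding multiplier_kernel_def trig_poly_with_def
    by (intro conjI exI[of _ "\<lambda>m. v (fst m) * v' (snd m)"])
       (use v v' in \<open>auto simp: sum_product sum.cartesian_product case_prod_unfold inner_prod_def
          cis_mult[symmetric] mult_ac\<close>)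
qed

text \<open>In the product of \<open>character m\<close> with a translate of \<open>character k\<close> the node appears with frequency
\<open>m - k\<close>; exactness on differences kills all pairs with \<open>m \<noteq> k\<close>.\<close>

lemma sampling_reproduces:
  assumes K: "multiplier_kernel \<Lambda> L a K" and t: "t \<in> trig_polys \<Lambda>"
    and ex: "exact_nodes I p {m - k | m k. m \<in> \<Lambda> \<and> k \<in> L}"
  shows "sampling I p K t x = a * t x"
proof -
  obtain v where v: "finite L" "\<Lambda> \<subseteq> L" "K = (\<lambda>x. \<Sum>k\<in>L. v k * character k x)"
      "\<And>m. m \<in> \<Lambda> \<Longrightarrow> v m = a"
    using K by (auto simp: multiplier_kernel_def trig_poly_with_def)
  obtain c where c: "finite \<Lambda>" "t = (\<lambda>x. \<Sum>m\<in>\<Lambda>. c m * character m x)"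
    using t by (rule trig_polysE)
  have I: "finite I" "I \<noteq> {}" using ex by (auto simp: exact_nodes_def)
  have q: "(\<Sum>i\<in>I. character (m - k) (p i)) = (if k = m then of_nat (card I) else 0)"
    if "m \<in> \<Lambda>" "k \<in> L" for m k
  proof (cases "k = m")
    case False
    then have "m - k \<noteq> 0" by simp
    moreover have "m - k \<in> {m - k | m k. m \<in> \<Lambda> \<and> k \<in> L}" using that by blast
    ultimately show ?thesis using ex False unfolding exact_nodes_def by simp
  qed auto
  have e: "character m (p i) * character k (x - p i) = character k x * character (m - k) (p i)" for m k i
    by (simp add: cis_mult inner_diff_left inner_diff_right algebra_simps)
  have "(\<Sum>i\<in>I. t (p i) * K (x - p i)) =
      (\<Sum>i\<in>I. \<Sum>m\<in>\<Lambda>. \<Sum>k\<in>L. c m * v k * (character m (p i) * character k (x - p i)))"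
    by (simp add: c v sum_product mult_ac)
  also have "\<dots> = (\<Sum>i\<in>I. \<Sum>m\<in>\<Lambda>. \<Sum>k\<in>L. c m * v k * character k x * character (m - k) (p i))"
    unfolding e by (simp add: mult_ac)
  also have "\<dots> = (\<Sum>m\<in>\<Lambda>. \<Sum>k\<in>L. \<Sum>i\<in>I. c m * v k * character k x * character (m - k) (p i))"
    by (subst sum.swap, intro sum.cong refl, subst sum.swap, rule refl)
  also have "\<dots> = (\<Sum>m\<in>\<Lambda>. \<Sum>k\<in>L. c m * v k * character k x * (if k = m then of_nat (card I) else 0))"
    by (intro sum.cong refl) (simp add: sum_distrib_left[symmetric] q)
  also have "\<dots> = (\<Sum>m\<in>\<Lambda>. c m * v m * character m x * of_nat (card I))"
    using v by (intro sum.cong refl) (auto simp: if_distrib cong: if_cong)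
  also have "\<dots> = a * t x * of_nat (card I)"
    unfolding c(2) by (simp add: v(4) sum_distrib_left sum_distrib_right mult_ac)
  finally show ?thesis
    using I by (simp add: sampling_def)
qed

lemma one_in_trig_polys: "(\<lambda>x. 1) \<in> trig_polys {0}"
  by (rule trig_polysI[where c="\<lambda>_. 1"]) auto

text \<open>The average of the majorant over the nodes is the sampling operator applied to the constant 1, and
is therefore its mean value.\<close>

lemma sampling_kernel_bound:
  assumes B: "multiplier_kernel {0} L (of_real c) (\<lambda>x. of_real (B x))"
    and KB: "\<And>x. cmod (K x) \<le> B x"
    and ex: "exact_nodes I p (uminus ` L)"
  shows "(\<Sum>i\<in>I. cmod (K (x - p i))) / card I \<le> c"
proof -
  have "complex_of_real ((\<Sum>i\<in>I. B (x - p i)) / card I) = sampling I p (\<lambda>x. of_real (B x)) (\<lambda>x. 1) x"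
    by (simp add: sampling_def)
  also have "\<dots> = of_real c * 1"
  proof (rule sampling_reproduces[OF B one_in_trig_polys])
    have "{m - k | m k. m \<in> {0} \<and> k \<in> L} = uminus ` L" by auto
    then show "exact_nodes I p {m - k | m k. m \<in> {0} \<and> k \<in> L}" using ex by simp
  qed
  finally have "(\<Sum>i\<in>I. B (x - p i)) / card I = c"
    by (simp only: of_real_eq_iff mult_1_right)
  moreover have "(\<Sum>i\<in>I. cmod (K (x - p i))) / card I \<le> (\<Sum>i\<in>I. B (x - p i)) / card I"
    by (intro divide_right_mono sum_mono KB) auto
  ultimately show ?thesis by simp
qed

lemma norm_sampling_le:
  assumes "(\<Sum>i\<in>I. cmod (K (x - p i))) / card I \<le> c" and "\<And>i. i \<in> I \<Longrightarrow> cmod (f (p i)) \<le> e"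
    and "0 \<le> e"
  shows "cmod (sampling I p K f x) \<le> c * e"
proof -
  have "cmod (sampling I p K f x) \<le> (\<Sum>i\<in>I. e * cmod (K (x - p i))) / card I"
    unfolding sampling_def norm_divide norm_of_nat
    by (intro divide_right_mono order_trans[OF norm_sum] sum_mono)
       (auto simp: norm_mult intro!: mult_right_mono assms)
  also have "\<dots> = e * ((\<Sum>i\<in>I. cmod (K (x - p i))) / card I)"
    by (simp add: sum_distrib_left)
  also have "\<dots> \<le> e * c" using assms by (intro mult_left_mono) auto
  finally show ?thesis by (simp add: mult.commute)
qed

text \<open>The usual Lebesgue inequality: a bounded operator that fixes \<open>t\<close> approximates \<open>f\<close> almost as well
as \<open>t\<close> does. Only values of \<open>f\<close> at the nodes and at \<open>x\<close> enter.\<close>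

lemma sampling_near_best:
  assumes K: "multiplier_kernel \<Lambda> L 1 K" and t: "t \<in> trig_polys \<Lambda>"
    and ex: "exact_nodes I p {m - k | m k. m \<in> \<Lambda> \<and> k \<in> L}"
    and bd: "(\<Sum>i\<in>I. cmod (K (x - p i))) / card I \<le> c"
    and ft: "cmod (f x - t x) \<le> e" "\<And>i. i \<in> I \<Longrightarrow> cmod (f (p i) - t (p i)) \<le> e"
  shows "cmod (f x - sampling I p K f x) \<le> (1 + c) * e"
proof -
  have "0 \<le> e" using ft(1) norm_ge_zero order_trans by blast
  have "sampling I p K t x = t x"
    using sampling_reproduces[OF K t ex] by simp
  moreover have "sampling I p K (\<lambda>x. f x - t x) x = sampling I p K f x - sampling I p K t x"
    by (simp add: sampling_def sum_subtractf left_diff_distrib diff_divide_distrib)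
  ultimately have "f x - sampling I p K f x = (f x - t x) - sampling I p K (\<lambda>x. f x - t x) x"
    by simp
  also have "cmod \<dots> \<le> e + c * e"
    by (intro order_trans[OF norm_triangle_ineq4] add_mono ft norm_sampling_le bd \<open>0 \<le> e\<close>)
  finally show ?thesis by (simp add: algebra_simps)
qed

section \<open>De la Vallee Poussin kernels\<close>

definition freqs :: "nat \<Rightarrow> real set" where
  "freqs N = of_int ` {- int N..int N}"

lemma finite_freqs [simp]: "finite (freqs N)"
  by (simp add: freqs_def)

lemma freqs_mono: "M \<le> N \<Longrightarrow> freqs M \<subseteq> freqs N"
  by (auto simp: freqs_def)

lemma zero_in_freqs: "0 \<in> freqs N"
  by (auto simp: freqs_def intro!: image_eqI[of _ _ 0])

lemma sum_freqs: "(\<Sum>m\<in>freqs N. F m) = (\<Sum>k=- int N..int N. F (of_int k))"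
  unfolding freqs_def by (subst sum.reindex) (auto simp: inj_on_def)

lemma multiplier_kernel_dirichlet:
  assumes "j \<le> l" "l \<le> N"
  shows "multiplier_kernel (freqs j) (freqs N) 1 (dirichlet_kernel l)"
  unfolding multiplier_kernel_def trig_poly_with_def
proof (intro conjI exI[of _ "\<lambda>m. if m \<in> freqs l then 1 else 0"] ext ballI)
  fix x
  have "dirichlet_kernel l x = (\<Sum>m\<in>freqs l. character m x)"
    by (simp add: dirichlet_kernel_def sum_freqs)
  also have "\<dots> = (\<Sum>m\<in>freqs N. (if m \<in> freqs l then 1 else 0) * character m x)"
    using freqs_mono[OF assms(2)] by (intro sum.mono_neutral_cong_left) auto
  finally show "dirichlet_kernel l x = (\<Sum>m\<in>freqs N. (if m \<in> freqs l then 1 else 0) * character m x)" .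
qed (use assms freqs_mono[of j l] freqs_mono[of j N] in auto)

lemma multiplier_kernel_VP:
  assumes "1 \<le> j"
  shows "multiplier_kernel (freqs j) (freqs (2 * j - 1)) 1 (VP_kernel j)"
proof -
  have "multiplier_kernel (freqs j) (freqs (2 * j - 1))
      (\<Sum>l\<in>{j..2*j-1}. (1 / of_nat j) * 1) (\<lambda>x. \<Sum>l\<in>{j..2*j-1}. (1 / of_nat j) * dirichlet_kernel l x)"
    using assms by (intro multiplier_kernel_sum multiplier_kernel_dirichlet freqs_mono) auto
  moreover have "card {j..2*j-1} = j" using assms by auto
  then have "(\<Sum>l\<in>{j..2*j-1}. (1 / complex_of_nat j) * 1) = 1" using assms by simp
  ultimately show ?thesis
    unfolding VP_kernel_def[abs_def] by (simp add: sum_divide_distrib)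
qed

lemma dirichlet_kernel_Suc:
  fixes x :: real
  shows "dirichlet_kernel (Suc n) x = dirichlet_kernel n x + of_real (2 * cos (real (Suc n) * x))"
proof -
  have I: "{- int (Suc n)..int (Suc n)} = insert (int (Suc n)) (insert (- int (Suc n)) {- int n..int n})"
    by auto
  then have "dirichlet_kernel (Suc n) x =
      cis (of_int (int (Suc n)) * x) + (cis (of_int (- int (Suc n)) * x) + dirichlet_kernel n x)"
    unfolding dirichlet_kernel_def by (simp add: I del: of_nat_Suc)
  also have "cis (of_int (- int (Suc n)) * x) = cnj (cis (of_int (int (Suc n)) * x))"
    by (simp add: cis_cnj del: of_nat_Suc)
  finally show ?thesis
    by (simp add: complex_eq_iff del: of_nat_Suc)
qed

lemma dirichlet_kernel_eq_cos_sum: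
  "dirichlet_kernel n x = of_real (1 + (\<Sum>k\<in>{1..n}. 2 * cos (real k * x)))"
proof (induction n)
  case 0 then show ?case by (simp add: dirichlet_kernel_def)
next
  case (Suc n) then show ?case by (simp add: dirichlet_kernel_Suc del: of_nat_Suc)
qed

lemma cmod_add_sq: "(cmod (w + z))\<^sup>2 = (cmod w)\<^sup>2 + (cmod z)\<^sup>2 + 2 * Re (cnj z * w)"
  unfolding cmod_power2 by (simp add: power2_eq_square algebra_simps)

text \<open>The Fejer kernel is a square, hence nonnegative.\<close>

lemma sum_dirichlet_kernel:
  "(\<Sum>l<n. dirichlet_kernel l x) = of_real ((cmod (\<Sum>k\<in>{..<n}. cis (real k * x)))\<^sup>2)"
proof (induction n)
  case (Suc n)
  let ?G = "\<Sum>k\<in>{..<n}. cis (real k * x)"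
  have "(cmod (?G + cis (real n * x)))\<^sup>2 = (cmod ?G)\<^sup>2 + 1 + 2 * Re (cnj (cis (real n * x)) * ?G)"
    using cmod_add_sq[of ?G "cis (real n * x)"] by simp
  also have "2 * Re (cnj (cis (real n * x)) * ?G) = (\<Sum>k\<in>{..<n}. 2 * cos ((real n - real k) * x))"
  proof -
    have "2 * Re (cnj (cis (real n * x)) * ?G) = (\<Sum>k\<in>{..<n}. 2 * Re (cnj (cis (real n * x)) * cis (real k * x)))"
      by (simp only: sum_distrib_left Re_sum)
    also have "\<dots> = (\<Sum>k\<in>{..<n}. 2 * cos ((real n - real k) * x))"
      by (intro sum.cong refl) (simp only: cis_cnj cis_mult Re_complex_of_real cis.simps,
          metis (no_types, opaque_lifting) cos_minus minus_diff_eq left_diff_distrib uminus_add_conv_diff)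
    finally show ?thesis .
  qed
  also have "\<dots> = (\<Sum>k\<in>{..<n}. 2 * cos (real (Suc k) * x))"
    by (subst sum.nat_diff_reindex[symmetric]) (intro sum.cong refl, simp add: of_nat_diff Suc_diff_Suc)
  also have "\<dots> = (\<Sum>k\<in>{1..n}. 2 * cos (real k * x))"
    by (rule sum.reindex_bij_witness[of _ "\<lambda>k. k - 1" Suc]) auto
  finally show ?case
    using Suc by (simp add: dirichlet_kernel_eq_cos_sum)
qed simp

text \<open>With \<open>K\<^sub>n\<close> the \<open>n\<close>-th Fejer kernel, this is \<open>2 * K\<^sub>2\<^sub>j + K\<^sub>j\<close>, whereas \<open>\<V>\<^sub>j = 2 * K\<^sub>2\<^sub>j - K\<^sub>j\<close>.\<close>

definition VP_majorant :: "nat \<Rightarrow> real \<Rightarrow> real" where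
  "VP_majorant j x = ((cmod (\<Sum>k\<in>{..<2 * j}. cis (real k * x)))\<^sup>2 + (cmod (\<Sum>k\<in>{..<j}. cis (real k * x)))\<^sup>2) / j"

lemma norm_VP_kernel_le:
  assumes "1 \<le> j" shows "cmod (VP_kernel j x) \<le> VP_majorant j x"
proof -
  have I: "{..<2*j} = {..<j} \<union> {j..2*j-1}" using assms by auto
  have "(\<Sum>l<2*j. dirichlet_kernel l x) = (\<Sum>l<j. dirichlet_kernel l x) + (\<Sum>l=j..2*j-1. dirichlet_kernel l x)"
    unfolding I by (rule sum.union_disjoint) auto
  then have "(\<Sum>l=j..2*j-1. dirichlet_kernel l x) =
     of_real ((cmod (\<Sum>k\<in>{..<2 * j}. cis (real k * x)))\<^sup>2 - (cmod (\<Sum>k\<in>{..<j}. cis (real k * x)))\<^sup>2)"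
    by (simp add: sum_dirichlet_kernel)
  then have "cmod (\<Sum>l=j..2*j-1. dirichlet_kernel l x) \<le>
      (cmod (\<Sum>k\<in>{..<2 * j}. cis (real k * x)))\<^sup>2 + (cmod (\<Sum>k\<in>{..<j}. cis (real k * x)))\<^sup>2"
    by (simp only: norm_of_real) (simp only: abs_le_iff, simp add: add_increasing le_diff_eq add_increasing2)
  then show ?thesis
    by (simp add: VP_kernel_def VP_majorant_def norm_divide divide_right_mono)
qed

lemma multiplier_kernel_VP_majorant:
  assumes "1 \<le> j"
  shows "multiplier_kernel {0} (freqs (2 * j - 1)) 3 (\<lambda>x. of_real (VP_majorant j x))"
proof -
  have D: "multiplier_kernel {0} (freqs (2 * j - 1)) 1 (dirichlet_kernel l)" if "l < 2 * j" for l
    using multiplier_kernel_dirichlet[of 0 l "2*j-1"] that by (simp add: freqs_def)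
  have K: "multiplier_kernel {0} (freqs (2 * j - 1)) (of_nat n) (\<lambda>x. \<Sum>l<n. 1 * dirichlet_kernel l x)" if "n \<le> 2 * j" for n
  proof -
    have "multiplier_kernel {0} (freqs (2 * j - 1)) (\<Sum>l<n. 1 * 1) (\<lambda>x. \<Sum>l<n. 1 * dirichlet_kernel l x)"
      using that zero_in_freqs by (intro multiplier_kernel_sum D) auto
    then show ?thesis by simp
  qed
  have "multiplier_kernel {0} (freqs (2 * j - 1)) (\<Sum>n\<in>{j, 2*j}. (1 / of_nat j) * of_nat n)
       (\<lambda>x. \<Sum>n\<in>{j, 2*j}. (1 / of_nat j) * (\<Sum>l<n. 1 * dirichlet_kernel l x))"
    using zero_in_freqs by (intro multiplier_kernel_sum K) auto
  moreover have "(\<Sum>n\<in>{j, 2*j}. (1 / of_nat j) * complex_of_nat n) = 3"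
    using assms by (simp add: field_simps)
  moreover have "(\<Sum>n\<in>{j, 2*j}. (1 / of_nat j) * (\<Sum>l<n. 1 * dirichlet_kernel l x)) = of_real (VP_majorant j x)" for x
    using assms by (simp add: VP_majorant_def sum_dirichlet_kernel add_divide_distrib)
  ultimately show ?thesis by simp
qed

section \<open>Equispaced nodes and approximation in two variables\<close>

text \<open>The shift \<open>\<theta>\<close> serves two purposes: \<open>\<theta> = - pi\<close> keeps the nodes in \<open>[- pi, pi)\<close>, where \<open>\<bar>h\<bar>\<close> is
comparable with \<open>cmod (1 - cis h)\<close>, and \<open>\<theta> = x\<close> describes the translates of the grid.\<close>

definition equi_node :: "real \<Rightarrow> nat \<Rightarrow> nat \<Rightarrow> real" where
  "equi_node \<theta> M m = \<theta> + 2 * pi * m / M"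

lemma sum_cis_equi_node:
  fixes k :: int
  assumes "k \<noteq> 0" "\<bar>k\<bar> < int M"
  shows "(\<Sum>m<M. cis (of_int k * equi_node \<theta> M m)) = 0"
proof -
  have M: "M > 0" using assms by auto
  let ?z = "cis (2 * pi * of_int k / M)"
  have "?z \<noteq> 1"
  proof
    assume "?z = 1"
    then have "cos (2 * pi * of_int k / M) = 1" by (simp add: complex_eq_iff)
    then obtain x :: int where "2 * pi * of_int k / M = of_int x * 2 * pi"
      using cos_one_2pi_int by auto
    then have "of_int k = of_int x * real M" using M by (simp add: field_simps)
    then have "k = x * int M" by (metis of_int_eq_iff of_int_mult of_int_of_nat_eq)
    then have "int M dvd k" by simp
    then show False using assms zdvd_not_zless[of "\<bar>k\<bar>" "int M"] by auto
  qed
  moreover have "?z ^ M = 1"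
    using M by (simp add: Complex.DeMoivre)
  ultimately have "(\<Sum>m<M. ?z ^ m) = 0"
    by (simp add: geometric_sum)
  moreover have "cis (of_int k * equi_node \<theta> M m) = cis (of_int k * \<theta>) * ?z ^ m" for m
    by (simp add: Complex.DeMoivre cis_mult equi_node_def algebra_simps)
  ultimately show ?thesis by (simp add: sum_distrib_left[symmetric])
qed

lemma exact_nodes_equi_node:
  assumes "L \<subseteq> freqs N" "N < M"
  shows "exact_nodes {..<M} (equi_node \<theta> M) L"
  unfolding exact_nodes_def
proof (intro conjI ballI impI)
  fix m :: real assume "m \<in> L" "m \<noteq> 0"
  then have "m \<in> freqs N" using assms by blast
  then obtain k :: int where "m = of_int k" "k \<in> {- int N..int N}" unfolding freqs_def by blast
  then have "m = of_int k" "\<bar>k\<bar> \<le> int N" by auto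
  then show "(\<Sum>i<M. character m (equi_node \<theta> M i)) = 0"
    using sum_cis_equi_node[of k M \<theta>] \<open>m \<noteq> 0\<close> assms by simp
qed (use assms in auto)

lemma freqs_diff: "m \<in> freqs M \<Longrightarrow> n \<in> freqs N \<Longrightarrow> m - n \<in> freqs (M + N)"
proof -
  assume "m \<in> freqs M" "n \<in> freqs N"
  then obtain i k :: int where "m = of_int i" "n = of_int k" "\<bar>i\<bar> \<le> int M" "\<bar>k\<bar> \<le> int N"
    by (auto simp: freqs_def)
  then show ?thesis
    by (auto simp: freqs_def intro!: image_eqI[of _ _ "i - k"])
qed

lemma uminus_freqs [simp]: "uminus ` freqs N = freqs N"
proof -
  have m: "- x \<in> freqs N" if "x \<in> freqs N" for x
    using freqs_diff[OF zero_in_freqs[of 0] that] by simp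
  show ?thesis
  proof (intro equalityI subsetI)
    fix x assume "x \<in> freqs N"
    from m[OF this] show "x \<in> uminus ` freqs N" by (rule rev_image_eqI) simp
  qed (use m in auto)
qed

text \<open>Products of a polynomial of degree \<open>j\<close> with the kernel have degree at most \<open>3 * j - 1\<close>, so
\<open>3 * j\<close> nodes suffice.\<close>

definition equi_sampling :: "nat \<Rightarrow> (real \<Rightarrow> complex) \<Rightarrow> real \<Rightarrow> complex" where
  "equi_sampling j = sampling {..<3 * j} (equi_node 0 (3 * j)) (VP_kernel j)"

lemma equi_sampling_weight:
  assumes "1 \<le> j"
  shows "(\<Sum>i<3 * j. cmod (VP_kernel j (x - equi_node 0 (3 * j) i))) / card {..<3 * j} \<le> 3"
  using assms multiplier_kernel_VP_majorant[OF assms]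
  by (intro sampling_kernel_bound[where L="freqs (2 * j - 1)" and B="VP_majorant j"]
       norm_VP_kernel_le exact_nodes_equi_node[where N="2 * j - 1"]) simp_all

lemma equi_node_bounds: "m < M \<Longrightarrow> equi_node 0 M m \<in> {0..2 * pi}"
  by (auto simp: equi_node_def field_simps)

lemma equi_sampling_near_best:
  assumes "1 \<le> j" "t \<in> trig_polys (freqs j)" "x \<in> {0..2 * pi}"
    and ft: "\<And>u. u \<in> {0..2 * pi} \<Longrightarrow> cmod (f u - t u) \<le> e"
  shows "cmod (f x - equi_sampling j f x) \<le> 4 * e"
proof -
  have "{m - k |m k. m \<in> freqs j \<and> k \<in> freqs (2 * j - 1)} \<subseteq> freqs (j + (2 * j - 1))"
    using freqs_diff by blast
  then have "exact_nodes {..<3*j} (equi_node 0 (3 * j)) {m - k |m k. m \<in> freqs j \<and> k \<in> freqs (2 * j - 1)}"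
    by (rule exact_nodes_equi_node) (use assms in auto)
  from sampling_near_best[OF multiplier_kernel_VP[OF assms(1)] assms(2) this equi_sampling_weight[OF assms(1)], of f x e]
  show ?thesis
    using assms equi_node_bounds by (auto simp: equi_sampling_def)
qed

lemma norm_equi_sampling_le:
  assumes "1 \<le> j" "0 \<le> e" "\<And>u. u \<in> {0..2 * pi} \<Longrightarrow> cmod (f u) \<le> e"
  shows "cmod (equi_sampling j f x) \<le> 3 * e"
  unfolding equi_sampling_def
  using assms equi_node_bounds
  by (intro norm_sampling_le[OF equi_sampling_weight]) auto

lemma continuous_on_equi_sampling:
  fixes f :: "'a::topological_space \<Rightarrow> real \<Rightarrow> complex"
  assumes "\<And>u. continuous_on S (\<lambda>y. f y u)" "continuous_on S h" "1 \<le> j"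
  shows "continuous_on S (\<lambda>y. equi_sampling j (f y) (h y))"
proof -
  have "continuous_on UNIV (VP_kernel j)"
    using multiplier_kernel_VP[OF assms(3)] continuous_on_trig_polys multiplier_kernel_imp_trig_polys by blast
  then have "continuous_on S (\<lambda>y. VP_kernel j (h y - c))" for c
    by (rule continuous_on_compose2) (auto intro!: continuous_intros assms)
  then show ?thesis
    unfolding equi_sampling_def sampling_def using assms
    by (intro continuous_on_divide continuous_on_sum continuous_on_mult) auto
qed

text \<open>The sections \<open>F y\<close> that can be approximated within \<open>e\<close> need only be dense; continuity of
\<open>equi_sampling\<close> carries the estimate to the others.\<close>

definition slices_approx :: "nat \<Rightarrow> real \<Rightarrow> (real \<Rightarrow> real \<Rightarrow> complex) \<Rightarrow> bool" where
  "slices_approx j e F \<longleftrightarrow> {0..2 * pi} \<subseteq> closure {y \<in> {0..2 * pi}.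
     \<exists>t\<in>trig_polys (freqs j). \<forall>x\<in>{0..2 * pi}. cmod (F y x - t x) \<le> e}"

lemma slices_approx_imp_equi_sampling:
  assumes "slices_approx j e F" "1 \<le> j" and F: "\<And>x. continuous_on UNIV (\<lambda>y. F y x)"
    and "y \<in> {0..2 * pi}" "x \<in> {0..2 * pi}"
  shows "cmod (F y x - equi_sampling j (F y) x) \<le> 4 * e"
proof -
  let ?C = "{y. cmod (F y x - equi_sampling j (F y) x) \<le> 4 * e}"
  have "closed ?C"
    by (intro closed_Collect_le continuous_intros continuous_on_equi_sampling F assms)
  moreover have "{y \<in> {0..2 * pi}. \<exists>t\<in>trig_polys (freqs j). \<forall>x\<in>{0..2 * pi}. cmod (F y x - t x) \<le> e} \<subseteq> ?C"
    using equi_sampling_near_best assms by blast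
  ultimately have "closure {y \<in> {0..2 * pi}. \<exists>t\<in>trig_polys (freqs j). \<forall>x\<in>{0..2 * pi}. cmod (F y x - t x) \<le> e} \<subseteq> ?C"
    by (rule closure_minimal[rotated])
  then show ?thesis using assms unfolding slices_approx_def by blast
qed

text \<open>The approximant is the tensor product of the two one-dimensional operators, and
\<open>f - A B f = (f - A f) + A (f - B f)\<close> with \<open>A\<close> of norm at most 3.\<close>

lemma approx_two_variables:
  fixes f :: "real \<times> real \<Rightarrow> complex"
  assumes f: "continuous_on UNIV f" and j: "1 \<le> j1" "1 \<le> j2"
    and s1: "slices_approx j1 e1 (\<lambda>y x. f (x, y))" and s2: "slices_approx j2 e2 (\<lambda>y x. f (y, x))"
  shows "\<exists>t\<in>trig_polys (freqs (2 * j1 - 1) \<times> freqs (2 * j2 - 1)).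
    \<forall>x\<in>T2. cmod (f x - t x) \<le> 4 * e1 + 12 * e2"
proof -
  define h where "h x y = equi_sampling j2 (\<lambda>v. f (x, v)) y" for x y
  define t where "t x = equi_sampling j1 (\<lambda>u. h u (snd x)) (fst x)" for x
  have "t = (\<lambda>x. \<Sum>i\<in>{..<3*j1} \<times> {..<3*j2}.
       (f (equi_node 0 (3*j1) (fst i), equi_node 0 (3*j2) (snd i)) / (of_nat (3*j1) * of_nat (3*j2))) *
       (VP_kernel j1 (fst x - equi_node 0 (3*j1) (fst i)) * VP_kernel j2 (snd x - equi_node 0 (3*j2) (snd i))))"
    unfolding t_def h_def equi_sampling_def sampling_def
    by (intro ext) (simp add: sum_divide_distrib sum_distrib_right sum_distrib_left mult_ac sum.cartesian_product case_prod_unfold)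
  moreover have "(\<lambda>x. VP_kernel j1 (fst x - c) * VP_kernel j2 (snd x - d)) \<in> trig_polys (freqs (2 * j1 - 1) \<times> freqs (2 * j2 - 1))" for c d
    using j by (intro trig_polys_tensor trig_polys_translate multiplier_kernel_imp_trig_polys[OF multiplier_kernel_VP])
  ultimately have t: "t \<in> trig_polys (freqs (2 * j1 - 1) \<times> freqs (2 * j2 - 1))"
    by (simp only:, intro trig_polys_sum) auto
  have c: "continuous_on UNIV (\<lambda>y. f (x, y))" "continuous_on UNIV (\<lambda>y. f (y, x))" for x
    by (rule continuous_on_compose2[OF f], auto intro!: continuous_intros)+
  have "cmod (f x - t x) \<le> 4 * e1 + 12 * e2" if "x \<in> T2" for x
  proof -
    obtain u v where x: "x = (u, v)" "u \<in> {0..2*pi}" "v \<in> {0..2*pi}" using \<open>x \<in> T2\<close> by (auto simp: T2_def)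
    have 1: "cmod (f (u, v) - equi_sampling j1 (\<lambda>u. f (u, v)) u) \<le> 4 * e1"
      by (rule slices_approx_imp_equi_sampling[OF s1 j(1) c(1) x(3,2)])
    have 2: "cmod (f (u', v) - h u' v) \<le> 4 * e2" if "u' \<in> {0..2 * pi}" for u'
      unfolding h_def by (rule slices_approx_imp_equi_sampling[OF s2 j(2) c(2) that x(3)])
    have "0 \<le> 4 * e2" using 2[OF x(2)] norm_ge_zero order_trans by blast
    then have "cmod (equi_sampling j1 (\<lambda>u. f (u, v) - h u v) u) \<le> 3 * (4 * e2)"
      using 2 by (intro norm_equi_sampling_le j) auto
    moreover have "equi_sampling j1 (\<lambda>u. f (u, v) - h u v) u = equi_sampling j1 (\<lambda>u. f (u, v)) u - t x"
      by (simp add: t_def x equi_sampling_def sampling_def left_diff_distrib sum_subtractf diff_divide_distrib)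
    ultimately have "cmod (equi_sampling j1 (\<lambda>u. f (u, v)) u - t x) \<le> 12 * e2" by simp
    then show ?thesis
      using 1 norm_triangle_ineq[of "f x - equi_sampling j1 (\<lambda>u. f (u, v)) u" "equi_sampling j1 (\<lambda>u. f (u, v)) u - t x"]
      by (simp add: x)
  qed
  with t show ?thesis by blast
qed

section \<open>Fibonacci nodes\<close>

text \<open>By Fubini the integral factors, and one of the two factors is an integral of a nonconstant character
over a period.\<close>

lemma lebesgue_integral_character:
  fixes k :: "int \<times> int"
  assumes "k \<noteq> 0"
  shows "(LINT x|lebesgue_on T2. cis (of_int (fst k) * fst x + of_int (snd k) * snd x)) = 0"
proof -
  have one: "integral {0..2*pi} (\<lambda>x. cis (of_int n * x)) = 0" if "n \<noteq> 0" for n :: int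
  proof -
    have "((\<lambda>x. cis (of_int n * x)) has_integral
        (cis (of_int n * (2 * pi)) / (\<i> * of_int n) - cis (of_int n * 0) / (\<i> * of_int n))) {0..2*pi}"
      using that
      by (intro fundamental_theorem_of_calculus)
         (auto intro!: derivative_eq_intros simp: has_vector_derivative_def scaleR_conv_of_real field_simps)
    moreover have "cis (of_int n * (2 * pi)) = 1"
      using cis_multiple_2pi[of "of_int n"] by (simp add: mult_ac)
    ultimately show ?thesis by (simp add: integral_unique)
  qed
  let ?f = "\<lambda>x::real\<times>real. cis (of_int (fst k) * fst x + of_int (snd k) * snd x)"
  have T2: "T2 = cbox (0, 0) (2 * pi, 2 * pi)" by (simp add: T2_def cbox_Pair_eq)
  have cont: "continuous_on S ?f" for S
    by (auto simp: cis_conv_exp intro!: continuous_intros)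
  have "integrable (lebesgue_on T2) ?f"
    unfolding T2 by (intro continuous_imp_integrable cont)
  then have "(LINT x|lebesgue_on T2. ?f x) = integral T2 ?f"
    by (rule lebesgue_integral_eq_integral) (simp add: T2)
  also have "\<dots> = integral {0..2*pi} (\<lambda>x. integral {0..2*pi} (\<lambda>y. ?f (x, y)))"
    unfolding T2 by (subst integral_prod_continuous[OF cont]) simp
  also have "\<dots> = integral {0..2*pi} (\<lambda>x. cis (of_int (fst k) * x) * integral {0..2*pi} (\<lambda>y. cis (of_int (snd k) * y)))"
    by (simp flip: cis_mult)
  also have "\<dots> = integral {0..2*pi} (\<lambda>x. cis (of_int (fst k) * x)) * integral {0..2*pi} (\<lambda>y. cis (of_int (snd k) * y))"
    by simp
  also have "\<dots> = 0" using assms one[of "fst k"] one[of "snd k"] by (auto simp: prod_eq_iff)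
  finally show ?thesis .
qed

text \<open>A box lies in the hyperbolic cross whose order is the product of its half sides.\<close>

lemma fib_exact_imp_exact_nodes:
  assumes "fib_exact \<gamma>" "n > 2" "1 \<le> M" "real M \<le> \<gamma> * real (b n)" "M1 * M2 \<le> M" "1 \<le> M1" "1 \<le> M2"
    and L: "L \<subseteq> freqs M1 \<times> freqs M2"
  shows "exact_nodes {1..b n} (fib_point n) L"
  unfolding exact_nodes_def
proof (intro conjI ballI impI)
  have b: "b n \<ge> 1" by (simp add: b_def fib_neq_0_nat Suc_le_eq)
  then show "{1..b n} \<noteq> {}" by simp
  fix m :: "real \<times> real" assume "m \<in> L" "m \<noteq> 0"
  then obtain k :: "int \<times> int" where k: "m = (of_int (fst k), of_int (snd k))"
    "\<bar>fst k\<bar> \<le> int M1" "\<bar>snd k\<bar> \<le> int M2"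
  proof -
    have "fst m \<in> freqs M1" "snd m \<in> freqs M2" using L \<open>m \<in> L\<close> by auto
    then obtain i j :: int where ij: "fst m = of_int i" "i \<in> {- int M1..int M1}" "snd m = of_int j" "j \<in> {- int M2..int M2}"
      unfolding freqs_def by blast
    then show thesis by (intro that[of "(i, j)"]) (auto simp: prod_eq_iff)
  qed
  have "max \<bar>fst k\<bar> 1 * max \<bar>snd k\<bar> 1 \<le> int M1 * int M2"
    using k assms by (intro mult_mono) auto
  also have "\<dots> \<le> int M" using assms(5) by (metis of_nat_le_iff of_nat_mult)
  finally have kM: "k \<in> hyperbolic_cross M" by (auto simp: hyperbolic_cross_def case_prod_unfold)
  have "trig_poly (hyperbolic_cross M) (\<lambda>i. if i = k then 1 else 0) x = character m x" for x
    using kM finite_hyperbolic_cross[of M]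
    by (simp add: trig_poly_def k inner_prod_def if_distrib[of "\<lambda>c. c * _"] cong: if_cong)
  moreover have "(LINT x|lebesgue_on T2. character m x) = 0"
    using lebesgue_integral_character[of k] \<open>m \<noteq> 0\<close> by (auto simp: k inner_prod_def prod_eq_iff zero_prod_def)
  moreover have "(\<Sum>\<nu>=1..b n. trig_poly (hyperbolic_cross M) (\<lambda>i. if i = k then 1 else 0) (fib_point n \<nu>)) / of_nat (b n)
        = (LINT x|lebesgue_on T2. trig_poly (hyperbolic_cross M) (\<lambda>i. if i = k then 1 else 0) x) / (2 * pi)^2"
    using assms unfolding fib_exact_def by blast
  ultimately have "(\<Sum>\<nu>=1..b n. character m (fib_point n \<nu>)) / of_nat (b n) = 0"
    by (simp only:) simp
  then show "(\<Sum>i\<in>{1..b n}. character m (fib_point n i)) = 0" using b by simp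
qed simp

lemma V_eq_sampling: "V n s f = sampling {1..b n} (fib_point n) (VP_kernel2 (2 ^ fst s, 2 ^ snd s)) f"
  by (simp add: V_def sampling_def fun_eq_iff)

lemma fib_point_in_T2:
  assumes "\<nu> \<in> {1..b n}" shows "fib_point n \<nu> \<in> T2"
proof -
  have "0 \<le> frac x" "frac x \<le> 1" for x :: real
    using frac_lt_1[of x] by auto
  then show ?thesis
    using assms by (auto simp: fib_point_def T2_def field_simps)
qed

text \<open>The frequencies that exactness has to cover are below \<open>3 * 2 ^ s1\<close> and \<open>3 * 2 ^ s2\<close>; this is the
origin of the factor 9 in the definition of \<open>n'\<close>. The factor 10 is \<open>1 + 3 * 3\<close>.\<close>

lemma V_near_best:
  assumes "fib_exact \<gamma>" "n > 2" "9 * 2 ^ (s1 + s2) \<le> \<gamma> * real (b n)"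
    and t: "t \<in> trig_polys (freqs (2 ^ s1) \<times> freqs (2 ^ s2))"
    and ft: "\<And>u. u \<in> T2 \<Longrightarrow> cmod (f u - t u) \<le> e" and "x \<in> T2"
  shows "cmod (f x - V n (s1, s2) f x) \<le> 10 * e"
proof -
  let ?N1 = "2 ^ s1 :: nat" and ?N2 = "2 ^ s2 :: nat"
  let ?L = "freqs (2 * ?N1 - 1) \<times> freqs (2 * ?N2 - 1)"
  have ex: "exact_nodes {1..b n} (fib_point n) L" if "L \<subseteq> freqs (3 * ?N1) \<times> freqs (3 * ?N2)" for L
    using assms(3) by (intro fib_exact_imp_exact_nodes[OF assms(1,2) _ _ _ _ _ that, where M="9 * 2 ^ (s1 + s2)"])
       (auto simp: power_add)
  have K: "multiplier_kernel (freqs ?N1 \<times> freqs ?N2) ?L 1 (VP_kernel2 (?N1, ?N2))"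
    using multiplier_kernel_tensor[OF multiplier_kernel_VP[of ?N1] multiplier_kernel_VP[of ?N2]]
    by (simp add: VP_kernel2_def[abs_def])
  have B: "multiplier_kernel {0} ?L (of_real 9) (\<lambda>x. of_real (VP_majorant ?N1 (fst x) * VP_majorant ?N2 (snd x)))"
    using multiplier_kernel_tensor[OF multiplier_kernel_VP_majorant[of ?N1] multiplier_kernel_VP_majorant[of ?N2]]
    by (simp add: zero_prod_def)
  have d: "{m - k |m k. m \<in> freqs ?N1 \<times> freqs ?N2 \<and> k \<in> ?L} \<subseteq> freqs (3 * ?N1) \<times> freqs (3 * ?N2)"
  proof safe
    fix a1 b1 a2 b2 c d assume *: "a1 \<in> freqs ?N1" "b1 \<in> freqs ?N2" "a2 \<in> freqs (2 * ?N1 - 1)" "b2 \<in> freqs (2 * ?N2 - 1)"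
      "(c, d) = (a1, b1) - (a2, b2)"
    have "a1 - a2 \<in> freqs (3 * ?N1)" "b1 - b2 \<in> freqs (3 * ?N2)"
      using freqs_diff[OF *(1,3)] freqs_diff[OF *(2,4)] freqs_mono[of "?N1 + (2 * ?N1 - 1)" "3 * ?N1"]
        freqs_mono[of "?N2 + (2 * ?N2 - 1)" "3 * ?N2"] by auto
    then show "c \<in> freqs (3 * ?N1)" "d \<in> freqs (3 * ?N2)" using * by auto
  qed
  have le: "2 * ?N1 - 1 \<le> 3 * ?N1" "2 * ?N2 - 1 \<le> 3 * ?N2" by simp_all
  have u: "uminus ` ?L \<subseteq> freqs (3 * ?N1) \<times> freqs (3 * ?N2)"
  proof safe
    fix a1 b1 c d assume *: "a1 \<in> freqs (2 * ?N1 - 1)" "b1 \<in> freqs (2 * ?N2 - 1)" "(c, d) = - (a1, b1)"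
    then have "c \<in> freqs (2 * ?N1 - 1)" "d \<in> freqs (2 * ?N2 - 1)"
      using uminus_freqs imageI[of _ _ uminus] by (metis * Pair_inject uminus_Pair)+
    then show "c \<in> freqs (3 * ?N1)" "d \<in> freqs (3 * ?N2)"
      using freqs_mono[OF le(1)] freqs_mono[OF le(2)] by blast+
  qed
  have "cmod (VP_kernel2 (?N1, ?N2) x) \<le> VP_majorant ?N1 (fst x) * VP_majorant ?N2 (snd x)" for x
    unfolding VP_kernel2_def norm_mult fst_conv snd_conv
    by (intro mult_mono norm_VP_kernel_le) (auto simp: VP_majorant_def)
  from sampling_kernel_bound[OF B this ex[OF u], of x]
  have "(\<Sum>i\<in>{1..b n}. cmod (VP_kernel2 (?N1, ?N2) (x - fib_point n i))) / card {1..b n} \<le> 9" .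
  from sampling_near_best[OF K t ex[OF d] this, of f e] ft fib_point_in_T2 \<open>x \<in> T2\<close>
  show ?thesis by (simp add: V_eq_sampling)
qed

lemma power_n':
  assumes "\<gamma> * real (b n) \<ge> 18"
  shows "2 ^ n' \<gamma> n \<le> \<gamma> * real (b n) / 9" "\<gamma> * real (b n) / 9 < 2 * 2 ^ n' \<gamma> n"
proof -
  let ?P = "\<lambda>m. 2 ^ m \<le> \<gamma> * real (b n) / 9"
  obtain M where M: "\<gamma> * real (b n) / 9 < 2 ^ M"
    using real_arch_pow[of 2 "\<gamma> * real (b n) / 9"] by auto
  have bd: "\<forall>m. ?P m \<longrightarrow> m \<le> M"
  proof (intro allI impI)
    fix m assume "?P m"
    then have "(2::real) ^ m < 2 ^ M" using M by linarith
    then show "m \<le> M" by simp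
  qed
  have "?P 0" using assms by simp
  then show "2 ^ n' \<gamma> n \<le> \<gamma> * real (b n) / 9"
    unfolding n'_def by (rule GreatestI_nat[where P="?P"]) (use bd in auto)
  have "\<not> ?P (Suc (n' \<gamma> n))"
  proof
    assume "?P (Suc (n' \<gamma> n))"
    then have "Suc (n' \<gamma> n) \<le> (GREATEST m. ?P m)" by (rule Greatest_le_nat) (use bd in auto)
    then show False by (simp add: n'_def)
  qed
  then show "\<gamma> * real (b n) / 9 < 2 * 2 ^ n' \<gamma> n" by simp
qed

lemma sup_norm_Vn_le:
  assumes "u \<in> Vn \<gamma> n f" "fst s + snd s = n' \<gamma> n"
    and "\<And>x. x \<in> T2 \<Longrightarrow> cmod (f x - V n s f x) \<le> e"
  shows "sup_norm (\<lambda>x. f x - u x) \<le> e"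
proof -
  obtain s' where "u = V n s' f" "optimal_index \<gamma> n f s'" using assms(1) by (auto simp: Vn_def)
  then have "sup_norm (\<lambda>x. f x - u x) \<le> sup_norm (\<lambda>x. f x - V n s f x)"
    using assms(2) unfolding optimal_index_def is_arg_min_def not_less by (meson linorder_not_le)
  also have "\<dots> \<le> e"
    unfolding sup_norm_def using assms(3)
    by (intro cSUP_least) (auto simp: T2_def intro: exI[of _ "(0, 0)"])
  finally show ?thesis .
qed

section \<open>Jackson kernels\<close>

text \<open>A chord is comparable with its arc; the constant 2 is not optimal, but follows from the cubic Taylor
bound of the sine.\<close>

lemma norm_one_minus_cis_ge:
  assumes "\<bar>x\<bar> \<le> pi"
  shows "\<bar>x\<bar> \<le> 2 * cmod (1 - cis x)"
proof -
  have pos: "y / 2 \<le> sin y" if "0 \<le> y" "y \<le> pi / 2" for y :: real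
  proof -
    have "\<bar>sin y - (\<Sum>m<3. sin_coeff m * y ^ m)\<bar> \<le> inverse (fact 3) * \<bar>y\<bar> ^ 3"
      by (rule Maclaurin_sin_bound)
    then have "\<bar>sin y - y\<bar> \<le> y ^ 3 / 6"
      using that by (simp add: sin_coeff_def eval_nat_numeral)
    moreover have "y < 1.6" using that pi_approx by simp
    then have "y * y \<le> 3"
      using that mult_mono[of y "1.6" y "1.6"] by simp
    then have "y * (y * y) \<le> y * 3" using that by (intro mult_left_mono) auto
    then have "y ^ 3 / 6 \<le> y / 2" by (simp add: eval_nat_numeral)
    ultimately show ?thesis by linarith
  qed
  have s: "\<bar>x\<bar> / 4 \<le> \<bar>sin (x / 2)\<bar>"
    using pos[of "\<bar>x\<bar> / 2"] assms by (cases "0 \<le> x") auto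
  have "(cmod (1 - cis x))\<^sup>2 = 2 - 2 * cos x"
    unfolding cmod_power2 using sin_cos_squared_add3[of x] by (simp add: power2_eq_square algebra_simps)
  also have "\<dots> = (2 * \<bar>sin (x / 2)\<bar>)\<^sup>2"
    using cos_double_sin[of "x / 2"] by (simp add: power_mult_distrib)
  finally have "cmod (1 - cis x) = 2 * \<bar>sin (x / 2)\<bar>"
    by (rule power2_eq_imp_eq) auto
  then show ?thesis using s by simp
qed

lemma poly_eq_sum_le:
  fixes P :: "'a::comm_semiring_1 poly"
  assumes "degree P \<le> d"
  shows "poly P z = (\<Sum>i\<le>d. coeff P i * z ^ i)"
  unfolding poly_altdef
  using assms by (intro sum.mono_neutral_left) (auto simp: coeff_eq_0)

lemma of_real_norm_poly_cis:
  assumes "degree P \<le> d"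
  shows "complex_of_real ((cmod (poly P (cis x)))\<^sup>2) =
     (\<Sum>i\<le>d. \<Sum>j\<le>d. coeff P i * cnj (coeff P j) * cis (of_int (int i - int j) * x))"
proof -
  have "poly P (cis x) = (\<Sum>i\<le>d. coeff P i * cis x ^ i)"
    by (rule poly_eq_sum_le) (rule assms)
  then have e: "poly P (cis x) = (\<Sum>i\<le>d. coeff P i * cis (real i * x))"
    by (simp add: Complex.DeMoivre)
  have "complex_of_real ((cmod (poly P (cis x)))\<^sup>2) = poly P (cis x) * cnj (poly P (cis x))"
    by (rule complex_norm_square)
  also have "\<dots> = (\<Sum>i\<le>d. \<Sum>j\<le>d. coeff P i * cnj (coeff P j) * cis (of_int (int i - int j) * x))"
    unfolding e cnj_sum complex_cnj_mult cis_cnj sum_product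
    by (intro sum.cong refl) (simp add: cis_mult left_diff_distrib)
  finally show ?thesis .
qed

lemma norm_poly_cis_in_trig_polys:
  assumes "degree P \<le> d"
  shows "(\<lambda>x. complex_of_real ((cmod (poly P (cis x)))\<^sup>2)) \<in> trig_polys (freqs d)"
proof -
  have "(\<lambda>x. cis (of_int (int i - int j) * x)) \<in> trig_polys (freqs d)" if "i \<le> d" "j \<le> d" for i j
  proof -
    have m: "real_of_int (int i - int j) \<in> freqs d"
      unfolding freqs_def by (rule imageI) (use that in auto)
    then show ?thesis
      using character_in_trig_polys[OF finite_freqs m, of 1] by simp
  qed
  then have "(\<lambda>x. \<Sum>ij\<in>{..d} \<times> {..d}. coeff P (fst ij) * cnj (coeff P (snd ij)) *
      cis (of_int (int (fst ij) - int (snd ij)) * x)) \<in> trig_polys (freqs d)"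
    by (intro trig_polys_sum) auto
  then show ?thesis
    by (simp only: of_real_norm_poly_cis[OF assms] sum.cartesian_product case_prod_unfold)
qed

text \<open>Parseval's identity on the grid: there is no aliasing as long as the number of nodes exceeds the
degree.\<close>

lemma sum_norm_poly_equi_node:
  assumes "degree P \<le> d" "d < M"
  shows "(\<Sum>m<M. (cmod (poly P (cis (equi_node \<theta> M m))))\<^sup>2) = M * (\<Sum>i\<le>d. (cmod (coeff P i))\<^sup>2)"
proof -
  have "complex_of_real (\<Sum>m<M. (cmod (poly P (cis (equi_node \<theta> M m))))\<^sup>2) =
    (\<Sum>m<M. \<Sum>i\<le>d. \<Sum>j\<le>d. coeff P i * cnj (coeff P j) * cis (of_int (int i - int j) * equi_node \<theta> M m))"
    unfolding of_real_sum of_real_norm_poly_cis[OF assms(1)] ..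
  also have "\<dots> = (\<Sum>i\<le>d. \<Sum>j\<le>d. coeff P i * cnj (coeff P j) * (\<Sum>m<M. cis (of_int (int i - int j) * equi_node \<theta> M m)))"
    unfolding sum_distrib_left by (subst sum.swap, rule sum.cong[OF refl], rule sum.swap)
  also have "\<dots> = (\<Sum>i\<le>d. \<Sum>j\<le>d. coeff P i * cnj (coeff P j) * (if j = i then of_nat M else 0))"
  proof (intro sum.cong refl)
    fix i j assume "i \<in> {..d}" "j \<in> {..d}"
    then show "coeff P i * cnj (coeff P j) * (\<Sum>m<M. cis (of_int (int i - int j) * equi_node \<theta> M m)) =
      coeff P i * cnj (coeff P j) * (if j = i then of_nat M else 0)"
      using sum_cis_equi_node[of "int i - int j" M \<theta>] assms by (cases "i = j") auto
  qed
  also have "\<dots> = (\<Sum>i\<le>d. coeff P i * cnj (coeff P i) * of_nat M)"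
    by (simp add: if_distrib cong: if_cong)
  also have "\<dots> = complex_of_real (M * (\<Sum>i\<le>d. (cmod (coeff P i))\<^sup>2))"
    by (simp only: complex_norm_square[symmetric] of_real_mult of_real_sum sum_distrib_left of_real_of_nat_eq mult.commute)
  finally show ?thesis by (simp only: of_real_eq_iff)
qed

text \<open>Cauchy-Schwarz inequality for the sum of the coefficients. It bounds the normalizing factor of the
Jackson kernel from below.\<close>

lemma sum_norm_coeff_ge:
  assumes "degree P \<le> d"
  shows "(cmod (poly P 1))\<^sup>2 \<le> (d + 1) * (\<Sum>i\<le>d. (cmod (coeff P i))\<^sup>2)"
proof -
  have "poly P 1 = (\<Sum>i\<le>d. coeff P i)"
    using poly_eq_sum_le[OF assms, of 1] by simp
  then have "(cmod (poly P 1))\<^sup>2 \<le> (\<Sum>i\<le>d. cmod (coeff P i))\<^sup>2"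
    by (simp add: norm_sum power_mono)
  also have "\<dots> \<le> (\<Sum>i\<le>d. (cmod (coeff P i))\<^sup>2) * card {..d}"
    by (rule sum_squared_le_sum_of_squares)
  finally show ?thesis by (simp add: mult.commute add.commute)
qed

definition geo_poly :: "nat \<Rightarrow> complex poly" where
  "geo_poly N = (\<Sum>j<N. monom 1 j)"

lemma coeff_geo_poly: "coeff (geo_poly N) i = (if i < N then 1 else 0)"
  by (simp add: geo_poly_def coeff_sum)

lemma degree_geo_poly: "degree (geo_poly N) \<le> N - 1"
  by (intro degree_le) (auto simp: coeff_geo_poly)

lemma poly_geo_poly: "(1 - z) * poly (geo_poly N) z = 1 - z ^ N"
  by (simp add: geo_poly_def poly_sum poly_monom one_diff_power_eq)

lemma poly_geo_poly_1: "poly (geo_poly N) 1 = of_nat N"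
  by (simp add: geo_poly_def poly_sum poly_monom)

text \<open>The last condition is the moment of order \<open>2 * q\<close>, of the size \<open>N ^ - (2 * q)\<close> as for a
distribution concentrated at the distance \<open>1 / N\<close> from the origin.\<close>

definition jackson_kernel :: "nat \<Rightarrow> nat \<Rightarrow> (real \<Rightarrow> real) \<Rightarrow> bool" where
  "jackson_kernel q N \<kappa> \<longleftrightarrow>
     (\<forall>x. 0 \<le> \<kappa> x) \<and>
     (\<lambda>x. complex_of_real (\<kappa> x)) \<in> trig_polys (freqs (Suc q * (N - 1))) \<and>
     (\<forall>M \<theta>. Suc q * (N - 1) < M \<longrightarrow>
        (\<Sum>m<M. \<kappa> (equi_node \<theta> M m)) = real M \<and>
        (\<Sum>m<M. \<kappa> (equi_node \<theta> M m) * cmod (1 - cis (equi_node \<theta> M m)) ^ (2 * q)) * real N ^ (2 * q)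
          \<le> real M * (real (Suc q) * 4 ^ q))"

text \<open>The kernel is \<open>\<bar>Q (cis x)\<bar> ^ (2 * Suc q)\<close> up to normalization, with \<open>Q = 1 + z + \<dots> + z ^ (N - 1)\<close>.
In its moment, \<open>q\<close> pairs of factors \<open>Q\<close> cancel against \<open>1 - z\<close> because \<open>(1 - z) * Q = 1 - z ^ N\<close> is
bounded by 2; Parseval's identity evaluates the remaining \<open>\<bar>Q\<bar>\<^sup>2\<close> as \<open>N\<close>.\<close>

lemma jackson_kernel_exists:
  assumes N: "1 \<le> N"
  shows "\<exists>\<kappa>. jackson_kernel q N \<kappa>"
proof -
  let ?Q = "geo_poly N" and ?d = "Suc q * (N - 1)"
  define P where "P = ?Q ^ Suc q"
  define S where "S = (\<Sum>i\<le>?d. (cmod (coeff P i))\<^sup>2)"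
  have deg: "degree P \<le> ?d"
    unfolding P_def using degree_power_le[of ?Q "Suc q"] degree_geo_poly[of N]
    by (metis le_trans mult.commute mult_le_mono2)
  have "real N ^ (2 * Suc q) = (cmod (poly P 1))\<^sup>2"
    by (simp only: P_def poly_power poly_geo_poly_1 norm_power norm_of_nat power_mult[symmetric] mult.commute)
  also have "\<dots> \<le> (?d + 1) * S"
    unfolding S_def using sum_norm_coeff_ge[OF deg] by (simp only: of_nat_add of_nat_1)
  also have "\<dots> \<le> (Suc q * N) * S"
  proof (intro mult_right_mono)
    have "?d + 1 \<le> Suc q * N" using N by (cases N) auto
    then show "real (?d + 1) \<le> real (Suc q * N)" by (simp only: of_nat_le_iff)
  qed (auto simp: S_def intro: sum_nonneg)
  finally have S: "real N ^ (2 * Suc q) \<le> Suc q * N * S" .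
  have "0 < real N ^ (2 * Suc q)" using N by simp
  with S have "0 < Suc q * N * S" by linarith
  then have S0: "0 < S" by (rule zero_less_mult_pos) (use N in \<open>auto intro!: add_pos_nonneg\<close>)
  define \<kappa> where "\<kappa> x = (cmod (poly P (cis x)))\<^sup>2 / S" for x
  show ?thesis
    unfolding jackson_kernel_def
  proof (intro exI[of _ \<kappa>] conjI allI impI)
    show "0 \<le> \<kappa> x" for x using S0 by (simp add: \<kappa>_def)
    have "(\<lambda>x. \<Sum>i\<in>{()}. (1 / of_real S) * complex_of_real ((cmod (poly P (cis x)))\<^sup>2)) \<in> trig_polys (freqs ?d)"
      by (intro trig_polys_sum norm_poly_cis_in_trig_polys deg) auto
    then show "(\<lambda>x. complex_of_real (\<kappa> x)) \<in> trig_polys (freqs ?d)"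
      by (simp add: \<kappa>_def)
  next
    fix M \<theta> assume M: "?d < M"
    show "(\<Sum>m<M. \<kappa> (equi_node \<theta> M m)) = M"
      unfolding \<kappa>_def sum_divide_distrib[symmetric] sum_norm_poly_equi_node[OF deg M] S_def[symmetric]
      using S0 by simp
    have le: "\<kappa> x * cmod (1 - cis x) ^ (2 * q) \<le> 4 ^ q * (cmod (poly ?Q (cis x)))\<^sup>2 / S" for x
    proof -
      have "cmod (1 - cis x ^ N) \<le> 2"
        using norm_triangle_ineq4[of 1 "cis x ^ N"] by (simp add: norm_power)
      then have "cmod (1 - cis x ^ N) ^ (2 * q) \<le> 2 ^ (2 * q)" by (intro power_mono) auto
      then have "cmod (1 - cis x ^ N) ^ (2 * q) \<le> 4 ^ q" by (simp add: power_mult)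
      moreover have "(cmod (poly P (cis x)))\<^sup>2 * cmod (1 - cis x) ^ (2 * q) =
          cmod (1 - cis x ^ N) ^ (2 * q) * (cmod (poly ?Q (cis x)))\<^sup>2"
      proof -
        have "(a ^ Suc q)\<^sup>2 * c ^ (2 * q) = (c * a) ^ (2 * q) * a\<^sup>2" for a c :: real
          by (simp only: power_mult power_mult_distrib power2_eq_square power_Suc) (simp only: mult_ac)
        then show ?thesis
          by (simp only: P_def poly_power norm_power poly_geo_poly[symmetric] norm_mult)
      qed
      ultimately have "(cmod (poly P (cis x)))\<^sup>2 * cmod (1 - cis x) ^ (2 * q) \<le> 4 ^ q * (cmod (poly ?Q (cis x)))\<^sup>2"
        by (simp add: mult_right_mono)
      then show ?thesis using S0 by (simp add: \<kappa>_def divide_right_mono)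
    qed
    have M': "N - 1 < M" using M by auto
    have "{..N - 1} = {..<N}" using N by auto
    then have Qs: "(\<Sum>m<M. (cmod (poly ?Q (cis (equi_node \<theta> M m))))\<^sup>2) = M * N"
      using sum_norm_poly_equi_node[OF degree_geo_poly M', of \<theta>] by (simp add: coeff_geo_poly)
    have "(\<Sum>m<M. \<kappa> (equi_node \<theta> M m) * cmod (1 - cis (equi_node \<theta> M m)) ^ (2 * q)) * N ^ (2 * q)
      \<le> (\<Sum>m<M. 4 ^ q * (cmod (poly ?Q (cis (equi_node \<theta> M m))))\<^sup>2 / S) * N ^ (2 * q)"
      by (intro mult_right_mono sum_mono le) auto
    also have "\<dots> = 4 ^ q * M * (N * N ^ (2 * q) / S)"
      unfolding sum_divide_distrib[symmetric] sum_distrib_left[symmetric] Qs by simp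
    also have "\<dots> \<le> 4 ^ q * M * real (Suc q)"
    proof (rule mult_left_mono)
      have "real N * real N ^ (2 * q) * real N \<le> (Suc q * S) * real N"
        using S by (simp add: algebra_simps)
      then have "real N * real N ^ (2 * q) \<le> Suc q * S"
        using N by (simp only: mult_le_cancel_right)
      then show "N * N ^ (2 * q) / S \<le> real (Suc q)" using S0 by (simp add: divide_le_eq)
    qed simp
    finally show "(\<Sum>m<M. \<kappa> (equi_node \<theta> M m) * cmod (1 - cis (equi_node \<theta> M m)) ^ (2 * q)) * real N ^ (2 * q)
      \<le> real M * (real (Suc q) * 4 ^ q)"
      by (simp add: algebra_simps)
  qed
qed

lemma jackson_kernelD:
  assumes "jackson_kernel q N \<kappa>"
  shows "0 \<le> \<kappa> x"
    and "(\<lambda>x. complex_of_real (\<kappa> x)) \<in> trig_polys (freqs (Suc q * (N - 1)))"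
    and "Suc q * (N - 1) < M \<Longrightarrow> (\<Sum>m<M. \<kappa> (equi_node \<theta> M m)) = real M"
    and "Suc q * (N - 1) < M \<Longrightarrow>
      (\<Sum>m<M. \<kappa> (equi_node \<theta> M m) * cmod (1 - cis (equi_node \<theta> M m)) ^ (2 * q)) * real N ^ (2 * q)
        \<le> real M * (real (Suc q) * 4 ^ q)"
  using assms unfolding jackson_kernel_def by blast+

section \<open>Jackson's theorem for functions with small differences\<close>

lemma periodic_shift_int:
  fixes f :: "real \<Rightarrow> 'a"
  assumes "\<And>x. f (x + 2 * pi) = f x"
  shows "f (x + 2 * pi * of_int k) = f x"
proof -
  have n: "f (x + 2 * pi * real n) = f x" for n x
  proof (induction n)
    case (Suc n)
    have "x + 2 * pi * real (Suc n) = (x + 2 * pi * real n) + 2 * pi" by (simp add: algebra_simps)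
    then show ?case using assms[of "x + 2 * pi * real n"] Suc by metis
  qed simp
  show ?thesis
  proof (cases k rule: int_cases2)
    case (nonneg m) then show ?thesis using n[of x m] by simp
  next
    case (nonpos m) then show ?thesis using n[of "x + 2 * pi * of_int k" m] by simp
  qed
qed

lemma periodic_representative: "\<exists>k::int. \<bar>x - 2 * pi * of_int k\<bar> \<le> pi"
proof
  have "\<bar>x / (2 * pi) - of_int (round (x / (2 * pi)))\<bar> \<le> 1 / 2"
    using of_int_round_abs_le[of "x / (2 * pi)"] by (simp add: abs_minus_commute)
  then have "\<bar>2 * pi\<bar> * \<bar>x / (2 * pi) - of_int (round (x / (2 * pi)))\<bar> \<le> 2 * pi * (1 / 2)"
    by (intro mult_mono) auto
  then show "\<bar>x - 2 * pi * of_int (round (x / (2 * pi)))\<bar> \<le> pi"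
    unfolding abs_mult[symmetric] by (simp add: right_diff_distrib)
qed

lemma cis_shift_int: "cis (x + 2 * pi * of_int k) = cis x"
  by (simp flip: cis_mult)

text \<open>Increments that are not covered by uniform continuity have a chord bounded away from zero, so that
boundedness of \<open>f\<close> controls them.\<close>

lemma periodic_modulus_bound:
  fixes f :: "real \<Rightarrow> complex"
  assumes f: "continuous_on UNIV f" and per: "\<And>x. f (x + 2 * pi) = f x" and e: "0 < e"
  shows "\<exists>A\<ge>0. \<forall>x y. cmod (f x - f y) \<le> e + A * (cmod (1 - cis (x - y)))\<^sup>2"
proof -
  let ?I = "{-2 * pi..2 * pi}"
  have cont: "continuous_on ?I f" using f continuous_on_subset by blast
  obtain \<delta> where \<delta>: "\<delta> > 0" "\<And>x y. x \<in> ?I \<Longrightarrow> y \<in> ?I \<Longrightarrow> dist y x < \<delta> \<Longrightarrow> dist (f y) (f x) < e"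
    using compact_uniformly_continuous[OF cont compact_Icc] e unfolding uniformly_continuous_on_def by metis
  have "bounded (f ` ?I)" using compact_continuous_image[OF cont compact_Icc] compact_imp_bounded by blast
  then obtain B where B: "B > 0" "\<And>x. x \<in> ?I \<Longrightarrow> cmod (f x) \<le> B"
    unfolding bounded_pos by auto
  let ?A = "2 * B * 4 / \<delta>\<^sup>2"
  have "cmod (f x - f y) \<le> e + ?A * (cmod (1 - cis (x - y)))\<^sup>2" for x y
  proof -
    obtain k where k: "\<bar>x - 2 * pi * of_int k\<bar> \<le> pi" using periodic_representative by blast
    obtain l where l: "\<bar>(x - y) - 2 * pi * of_int l\<bar> \<le> pi" using periodic_representative by blast
    define u where "u = x - 2 * pi * of_int k"
    define d where "d = (x - y) - 2 * pi * of_int l"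
    have "f x = f u" using periodic_shift_int[of f, OF per, of u k] by (simp add: u_def)
    moreover have "y = (u - d) + 2 * pi * of_int (k - l)" by (simp add: u_def d_def algebra_simps)
    then have "f y = f (u - d)" using periodic_shift_int[of f, OF per] by metis
    moreover have "x - y = d + 2 * pi * of_int l" by (simp add: d_def)
    then have "cis (x - y) = cis d" using cis_shift_int by metis
    moreover have "cmod (f u - f (u - d)) \<le> e + ?A * (cmod (1 - cis d))\<^sup>2"
    proof (cases "\<bar>d\<bar> < \<delta>")
      case True
      have "u \<in> ?I" "u - d \<in> ?I" using k l by (auto simp: u_def d_def)
      from \<delta>(2)[OF this(2,1)] True have "cmod (f u - f (u - d)) \<le> e" by (simp add: dist_norm)
      moreover have "0 \<le> ?A * (cmod (1 - cis d))\<^sup>2" using B by simp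
      ultimately show ?thesis by linarith
    next
      case False
      have "\<delta> \<le> 2 * cmod (1 - cis d)"
        using norm_one_minus_cis_ge[of d] l False by (simp add: d_def)
      then have "\<delta>\<^sup>2 \<le> (2 * cmod (1 - cis d))\<^sup>2" using \<delta> by (intro power_mono) auto
      then have "1 \<le> 4 / \<delta>\<^sup>2 * (cmod (1 - cis d))\<^sup>2" using \<delta> by (simp add: power_mult_distrib field_simps)
      then have "2 * B * 1 \<le> 2 * B * (4 / \<delta>\<^sup>2 * (cmod (1 - cis d))\<^sup>2)" using B by (intro mult_left_mono) auto
      moreover have "u \<in> ?I" "u - d \<in> ?I" using k l by (auto simp: u_def d_def)
      then have "cmod (f u - f (u - d)) \<le> B + B" by (intro order_trans[OF norm_triangle_ineq4] add_mono B)
      ultimately show ?thesis using e by simp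
    qed
    ultimately show ?thesis by simp
  qed
  moreover have "0 \<le> ?A" using B by simp
  ultimately show ?thesis by blast
qed

text \<open>A discrete Jackson mean of \<open>f\<close> is a trigonometric polynomial in the translation variable, and the
preceding bound reduces its error to the second moment of the kernel.\<close>

lemma trig_polys_dense:
  fixes f :: "real \<Rightarrow> complex"
  assumes f: "continuous_on UNIV f" and per: "\<And>x. f (x + 2 * pi) = f x" and e: "0 < e"
  shows "\<exists>D. \<exists>t\<in>trig_polys (freqs D). \<forall>x. cmod (f x - t x) \<le> e"
proof -
  obtain A where A: "0 \<le> A" "\<And>x y. cmod (f x - f y) \<le> e / 2 + A * (cmod (1 - cis (x - y)))\<^sup>2"
    using periodic_modulus_bound[OF f per, of "e / 2"] e by auto
  obtain N :: nat where N: "16 * A / e < N" using reals_Archimedean2 by blast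
  have "0 \<le> 16 * A / e" using A e by simp
  with N have N1: "1 \<le> N" by (cases N) auto
  obtain \<kappa> where "jackson_kernel 1 N \<kappa>" using jackson_kernel_exists[OF N1] by blast
  note \<kappa> = jackson_kernelD[OF this]
  define M where "M = Suc (Suc 1 * (N - 1))"
  have M: "Suc 1 * (N - 1) < M" "0 < M" by (simp_all add: M_def)
  \<comment> \<open>The sign turns \<open>x - y m\<close> into the nodes of a grid shifted by \<open>x\<close>.\<close>
  define y where "y m = - equi_node 0 M m" for m
  define t where "t x = (\<Sum>m<M. (f (y m) / M) * complex_of_real (\<kappa> (x - y m)))" for x
  have t: "t \<in> trig_polys (freqs (Suc 1 * (N - 1)))"
    unfolding t_def[abs_def] by (intro trig_polys_sum trig_polys_translate[OF \<kappa>(2)]) auto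
  have "cmod (f x - t x) \<le> e" for x
  proof -
    have xy: "x - y m = equi_node x M m" for m by (simp add: y_def equi_node_def)
    have "f x = f x * of_real (\<Sum>m<M. \<kappa> (x - y m)) / M"
      unfolding xy \<kappa>(3)[OF M(1)] using M by simp
    then have "f x - t x = (\<Sum>m<M. (f x - f (y m)) * complex_of_real (\<kappa> (x - y m))) / M"
      by (simp add: t_def sum_subtractf left_diff_distrib diff_divide_distrib sum_distrib_left sum_divide_distrib)
    also have "cmod \<dots> \<le> (\<Sum>m<M. (e / 2 + A * (cmod (1 - cis (x - y m)))\<^sup>2) * \<kappa> (x - y m)) / M"
      unfolding norm_divide norm_of_nat
      by (intro divide_right_mono order_trans[OF norm_sum] sum_mono)
         (use \<kappa>(1) A in \<open>auto simp: norm_mult intro!: mult_right_mono\<close>)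
    also have "\<dots> = (e / 2 * (\<Sum>m<M. \<kappa> (x - y m)) + A * (\<Sum>m<M. \<kappa> (x - y m) * cmod (1 - cis (x - y m)) ^ (2 * 1))) / M"
      by (simp add: sum.distrib sum_distrib_left algebra_simps power2_eq_square)
    also have "\<dots> \<le> (e / 2 * M + A * (M * 8 / N ^ 2)) / M"
    proof (intro divide_right_mono add_mono mult_left_mono A)
      show "(\<Sum>m<M. \<kappa> (x - y m)) \<le> M" unfolding xy using \<kappa>(3)[OF M(1)] by simp
      have "(\<Sum>m<M. \<kappa> (x - y m) * cmod (1 - cis (x - y m)) ^ (2 * 1)) * N ^ 2 \<le> M * 8"
        unfolding xy using \<kappa>(4)[OF M(1), of x] by simp
      then show "(\<Sum>m<M. \<kappa> (x - y m) * cmod (1 - cis (x - y m)) ^ (2 * 1)) \<le> M * 8 / N ^ 2"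
        using N1 by (simp add: le_divide_eq)
    qed (use e in auto)
    also have "\<dots> = e / 2 + A * 8 / N ^ 2" using M by (simp add: field_simps)
    also have "A * 8 / N ^ 2 \<le> A * 8 / N"
      using N1 A by (intro divide_left_mono) (auto simp: power2_eq_square)
    also have "A * 8 / N \<le> e / 2" using N e N1 by (simp add: field_simps)
    finally show ?thesis by simp
  qed
  with t show ?thesis by blast
qed

lemma powr_le_one_plus_power:
  assumes "0 \<le> v" "0 < r" "r \<le> real k"
  shows "v powr r \<le> 1 + v ^ k"
proof (cases "v \<le> 1")
  case True
  then have "v powr r \<le> 1" using assms by (simp add: powr_le1)
  moreover have "0 \<le> v ^ k" using assms(1) by (rule zero_le_power)
  ultimately show ?thesis by linarith
next
  case False
  then have "v powr r \<le> v powr real k" using assms by (intro powr_mono) auto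
  then show ?thesis using False by (simp add: powr_realpow)
qed

text \<open>The spectral gap behind the next theorem: a frequency that exceeds the degree of the kernel cannot
be compensated by it, nor by aliasing if the grid is fine enough.\<close>

lemma sum_jackson_character_zero:
  fixes k :: int
  assumes "(\<lambda>x. complex_of_real (\<kappa> x)) \<in> trig_polys (freqs L)" "int L < \<bar>k\<bar>" "\<bar>k\<bar> + int L < int M"
  shows "(\<Sum>m<M. complex_of_real (\<kappa> (equi_node \<theta> M m)) * cis (of_int k * equi_node \<theta> M m)) = 0"
proof -
  obtain v where v: "(\<lambda>x. complex_of_real (\<kappa> x)) = (\<lambda>x. \<Sum>\<mu>\<in>freqs L. v \<mu> * character \<mu> x)"
    using assms(1) by (rule trig_polysE)
  have "(\<Sum>m<M. complex_of_real (\<kappa> (equi_node \<theta> M m)) * cis (of_int k * equi_node \<theta> M m)) =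
     (\<Sum>m<M. \<Sum>\<mu>\<in>freqs L. v \<mu> * cis ((\<mu> + of_int k) * equi_node \<theta> M m))"
    unfolding fun_cong[OF v] sum_distrib_right by (simp add: cis_mult algebra_simps flip: cis_mult)
  also have "\<dots> = (\<Sum>\<mu>\<in>freqs L. v \<mu> * (\<Sum>m<M. cis ((\<mu> + of_int k) * equi_node \<theta> M m)))"
    unfolding sum_distrib_left by (rule sum.swap)
  also have "\<dots> = 0"
  proof (intro sum.neutral ballI)
    fix \<mu> assume "\<mu> \<in> freqs L"
    then obtain i where i: "\<mu> = of_int i" "i \<in> {- int L..int L}" unfolding freqs_def by blast
    have "(\<Sum>m<M. cis (of_int (i + k) * equi_node \<theta> M m)) = 0"
      by (rule sum_cis_equi_node) (use i assms in auto)
    then show "v \<mu> * (\<Sum>m<M. cis ((\<mu> + of_int k) * equi_node \<theta> M m)) = 0" by (simp add: i)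
  qed
  finally show ?thesis .
qed

text \<open>The combination \<open>\<Sum>i\<le>l. c i * f (x + i * h)\<close> models a difference of order \<open>l\<close>. Averaging it
against the Jackson kernel and solving for the term \<open>i = 0\<close> expresses \<open>f x\<close> through averages of
\<open>f (x + i * h)\<close> with \<open>i \<ge> 1\<close>, up to an error of the size of the \<open>r\<close>-th moment of the kernel. For a
polynomial \<open>p\<close> in place of \<open>f\<close> these averages have degree at most that of the kernel, no matter how
large the degree of \<open>p\<close> is. As polynomials are dense, \<open>f\<close> may be replaced by such a \<open>p\<close> at the
cost of an arbitrarily small error.\<close>

lemma jackson_differences:
  fixes f :: "real \<Rightarrow> complex" and c :: "nat \<Rightarrow> complex"
  assumes f: "continuous_on UNIV f" and per: "\<And>x. f (x + 2 * pi) = f x"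
    and c: "cmod (c 0) = 1" and r: "0 < r" "r \<le> real (2 * q)" and N: "1 \<le> N"
    and diff: "\<And>x h. cmod (\<Sum>i\<le>l. c i * f (x + real i * h)) \<le> \<bar>h\<bar> powr r"
  shows "\<exists>t\<in>trig_polys (freqs (Suc q * (N - 1))).
    \<forall>x. cmod (f x - t x) \<le> (2 + real (Suc q) * 16 ^ q) * real N powr (- r)"
proof -
  let ?L = "Suc q * (N - 1)"
  define s where "s = (\<Sum>i\<in>{1..l}. cmod (c i))"
  have s: "0 \<le> s" by (auto simp: s_def intro: sum_nonneg)
  \<comment> \<open>The averages below amplify the error of \<open>p\<close> by at most \<open>s\<close>.\<close>
  define \<epsilon> where "\<epsilon> = real N powr (- r) / (1 + s)"
  have \<epsilon>: "0 < \<epsilon>" using N s by (simp add: \<epsilon>_def)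
  obtain D p where p: "p \<in> trig_polys (freqs D)" "\<And>x. cmod (f x - p x) \<le> \<epsilon>"
    using trig_polys_dense[OF f per \<epsilon>] by blast
  obtain a where a: "p = (\<lambda>x. \<Sum>k\<in>freqs D. a k * character k x)" using p(1) by (rule trig_polysE)
  obtain \<kappa> where "jackson_kernel q N \<kappa>" using jackson_kernel_exists[OF N] by blast
  note \<kappa> = jackson_kernelD[OF this]
  \<comment> \<open>The frequencies of \<open>p (x + i * h)\<close> in \<open>h\<close> are at most \<open>D * l\<close>, those of the kernel at most \<open>?L\<close>.\<close>
  define M where "M = Suc (D * l + ?L)"
  have M: "?L < M" "0 < M" by (auto simp: M_def)
  define h where "h m = equi_node (- pi) M m" for m
  have h: "\<bar>h m\<bar> \<le> pi" if "m < M" for m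
  proof -
    have "real m / real M \<le> 1" using that by (simp add: field_simps)
    then have "2 * pi * (real m / real M) \<le> 2 * pi * 1" by (intro mult_left_mono) auto
    then show ?thesis by (simp add: h_def equi_node_def abs_le_iff)
  qed
  define t where "t x = - (\<Sum>i\<in>{1..l}. c i * (\<Sum>m<M. \<kappa> (h m) * p (x + real i * h m)) / M) / c 0" for x
  define \<beta> where "\<beta> k = - (\<Sum>i\<in>{1..l}. c i * (\<Sum>m<M. \<kappa> (h m) * cis (k * (real i * h m))) / M) / c 0" for k
  have tb: "t x = (\<Sum>k\<in>freqs D. a k * \<beta> k * character k x)" for x
  proof -
    have "(\<Sum>m<M. \<kappa> (h m) * p (x + real i * h m)) =
       (\<Sum>k\<in>freqs D. a k * character k x * (\<Sum>m<M. \<kappa> (h m) * cis (k * (real i * h m))))" for i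
      unfolding a sum_distrib_left
      by (subst sum.swap) (simp add: distrib_left mult_ac flip: cis_mult)
    then have "(\<Sum>i\<in>{1..l}. c i * (\<Sum>m<M. \<kappa> (h m) * p (x + real i * h m)) / M) =
       (\<Sum>i\<in>{1..l}. \<Sum>k\<in>freqs D. a k * character k x * (c i * (\<Sum>m<M. \<kappa> (h m) * cis (k * (real i * h m))) / M))"
      by (simp add: sum_distrib_left sum_divide_distrib mult_ac)
    also have "\<dots> = (\<Sum>k\<in>freqs D. a k * character k x * (\<Sum>i\<in>{1..l}. c i * (\<Sum>m<M. \<kappa> (h m) * cis (k * (real i * h m))) / M))"
      unfolding sum_distrib_left by (rule sum.swap)
    finally show ?thesis
      unfolding t_def \<beta>_def by (simp add: sum_negf sum_divide_distrib sum_distrib_left mult_ac)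
  qed
  \<comment> \<open>For \<open>i \<ge> 1\<close> the frequency \<open>k * i\<close> in \<open>h\<close> is beyond the degree of the kernel whenever \<open>k\<close> is.\<close>
  have \<beta>0: "\<beta> k = 0" if k: "k \<in> freqs D" "k \<notin> freqs ?L" for k
  proof -
    obtain k' where k': "k = of_int k'" "k' \<in> {- int D..int D}" using k(1) unfolding freqs_def by blast
    have "(\<Sum>m<M. complex_of_real (\<kappa> (h m)) * cis (k * (real i * h m))) = 0" if i: "i \<in> {1..l}" for i
    proof -
      have "k' \<notin> {- int ?L..int ?L}" using k(2) unfolding k'(1) freqs_def by blast
      then have "int ?L < \<bar>k'\<bar>" by auto
      moreover have "\<bar>k'\<bar> * 1 \<le> \<bar>k'\<bar> * int i" using i by (intro mult_left_mono) auto
      moreover have "\<bar>k'\<bar> * int i \<le> int D * int l" using i k'(2) by (intro mult_mono) auto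
      moreover have "\<bar>k' * int i\<bar> = \<bar>k'\<bar> * int i" by (simp add: abs_mult)
      moreover have "int M = int D * int l + int ?L + 1" by (simp add: M_def)
      ultimately have "(\<Sum>m<M. complex_of_real (\<kappa> (equi_node (- pi) M m)) * cis (of_int (k' * int i) * equi_node (- pi) M m)) = 0"
        by (intro sum_jackson_character_zero[OF \<kappa>(2)]) linarith+
      then show ?thesis by (simp add: h_def k' mult_ac)
    qed
    then show ?thesis by (simp add: \<beta>_def)
  qed
  have "t \<in> trig_polys (freqs ?L)"
  proof (rule trig_polysI[where c="\<lambda>k. if k \<in> freqs D then a k * \<beta> k else 0"])
    fix x
    have "t x = (\<Sum>k\<in>freqs D \<inter> freqs ?L. a k * \<beta> k * character k x)"
      unfolding tb by (rule sum.mono_neutral_right) (auto simp: \<beta>0)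
    also have "\<dots> = (\<Sum>k\<in>freqs ?L. (if k \<in> freqs D then a k * \<beta> k else 0) * character k x)"
      by (rule sum.mono_neutral_cong_left) auto
    finally show "t x = (\<Sum>k\<in>freqs ?L. (if k \<in> freqs D then a k * \<beta> k else 0) * character k x)" .
  qed simp
  moreover have "cmod (f x - t x) \<le> (2 + real (Suc q) * 16 ^ q) * real N powr (- r)" for x
  proof -
    define E where "E = (\<Sum>m<M. \<kappa> (h m) * (\<Sum>i\<le>l. c i * f (x + real i * h m))) / M"
    define F where "F = (\<Sum>i\<in>{1..l}. c i * ((\<Sum>m<M. \<kappa> (h m) * (p (x + real i * h m) - f (x + real i * h m))) / M))"
    have avg: "(\<Sum>m<M. \<kappa> (h m)) = M" unfolding h_def by (rule \<kappa>(3)[OF M(1)])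
    have "E = c 0 * f x + (\<Sum>i\<in>{1..l}. c i * ((\<Sum>m<M. \<kappa> (h m) * f (x + real i * h m)) / M))"
    proof -
      have "(\<Sum>m<M. \<kappa> (h m) * (\<Sum>i\<le>l. c i * f (x + real i * h m))) =
          (\<Sum>i\<le>l. c i * (\<Sum>m<M. \<kappa> (h m) * f (x + real i * h m)))"
        unfolding sum_distrib_left by (subst sum.swap) (simp add: mult_ac)
      also have "\<dots> =
         c 0 * f x * of_real (\<Sum>m<M. \<kappa> (h m)) + (\<Sum>i\<in>{1..l}. c i * (\<Sum>m<M. \<kappa> (h m) * f (x + real i * h m)))"
      proof -
        have "{..l} = insert 0 {1..l}" by auto
        then show ?thesis by (simp add: sum_distrib_left sum_distrib_right mult_ac)
      qed
      finally show ?thesis using M by (simp add: E_def avg add_divide_distrib flip: sum_divide_distrib)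
    qed
    moreover have "c 0 * t x = - (\<Sum>i\<in>{1..l}. c i * ((\<Sum>m<M. \<kappa> (h m) * p (x + real i * h m)) / M))"
      using c by (auto simp: t_def)
    ultimately have "c 0 * (f x - t x) = E + F"
      by (simp add: F_def right_diff_distrib sum_subtractf diff_divide_distrib)
    then have "cmod (f x - t x) = cmod (E + F)"
      using c by (metis norm_mult mult_1)
    also have "\<dots> \<le> cmod E + cmod F" by (rule norm_triangle_ineq)
    also have "cmod F \<le> real N powr (- r)"
    proof -
      have "cmod ((\<Sum>m<M. \<kappa> (h m) * (p (x + real i * h m) - f (x + real i * h m))) / M) \<le> \<epsilon>" for i
      proof -
        have "cmod ((\<Sum>m<M. \<kappa> (h m) * (p (x + real i * h m) - f (x + real i * h m))) / M)
           \<le> (\<Sum>m<M. \<kappa> (h m) * \<epsilon>) / M"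
          unfolding norm_divide norm_of_nat
          by (intro divide_right_mono order_trans[OF norm_sum] sum_mono)
             (use \<kappa>(1) p(2) in \<open>auto simp: norm_mult norm_minus_commute intro!: mult_left_mono\<close>)
        also have "\<dots> = \<epsilon>" using M avg by (simp add: sum_distrib_right[symmetric])
        finally show ?thesis .
      qed
      then have "cmod F \<le> (\<Sum>i\<in>{1..l}. cmod (c i) * \<epsilon>)"
        unfolding F_def by (intro order_trans[OF norm_sum] sum_mono) (simp only: norm_mult mult_left_mono norm_ge_zero)
      also have "\<dots> = s * \<epsilon>" by (simp add: s_def sum_distrib_right)
      also have "\<dots> \<le> (1 + s) * \<epsilon>" using \<epsilon> by simp
      also have "\<dots> = real N powr (- r)" using s by (simp add: \<epsilon>_def)
      finally show ?thesis .
    qed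
    also have "cmod E \<le> (1 + real (Suc q) * 16 ^ q) * real N powr (- r)"
    proof -
      let ?S = "\<Sum>m<M. \<kappa> (h m) * cmod (1 - cis (h m)) ^ (2 * q)"
      have hb: "\<bar>h m\<bar> powr r \<le> (1 + real N ^ (2 * q) * (4 ^ q * cmod (1 - cis (h m)) ^ (2 * q))) * real N powr (- r)"
        if "m < M" for m
      proof -
        have "(real N * \<bar>h m\<bar>) powr r \<le> 1 + (real N * \<bar>h m\<bar>) ^ (2 * q)"
          by (rule powr_le_one_plus_power) (use r in auto)
        also have "\<dots> \<le> 1 + (real N * (2 * cmod (1 - cis (h m)))) ^ (2 * q)"
          by (intro add_left_mono power_mono mult_left_mono norm_one_minus_cis_ge h that) auto
        also have "\<dots> = 1 + real N ^ (2 * q) * (4 ^ q * cmod (1 - cis (h m)) ^ (2 * q))"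
          by (simp add: power_mult_distrib power_mult)
        finally have "(real N * \<bar>h m\<bar>) powr r * real N powr (- r) \<le>
          (1 + real N ^ (2 * q) * (4 ^ q * cmod (1 - cis (h m)) ^ (2 * q))) * real N powr (- r)"
          by (rule mult_right_mono) auto
        moreover have "(real N * \<bar>h m\<bar>) powr r * real N powr (- r) = \<bar>h m\<bar> powr r"
          using N by (simp add: powr_mult powr_minus field_simps)
        ultimately show ?thesis by simp
      qed
      have "cmod E \<le> (\<Sum>m<M. \<kappa> (h m) * ((1 + real N ^ (2 * q) * (4 ^ q * cmod (1 - cis (h m)) ^ (2 * q))) * real N powr (- r))) / M"
        unfolding E_def norm_divide norm_of_nat
      proof (intro divide_right_mono order_trans[OF norm_sum] sum_mono)
        fix m assume "m \<in> {..<M}"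
        then have "cmod (\<Sum>i\<le>l. c i * f (x + real i * h m)) \<le> (1 + real N ^ (2 * q) * (4 ^ q * cmod (1 - cis (h m)) ^ (2 * q))) * real N powr (- r)"
          using diff[of x "h m"] hb[of m] by simp
        then show "cmod (\<kappa> (h m) * (\<Sum>i\<le>l. c i * f (x + real i * h m))) \<le>
          \<kappa> (h m) * ((1 + real N ^ (2 * q) * (4 ^ q * cmod (1 - cis (h m)) ^ (2 * q))) * real N powr (- r))"
          using \<kappa>(1) unfolding norm_mult norm_of_real by (auto intro!: mult_left_mono)
      qed simp
      also have "\<dots> = ((\<Sum>m<M. \<kappa> (h m)) + 4 ^ q * (?S * real N ^ (2 * q))) * real N powr (- r) / M"
        by (simp add: sum_distrib_left sum_distrib_right sum.distrib distrib_left distrib_right mult_ac)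
      also have "\<dots> \<le> (real M + 4 ^ q * (real M * (real (Suc q) * 4 ^ q))) * real N powr (- r) / real M"
      proof (intro divide_right_mono mult_right_mono add_mono mult_left_mono)
        show "?S * real N ^ (2 * q) \<le> real M * (real (Suc q) * 4 ^ q)"
          using \<kappa>(4)[OF M(1), of "- pi"] by (simp add: h_def algebra_simps)
      qed (use avg in auto)
      also have "\<dots> = (1 + real (Suc q) * (4 ^ q * 4 ^ q)) * real N powr (- r)" using M by (simp add: field_simps)
      also have "(4::real) ^ q * 4 ^ q = 16 ^ q" by (simp flip: power_mult_distrib)
      finally show ?thesis .
    qed
    finally show ?thesis by (simp add: algebra_simps)
  qed
  ultimately show ?thesis by blast
qed

section \<open>Tails of the Bernoulli kernels\<close>

lemma summation_by_parts_sums: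
  fixes a :: "nat \<Rightarrow> real" and z :: complex
  assumes a: "a \<longlonglongrightarrow> 0" "summable (\<lambda>k. \<bar>a (Suc k) - a k\<bar>)" and z: "cmod z = 1" "z \<noteq> 1"
  shows "summable (\<lambda>k. of_real (a (Suc k) - a k) * z ^ Suc k)"
    and "(\<lambda>k. of_real (a k) * z ^ k) sums
      ((of_real (a 0) + (\<Sum>k. of_real (a (Suc k) - a k) * z ^ Suc k)) / (1 - z))"
proof -
  have part: "(1 - z) * (\<Sum>k<n. of_real (a k) * z ^ k) =
      of_real (a 0) + (\<Sum>k<n. of_real (a (Suc k) - a k) * z ^ Suc k) - of_real (a n) * z ^ n" for n
  proof (induction n)
    case (Suc n)
    show ?case unfolding sum.lessThan_Suc distrib_left Suc by (simp add: algebra_simps)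
  qed simp
  show s: "summable (\<lambda>k. of_real (a (Suc k) - a k) * z ^ Suc k)"
    by (rule summable_norm_cancel)
       (use a(2) z in \<open>simp add: norm_mult norm_power del: of_real_diff power_Suc\<close>)
  have "(\<lambda>n. cmod (of_real (a n) * z ^ n)) \<longlonglongrightarrow> 0"
    using tendsto_rabs_zero[OF a(1)] z by (simp add: norm_mult norm_power)
  then have "(\<lambda>n. of_real (a n) * z ^ n) \<longlonglongrightarrow> 0" by (rule tendsto_norm_zero_cancel)
  then have "(\<lambda>n. (of_real (a 0) + (\<Sum>k<n. of_real (a (Suc k) - a k) * z ^ Suc k) - of_real (a n) * z ^ n) / (1 - z))
     \<longlonglongrightarrow> (of_real (a 0) + (\<Sum>k. of_real (a (Suc k) - a k) * z ^ Suc k) - 0) / (1 - z)"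
    using summable_LIMSEQ[OF s] z by (intro tendsto_intros) auto
  moreover have "(of_real (a 0) + (\<Sum>k<n. of_real (a (Suc k) - a k) * z ^ Suc k) - of_real (a n) * z ^ n) / (1 - z) =
     (\<Sum>k<n. of_real (a k) * z ^ k)" for n
    unfolding part[symmetric] using z by simp
  ultimately show "(\<lambda>k. of_real (a k) * z ^ k) sums
      ((of_real (a 0) + (\<Sum>k. of_real (a (Suc k) - a k) * z ^ Suc k)) / (1 - z))"
    by (simp add: sums_def)
qed

text \<open>Summing by parts twice trades two factors \<open>1 - z\<close> for the total variation of the differences of the
coefficients.\<close>

lemma second_difference_bound:
  fixes a :: "nat \<Rightarrow> real" and z :: complex
  defines "d \<equiv> \<lambda>k. a (Suc k) - a k"
  assumes a: "a \<longlonglongrightarrow> 0" "a 0 = 0" "summable (\<lambda>k. \<bar>d k\<bar>)"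
    and dd: "\<And>n. (\<Sum>k<n. \<bar>d (Suc k) - d k\<bar>) \<le> B" and z: "cmod z = 1" "z \<noteq> 1"
  shows "(cmod (1 - z))\<^sup>2 * cmod (\<Sum>k. of_real (a k) * z ^ k) \<le> \<bar>d 0\<bar> + B"
proof -
  have d0: "d \<longlonglongrightarrow> 0" using tendsto_diff[OF LIMSEQ_Suc[OF a(1)] a(1)] by (simp add: d_def)
  have sdd: "summable (\<lambda>k. \<bar>d (Suc k) - d k\<bar>)"
    by (rule summableI_nonneg_bounded[OF _ dd]) auto
  have d: "a (Suc k) - a k = d k" for k by (simp add: d_def)
  note 1 = summation_by_parts_sums[OF a(1) a(3)[unfolded d_def] z, unfolded d]
  note 2 = summation_by_parts_sums[OF d0 sdd z]
  define E where "E = (\<Sum>k. of_real (d (Suc k) - d k) * z ^ Suc k)"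
  have "(\<Sum>k. of_real (d k) * z ^ Suc k) = z * (\<Sum>k. of_real (d k) * z ^ k)"
    using suminf_mult[OF sums_summable[OF 2(2)], of z] by (simp add: mult_ac)
  also have "(\<Sum>k. of_real (d k) * z ^ k) = (of_real (d 0) + E) / (1 - z)"
    using sums_unique[OF 2(2)] by (simp add: E_def)
  finally have "(\<Sum>k. of_real (a k) * z ^ k) = z * ((of_real (d 0) + E) / (1 - z)) / (1 - z)"
    using sums_unique[OF 1(2)] a(2) by simp
  then have "(1 - z)\<^sup>2 * (\<Sum>k. of_real (a k) * z ^ k) = z * (of_real (d 0) + E)"
    using z by (simp only:) (simp add: power2_eq_square)
  then have "(cmod (1 - z))\<^sup>2 * cmod (\<Sum>k. of_real (a k) * z ^ k) = cmod (of_real (d 0) + E)"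
    using z by (metis norm_mult norm_power mult_1)
  also have "\<dots> \<le> \<bar>d 0\<bar> + cmod E" using norm_triangle_ineq[of "of_real (d 0)" E] by simp
  also have "cmod E \<le> (\<Sum>k. \<bar>d (Suc k) - d k\<bar>)"
    unfolding E_def
    by (rule summable_norm[THEN order_trans])
       (use sdd z in \<open>simp_all add: norm_mult norm_power del: of_real_diff power_Suc\<close>)
  also have "\<dots> \<le> B" by (rule suminf_le_const[OF sdd dd])
  finally show ?thesis by simp
qed

text \<open>Between the frequencies 0 and \<open>N\<close> the coefficients of the tail of \<open>F\<^sub>r\<close> can be changed freely,
because polynomials of degree \<open>N\<close> are available for the approximation. A linear ramp makes the sum of
the moduli of the second differences as small as \<open>N powr (- r - 1)\<close>, up to a constant.\<close>

definition ramp_coeff :: "real \<Rightarrow> nat \<Rightarrow> nat \<Rightarrow> real" where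
  "ramp_coeff r N k = (if k \<le> N then real N powr (- r) / real N * real k else real k powr (- r))"

lemma powr_difference:
  fixes k :: nat
  assumes "1 \<le> k"
  shows "\<exists>\<xi>. real k < \<xi> \<and> \<xi> < real (Suc k) \<and>
    real (Suc k) powr (- r) - real k powr (- r) = - r * \<xi> powr (- r - 1)"
proof -
  have "\<exists>\<xi>>real k. \<xi> < real (Suc k) \<and> real (Suc k) powr (- r) - real k powr (- r) =
      (real (Suc k) - real k) * (- r * \<xi> powr (- r - 1))"
    using assms by (intro MVT2) (auto intro!: derivative_eq_intros)
  then show ?thesis by auto
qed

lemma ramp_coeff_bounds:
  assumes "0 < r" "1 \<le> N"
  shows "0 \<le> ramp_coeff r N k" "ramp_coeff r N k \<le> real N powr (- r)"
proof -
  show "0 \<le> ramp_coeff r N k" by (simp add: ramp_coeff_def)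
  have "real N powr (- r) * (real k / real N) \<le> real N powr (- r) * 1" if "k \<le> N"
    using that assms by (intro mult_left_mono) auto
  then show "ramp_coeff r N k \<le> real N powr (- r)"
    using assms by (auto simp: ramp_coeff_def intro: powr_mono2')
qed

lemma ramp_coeff_tendsto_0:
  assumes "0 < r"
  shows "ramp_coeff r N \<longlonglongrightarrow> 0"
proof -
  have "(\<lambda>k. real k powr (- r)) \<longlonglongrightarrow> 0"
    using assms by (intro tendsto_neg_powr filterlim_real_sequentially) auto
  moreover have "\<forall>\<^sub>F k in sequentially. real k powr (- r) = ramp_coeff r N k"
    using eventually_gt_at_top[of N] by eventually_elim (simp add: ramp_coeff_def)
  ultimately show ?thesis by (rule Lim_transform_eventually)
qed

text \<open>The differences are constant up to \<open>N\<close>, jump to a negative value there, and then increase to 0 by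
convexity of \<open>k powr (- r)\<close>; all sums telescope.\<close>

lemma ramp_coeff_differences:
  fixes r :: real and N :: nat
  defines "d \<equiv> \<lambda>k. ramp_coeff r N (Suc k) - ramp_coeff r N k" and "c \<equiv> real N powr (- r) / real N"
  assumes r: "0 < r" and N: "1 \<le> N"
  shows "d 0 = c" "summable (\<lambda>k. \<bar>d k\<bar>)" "(\<Sum>k<n. \<bar>d (Suc k) - d k\<bar>) \<le> (1 + 2 * r) * c"
proof -
  have c: "0 \<le> c" by (simp add: c_def)
  have dlt: "d k = c" if "k < N" for k
    using that by (simp add: d_def c_def ramp_coeff_def algebra_simps add_divide_distrib)
  have aN: "ramp_coeff r N k = real k powr (- r)" if "N \<le> k" for k
    using that N by (auto simp: ramp_coeff_def)
  have dge: "\<exists>\<xi>. real k < \<xi> \<and> \<xi> < real (Suc k) \<and> d k = - r * \<xi> powr (- r - 1)" if "N \<le> k" for k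
    using powr_difference[of k r] that N by (simp add: d_def aN)
  show "d 0 = c" using dlt N by simp
  have dneg: "d k \<le> 0" if k: "N \<le> k" for k
  proof -
    obtain \<xi> where "d k = - r * \<xi> powr (- r - 1)" using dge[OF k] by blast
    then show ?thesis using r by simp
  qed
  have "(\<Sum>k<n. \<bar>d k\<bar>) = (if n \<le> N then ramp_coeff r N n else 2 * ramp_coeff r N N - ramp_coeff r N n)" for n
  proof (induction n)
    case (Suc n)
    show ?case
    proof (cases "n < N")
      case True
      then have "\<bar>d n\<bar> = ramp_coeff r N (Suc n) - ramp_coeff r N n" using dlt[of n] c by (simp add: d_def)
      then show ?thesis using Suc True by simp
    next
      case False
      then have "\<bar>d n\<bar> = ramp_coeff r N n - ramp_coeff r N (Suc n)" using dneg[of n] by (simp add: d_def)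
      then show ?thesis using Suc False by (cases "n = N") auto
    qed
  qed (simp add: ramp_coeff_def)
  then have "(\<Sum>k<n. \<bar>d k\<bar>) \<le> 2 * real N powr (- r)" for n
    using ramp_coeff_bounds[OF r N, of n] ramp_coeff_bounds[OF r N, of N] by auto
  then show "summable (\<lambda>k. \<bar>d k\<bar>)" by (intro summableI_nonneg_bounded) auto
  have dmono: "d k \<le> d (Suc k)" if k: "N \<le> k" for k
  proof -
    obtain \<xi> where \<xi>: "real k < \<xi>" "\<xi> < real (Suc k)" "d k = - r * \<xi> powr (- r - 1)" using dge[OF k] by blast
    obtain \<eta> where \<eta>: "real (Suc k) < \<eta>" "d (Suc k) = - r * \<eta> powr (- r - 1)" using dge[of "Suc k"] k by auto
    have "0 < \<xi>" using \<xi>(1) by linarith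
    then have "\<eta> powr (- r - 1) \<le> \<xi> powr (- r - 1)" using \<xi> \<eta> r by (intro powr_mono2') auto
    then show ?thesis using r by (simp add: \<xi> \<eta> mult_left_mono)
  qed
  have dN: "- d N \<le> r * c"
  proof -
    obtain \<xi> where \<xi>: "real N < \<xi>" "d N = - r * \<xi> powr (- r - 1)" using dge[of N] by auto
    have "\<xi> powr (- r - 1) \<le> real N powr (- r - 1)" using \<xi> N r by (intro powr_mono2') auto
    also have "\<dots> = c" using N by (simp add: c_def powr_diff)
    finally show ?thesis using r by (simp add: \<xi> mult_left_mono)
  qed
  have "(\<Sum>k<n. \<bar>d (Suc k) - d k\<bar>) = (if n < N then 0 else c - 2 * d N + d n)" for n
  proof (induction n)
    case 0 then show ?case using N by simp
  next
    case (Suc n)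
    \<comment> \<open>Only the step at \<open>Suc n = N\<close> sees the corner of the ramp.\<close>
    consider "Suc n < N" | "Suc n = N" | "N \<le> n" by linarith
    then show ?case
    proof cases
      case 1 then show ?thesis using Suc dlt[of n] dlt[of "Suc n"] by simp
    next
      case 2
      show ?thesis using Suc dlt[of n] dneg[of N] c unfolding 2[symmetric] by simp
    next
      case 3 then show ?thesis using Suc dmono[of n] by simp
    qed
  qed
  then have "(\<Sum>k<n. \<bar>d (Suc k) - d k\<bar>) \<le> c - 2 * d N"
    using dneg[of n] dneg[of N] c by simp
  then show "(\<Sum>k<n. \<bar>d (Suc k) - d k\<bar>) \<le> (1 + 2 * r) * c" using dN by (simp add: algebra_simps)
qed

definition ramp_sum :: "real \<Rightarrow> nat \<Rightarrow> real \<Rightarrow> complex" where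
  "ramp_sum r N x = (\<Sum>k. of_real (ramp_coeff r N k) * cis x ^ k)"

lemma ramp_sum_sums:
  assumes "0 < r" "1 \<le> N" "cis x \<noteq> 1"
  shows "(\<lambda>k. of_real (ramp_coeff r N k) * cis x ^ k) sums ramp_sum r N x"
  unfolding ramp_sum_def
  using summation_by_parts_sums(2)[OF ramp_coeff_tendsto_0 ramp_coeff_differences(2), of r N "cis x"] assms
  by (intro summable_sums) (auto dest: sums_summable)

lemma ramp_sum_decay:
  assumes "0 < r" "1 \<le> N" "cis x \<noteq> 1"
  shows "(cmod (1 - cis x))\<^sup>2 * cmod (ramp_sum r N x) \<le> (2 + 2 * r) * (real N powr (- r) / real N)"
proof -
  have "(cmod (1 - cis x))\<^sup>2 * cmod (ramp_sum r N x) \<le>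
     \<bar>ramp_coeff r N (Suc 0) - ramp_coeff r N 0\<bar> + (1 + 2 * r) * (real N powr (- r) / real N)"
    unfolding ramp_sum_def
    by (rule second_difference_bound)
       (use assms ramp_coeff_differences[OF assms(1,2)] in \<open>simp_all add: ramp_coeff_tendsto_0 ramp_coeff_def[of _ _ 0]\<close>)
  then show ?thesis
    using ramp_coeff_differences(1)[OF assms(1,2)] by (simp add: algebra_simps add_divide_distrib)
qed

lemma ramp_sum_diff:
  assumes "0 < r" "1 \<le> M" "M \<le> N" "cis x \<noteq> 1"
  shows "ramp_sum r M x - ramp_sum r N x = (\<Sum>k<N. of_real (ramp_coeff r M k - ramp_coeff r N k) * cis x ^ k)"
proof -
  have "(\<lambda>k. of_real (ramp_coeff r M k) * cis x ^ k - of_real (ramp_coeff r N k) * cis x ^ k) sums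
      (ramp_sum r M x - ramp_sum r N x)"
    using assms by (intro sums_diff ramp_sum_sums) auto
  moreover have "(\<lambda>k. of_real (ramp_coeff r M k) * cis x ^ k - of_real (ramp_coeff r N k) * cis x ^ k) sums
      (\<Sum>k<N. of_real (ramp_coeff r M k) * cis x ^ k - of_real (ramp_coeff r N k) * cis x ^ k)"
  proof (rule sums_finite)
    fix k assume "k \<notin> {..<N}"
    then have "ramp_coeff r M k = real k powr (- r)" "ramp_coeff r N k = real k powr (- r)"
      using assms by (cases "k = M"; auto simp: ramp_coeff_def)+
    then show "of_real (ramp_coeff r M k) * cis x ^ k - of_real (ramp_coeff r N k) * cis x ^ k = 0" by simp
  qed simp
  ultimately have "ramp_sum r M x - ramp_sum r N x =
     (\<Sum>k<N. of_real (ramp_coeff r M k) * cis x ^ k - of_real (ramp_coeff r N k) * cis x ^ k)"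
    by (rule sums_unique2)
  then show ?thesis by (simp add: left_diff_distrib)
qed

text \<open>An integrable majorant of the shape of a Fejer kernel divided by its value at the origin.\<close>

definition bump :: "real \<Rightarrow> real \<Rightarrow> real" where
  "bump N x = 1 / (1 + N\<^sup>2 * (cmod (1 - cis x))\<^sup>2)"

text \<open>Near the origin the block is bounded by the sum of the moduli of its \<open>2 * N\<close> coefficients, away from
it by \<open>ramp_sum_decay\<close>.\<close>

lemma dyadic_block_bound:
  assumes r: "0 < r" and N: "1 \<le> N" and x: "cis x \<noteq> 1"
  shows "cmod (ramp_sum r N x - ramp_sum r (2 * N) x) \<le> (6 + 4 * r) * (real N * real N powr (- r)) * bump N x"
proof -
  let ?T = "cmod (ramp_sum r N x - ramp_sum r (2 * N) x)" and ?w = "cmod (1 - cis x)" and ?p = "real N powr (- r)"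
  have le: "real (2 * N) powr (- r) \<le> ?p" using N r by (intro powr_mono2') auto
  have "?T \<le> (\<Sum>k<2 * N. ?p)"
    unfolding ramp_sum_diff[OF r N le_add2[of N N, folded mult_2] x]
  proof (intro order_trans[OF norm_sum] sum_mono)
    fix k
    have "\<bar>ramp_coeff r N k - ramp_coeff r (2 * N) k\<bar> \<le> ?p"
      using ramp_coeff_bounds[OF r N, of k] ramp_coeff_bounds[OF r, of "2 * N" k] N le by linarith
    then show "cmod (of_real (ramp_coeff r N k - ramp_coeff r (2 * N) k) * cis x ^ k) \<le> ?p"
      by (simp add: norm_mult norm_power del: of_real_diff)
  qed
  then have 1: "?T \<le> 2 * (real N * ?p)" by simp
  have "?w\<^sup>2 * ?T \<le> ?w\<^sup>2 * (cmod (ramp_sum r N x) + cmod (ramp_sum r (2 * N) x))"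
    by (intro mult_left_mono norm_triangle_ineq4) auto
  also have "\<dots> \<le> (2 + 2 * r) * (?p / real N) + (2 + 2 * r) * (real (2 * N) powr (- r) / real (2 * N))"
    unfolding distrib_left by (intro add_mono ramp_sum_decay r N x) (use N in simp)
  also have "\<dots> \<le> (2 + 2 * r) * (?p / real N) + (2 + 2 * r) * (?p / real N)"
    using le N r by (intro add_left_mono mult_left_mono frac_le) auto
  finally have "(real N)\<^sup>2 * (?w\<^sup>2 * ?T) \<le> (real N)\<^sup>2 * ((4 + 4 * r) * (?p / real N))"
    by (intro mult_left_mono) (auto simp: algebra_simps)
  also have "\<dots> = (4 + 4 * r) * (real N * ?p)" using N by (simp add: power2_eq_square)
  finally have "(1 + (real N)\<^sup>2 * ?w\<^sup>2) * ?T \<le> (6 + 4 * r) * (real N * ?p)" using 1 by (simp add: algebra_simps)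
  moreover have "0 < 1 + (real N)\<^sup>2 * ?w\<^sup>2" by (simp add: add_pos_nonneg)
  ultimately show ?thesis by (simp add: bump_def pos_le_divide_eq mult_ac)
qed

text \<open>The telescoping sum of the blocks converges to \<open>ramp_sum r N x\<close>, as \<open>ramp_sum r (2 ^ J * N) x\<close> tends
to 0 by \<open>ramp_sum_decay\<close>.\<close>

lemma ramp_sum_dyadic:
  assumes r: "0 < r" and N: "1 \<le> N" and x: "cis x \<noteq> 1"
  shows "ennreal (cmod (ramp_sum r N x)) \<le>
    (\<Sum>j. ennreal ((6 + 4 * r) * (real (2 ^ j * N) * real (2 ^ j * N) powr (- r)) * bump (real (2 ^ j * N)) x))"
proof (rule ennreal_le_epsilon)
  fix e :: real assume e: "0 < e"
  define B where "B j = (6 + 4 * r) * (real (2 ^ j * N) * real (2 ^ j * N) powr (- r)) * bump (real (2 ^ j * N)) x" for j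
  have B0: "0 \<le> B j" for j using r by (simp add: B_def bump_def)
  have w: "0 < cmod (1 - cis x)" using x by auto
  define K where "K = (2 + 2 * r) / (cmod (1 - cis x))\<^sup>2"
  have K: "0 \<le> K" using r by (simp add: K_def)
  have J: "cmod (ramp_sum r N x) \<le> (\<Sum>j<J. B j) + cmod (ramp_sum r (2 ^ J * N) x)" for J
  proof (induction J)
    case (Suc J)
    have "cmod (ramp_sum r (2 ^ J * N) x) \<le> cmod (ramp_sum r (2 ^ J * N) x - ramp_sum r (2 * (2 ^ J * N)) x) + cmod (ramp_sum r (2 * (2 ^ J * N)) x)"
      using norm_triangle_ineq[of "ramp_sum r (2 ^ J * N) x - ramp_sum r (2 * (2 ^ J * N)) x" "ramp_sum r (2 * (2 ^ J * N)) x"] by simp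
    also have "cmod (ramp_sum r (2 ^ J * N) x - ramp_sum r (2 * (2 ^ J * N)) x) \<le> B J"
      unfolding B_def by (rule dyadic_block_bound[OF r _ x]) (use N in auto)
    finally show ?case using Suc by (simp add: mult.assoc)
  qed simp
  obtain J :: nat where J2: "K / e < 2 ^ J" using real_arch_pow[of 2 "K / e"] by auto
  have N2: "1 \<le> 2 ^ J * N" using N by simp
  have "cmod (ramp_sum r (2 ^ J * N) x) \<le> K * (real (2 ^ J * N) powr (- r) / real (2 ^ J * N))"
  proof -
    have "c \<le> A / w * q" if "w * c \<le> A * q" "0 < w" for c A w q :: real
      using that by (simp add: field_simps)
    from this[OF ramp_sum_decay[OF r N2 x]] w show ?thesis by (simp add: K_def)
  qed
  also have "\<dots> \<le> K * (1 / 2 ^ J)"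
  proof (intro mult_left_mono frac_le K)
    show "real (2 ^ J * N) powr (- r) \<le> 1"
      using powr_mono2'[of "- r" 1 "real (2 ^ J * N)"] r N2 by (simp del: of_nat_mult)
    show "2 ^ J \<le> real (2 ^ J * N)" using N by simp
  qed auto
  also have "\<dots> \<le> e" using J2 e by (simp add: field_simps)
  finally have "cmod (ramp_sum r N x) \<le> (\<Sum>j<J. B j) + e" using J[of J] by linarith
  then have "ennreal (cmod (ramp_sum r N x)) \<le> ennreal ((\<Sum>j<J. B j) + e)" by (rule ennreal_leI)
  also have "\<dots> = (\<Sum>j<J. ennreal (B j)) + ennreal e"
    using B0 e by (simp add: ennreal_plus sum_nonneg sum_ennreal)
  also have "\<dots> \<le> (\<Sum>j. ennreal (B j)) + ennreal e"
    by (intro add_right_mono sum_le_suminf) auto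
  finally show "ennreal (cmod (ramp_sum r N x)) \<le> (\<Sum>j. ennreal ((6 + 4 * r) * (real (2 ^ j * N) * real (2 ^ j * N) powr (- r)) *
     bump (real (2 ^ j * N)) x)) + ennreal e"
    by (simp only: B_def)
qed

lemma nn_integral_inverse_square:
  assumes "0 < a"
  shows "(\<integral>\<^sup>+y. ennreal (1 / (1 + (a * (x - y + c))\<^sup>2)) \<partial>lborel) = ennreal (pi / a)"
proof -
  have i: "integrable lborel (\<lambda>x::real. inverse (1 + x\<^sup>2))"
    using integrable_inverse_1_plus_square by (simp add: set_integrable_def)
  moreover have "(LINT x|lborel. inverse (1 + x\<^sup>2)) = pi"
    using LBINT_inverse_1_plus_square by (simp add: interval_lebesgue_integral_def set_lebesgue_integral_def)
  ultimately have "(\<integral>\<^sup>+x. ennreal (inverse (1 + x\<^sup>2)) \<partial>lborel) = ennreal pi"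
    by (subst nn_integral_eq_integral) (auto intro!: add_nonneg_nonneg)
  also have "(\<integral>\<^sup>+x. ennreal (inverse (1 + x\<^sup>2)) \<partial>lborel) =
     ennreal \<bar>- a\<bar> * (\<integral>\<^sup>+y. ennreal (inverse (1 + (a * (x + c) + - a * y)\<^sup>2)) \<partial>lborel)"
    by (rule nn_integral_real_affine) (use assms in auto)
  finally have e: "ennreal a * (\<integral>\<^sup>+y. ennreal (inverse (1 + (a * (x + c) + - a * y)\<^sup>2)) \<partial>lborel) = ennreal pi"
    using assms by simp
  have "(\<integral>\<^sup>+y. ennreal (inverse (1 + (a * (x + c) + - a * y)\<^sup>2)) \<partial>lborel) =
     ennreal (1 / a) * (ennreal a * (\<integral>\<^sup>+y. ennreal (inverse (1 + (a * (x + c) + - a * y)\<^sup>2)) \<partial>lborel))"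
    using assms by (simp add: mult.assoc[symmetric] ennreal_mult[symmetric])
  also have "\<dots> = ennreal (pi / a)"
    unfolding e using assms by (simp add: ennreal_mult[symmetric])
  finally show ?thesis by (simp add: algebra_simps inverse_eq_divide)
qed

text \<open>For \<open>x\<close> and \<open>y\<close> in a period, \<open>x - y\<close> is within distance \<open>pi\<close> of one of the points 0 and
\<open>\<plusminus> 2 * pi\<close>, near which the chord is comparable with the distance.\<close>

lemma bump_le:
  assumes "0 < N" "x \<in> {0..2 * pi}" "y \<in> {0..2 * pi}"
  shows "bump N (x - y) \<le> (\<Sum>c\<in>{0, 2 * pi, - 2 * pi}. 1 / (1 + (N / 2 * (x - y + c))\<^sup>2))"
proof -
  have "\<exists>c\<in>{0, 2 * pi, - 2 * pi}. \<bar>x - y + c\<bar> \<le> pi"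
  proof -
    consider "\<bar>x - y\<bar> \<le> pi" | "x - y > pi" | "x - y < - pi" by linarith
    then show ?thesis
      using assms by cases (auto simp: abs_le_iff)
  qed
  then obtain c where c: "c \<in> {0, 2 * pi, - 2 * pi}" "\<bar>x - y + c\<bar> \<le> pi" by blast
  have "cis (x - y + c) = cis (x - y)"
    using c(1) cis_shift_int[of "x - y" 1] cis_shift_int[of "x - y" "-1"] by auto
  then have "\<bar>x - y + c\<bar> \<le> 2 * cmod (1 - cis (x - y))"
    using norm_one_minus_cis_ge[OF c(2)] by simp
  then have "N / 2 * \<bar>x - y + c\<bar> \<le> N * cmod (1 - cis (x - y))"
    using assms by simp
  then have "(N / 2 * \<bar>x - y + c\<bar>)\<^sup>2 \<le> (N * cmod (1 - cis (x - y)))\<^sup>2"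
    using assms by (intro power_mono) auto
  then have "(N / 2 * (x - y + c))\<^sup>2 \<le> N\<^sup>2 * (cmod (1 - cis (x - y)))\<^sup>2"
    by (simp add: power_mult_distrib power_divide)
  then have "bump N (x - y) \<le> 1 / (1 + (N / 2 * (x - y + c))\<^sup>2)"
    unfolding bump_def by (intro divide_left_mono) (auto intro!: add_pos_nonneg mult_pos_pos)
  also have "\<dots> \<le> (\<Sum>c\<in>{0, 2 * pi, - 2 * pi}. 1 / (1 + (N / 2 * (x - y + c))\<^sup>2))"
    using c(1) by (intro member_le_sum) auto
  finally show ?thesis .
qed

lemma borel_measurable_bump [measurable]: "bump N \<in> borel_measurable borel"
proof -
  have [measurable]: "(\<lambda>x. cmod (1 - cis x)) \<in> borel_measurable borel"
    by (intro borel_measurable_continuous_onI continuous_intros)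
  show ?thesis unfolding bump_def[abs_def] by measurable
qed

lemma nn_integral_bump:
  assumes N: "0 < N" and x: "x \<in> {0..2 * pi}"
  shows "(\<integral>\<^sup>+y\<in>{0..2 * pi}. ennreal (bump N (x - y)) \<partial>lborel) \<le> ennreal (6 * pi / N)"
proof -
  have "(\<integral>\<^sup>+y\<in>{0..2 * pi}. ennreal (bump N (x - y)) \<partial>lborel) \<le>
     (\<integral>\<^sup>+y. (\<Sum>c\<in>{0, 2 * pi, - 2 * pi}. ennreal (1 / (1 + (N / 2 * (x - y + c))\<^sup>2))) \<partial>lborel)"
  proof (rule nn_integral_mono)
    fix y :: real
    show "ennreal (bump N (x - y)) * indicator {0..2 * pi} y \<le>
        (\<Sum>c\<in>{0, 2 * pi, - 2 * pi}. ennreal (1 / (1 + (N / 2 * (x - y + c))\<^sup>2)))"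
    proof (cases "y \<in> {0..2 * pi}")
      case True
      then have "ennreal (bump N (x - y)) \<le> ennreal (\<Sum>c\<in>{0, 2 * pi, - 2 * pi}. 1 / (1 + (N / 2 * (x - y + c))\<^sup>2))"
        using bump_le[OF N x True] by (intro ennreal_leI)
      also have "\<dots> = (\<Sum>c\<in>{0, 2 * pi, - 2 * pi}. ennreal (1 / (1 + (N / 2 * (x - y + c))\<^sup>2)))"
        by (rule sum_ennreal[symmetric]) (auto intro!: divide_nonneg_nonneg add_nonneg_nonneg)
      finally show ?thesis using True by (simp only: indicator_simps mult_1_right)
    qed simp
  qed
  also have "\<dots> = (\<Sum>c\<in>{0, 2 * pi, - 2 * pi}. \<integral>\<^sup>+y. ennreal (1 / (1 + (N / 2 * (x - y + c))\<^sup>2)) \<partial>lborel)"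
    by (rule nn_integral_sum) measurable
  also have "\<dots> = (\<Sum>c\<in>{0, 2 * pi, - 2 * pi}. ennreal (pi / (N / 2)))"
    using N by (intro sum.cong refl nn_integral_inverse_square) auto
  also have "\<dots> = ennreal (\<Sum>c\<in>{0, 2 * pi, - 2 * pi}. pi / (N / 2))"
    using N by (intro sum_ennreal) auto
  also have "(\<Sum>c\<in>{0, 2 * pi, - 2 * pi}. pi / (N / 2)) = 6 * pi / N"
    by simp
  finally show ?thesis .
qed

text \<open>The denominator sums the geometric series over the dyadic blocks.\<close>

definition kernel_const :: "real \<Rightarrow> real" where
  "kernel_const r = (6 + 4 * r) * (6 * pi) / (1 - 2 powr (- r))"

lemma kernel_const_pos: "0 < r \<Longrightarrow> 0 < kernel_const r"
  unfolding kernel_const_def by (intro divide_pos_pos mult_pos_pos) (auto simp: powr_less_one)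

lemma AE_cis_neq_1:
  assumes x: "x \<in> {0..2 * pi}"
  shows "AE y in lborel. y \<in> {0..2 * pi} \<longrightarrow> cis (x - y) \<noteq> 1"
proof -
  have "AE y in lborel. y \<notin> {x, x - 2 * pi, x + 2 * pi}"
    by (rule AE_not_in) (auto intro: countable_imp_null_set_lborel)
  then show ?thesis
  proof eventually_elim
    case (elim y)
    show ?case
    proof (intro impI notI)
      assume y: "y \<in> {0..2 * pi}" and "cis (x - y) = 1"
      then obtain k :: int where k: "x - y = of_int k * 2 * pi" using cos_one_2pi_int by (auto simp: complex_eq_iff)
      have "of_int k * (2 * pi) = x - y" using k by simp
      then have le: "of_int k * (2 * pi) \<le> 1 * (2 * pi)" "- 1 * (2 * pi) \<le> of_int k * (2 * pi)"
        using x y by auto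
      have "real_of_int k \<le> 1" "-1 \<le> real_of_int k"
        by (rule mult_right_le_imp_le[OF le(1)], simp, rule mult_right_le_imp_le[OF le(2)], simp)
      then have "k = -1 \<or> k = 0 \<or> k = 1" by linarith
      then show False using elim k by auto
    qed
  qed
qed

text \<open>Each block contributes its height \<open>(2 ^ j * N) powr (1 - r)\<close> times its width \<open>1 / (2 ^ j * N)\<close>.\<close>

lemma nn_integral_ramp_sum:
  assumes r: "0 < r" and N: "1 \<le> N" and x: "x \<in> {0..2 * pi}"
  shows "(\<integral>\<^sup>+y\<in>{0..2 * pi}. ennreal (cmod (ramp_sum r N (x - y))) \<partial>lborel) \<le> ennreal (kernel_const r * real N powr (- r))"
proof -
  let ?w = "\<lambda>j. (6 + 4 * r) * (real (2 ^ j * N) * real (2 ^ j * N) powr (- r))"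
  have "(\<integral>\<^sup>+y\<in>{0..2 * pi}. ennreal (cmod (ramp_sum r N (x - y))) \<partial>lborel) \<le>
     (\<integral>\<^sup>+y. (\<Sum>j. ennreal (?w j) * (ennreal (bump (real (2 ^ j * N)) (x - y)) * indicator {0..2 * pi} y)) \<partial>lborel)"
  proof (rule nn_integral_mono_AE)
    show "AE y in lborel. ennreal (cmod (ramp_sum r N (x - y))) * indicator {0..2 * pi} y \<le>
       (\<Sum>j. ennreal (?w j) * (ennreal (bump (real (2 ^ j * N)) (x - y)) * indicator {0..2 * pi} y))"
      using AE_cis_neq_1[OF x]
    proof eventually_elim
      case (elim y)
      show ?case
      proof (cases "y \<in> {0..2 * pi}")
        case True
        have "ennreal (?w j * bump (real (2 ^ j * N)) (x - y)) =
            ennreal (?w j) * ennreal (bump (real (2 ^ j * N)) (x - y))" for j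
          by (rule ennreal_mult) (use r in \<open>auto simp: bump_def\<close>)
        moreover have "cis (x - y) \<noteq> 1" using elim True by simp
        ultimately show ?thesis
          using ramp_sum_dyadic[OF r N, of "x - y"] True by (simp only: indicator_simps mult_1_right not_False_eq_True)
      qed simp
    qed
  qed
  also have "\<dots> = (\<Sum>j. ennreal (?w j) * (\<integral>\<^sup>+y\<in>{0..2 * pi}. ennreal (bump (real (2 ^ j * N)) (x - y)) \<partial>lborel))"
    by (subst nn_integral_suminf, measurable) (intro suminf_cong nn_integral_cmult, measurable)
  also have "\<dots> \<le> (\<Sum>j. ennreal (((6 + 4 * r) * (6 * pi) * real N powr (- r)) * (2 powr (- r)) ^ j))"
  proof (intro suminf_le)
    fix j
    have N': "0 < real (2 ^ j * N)" using N by simp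
    have "ennreal (?w j) * (\<integral>\<^sup>+y\<in>{0..2 * pi}. ennreal (bump (real (2 ^ j * N)) (x - y)) \<partial>lborel)
       \<le> ennreal (?w j) * ennreal (6 * pi / real (2 ^ j * N))"
      by (intro mult_left_mono nn_integral_bump N' x) auto
    also have "\<dots> = ennreal (?w j * (6 * pi / real (2 ^ j * N)))"
      by (rule ennreal_mult[symmetric]) (use r in auto)
    also have "?w j * (6 * pi / real (2 ^ j * N)) =
        (6 + 4 * r) * (6 * pi) * real N powr (- r) * (2 powr (- r)) ^ j"
    proof -
      have "A * (X * P) * (B / X) = A * B * P" if "0 < X" for A B P X :: real using that by simp
      note this[OF N', of "6 + 4 * r" "real (2 ^ j * N) powr (- r)" "6 * pi"]
      moreover have "real (2 ^ j * N) powr (- r) = real N powr (- r) * (2 powr (- r)) ^ j"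
      proof -
        have "real (2 ^ j * N) powr (- r) = real N powr (- r) * (2 powr real j) powr (- r)"
          by (subst powr_realpow) (simp_all add: powr_mult)
        also have "(2 powr real j) powr (- r) = (2 powr (- r)) powr real j" by (simp only: powr_powr mult.commute)
        also have "\<dots> = (2 powr (- r)) ^ j" by (rule powr_realpow) simp
        finally show ?thesis .
      qed
      ultimately show ?thesis by (metis mult.assoc)
    qed
    finally show "ennreal (?w j) * (\<integral>\<^sup>+y\<in>{0..2 * pi}. ennreal (bump (real (2 ^ j * N)) (x - y)) \<partial>lborel)
       \<le> ennreal (((6 + 4 * r) * (6 * pi) * real N powr (- r)) * (2 powr (- r)) ^ j)" .
  qed auto
  also have "\<dots> = ennreal (\<Sum>j. ((6 + 4 * r) * (6 * pi) * real N powr (- r)) * (2 powr (- r)) ^ j)"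
    using r by (intro suminf_ennreal2 summable_mult summable_geometric) (auto simp: powr_less_one)
  also have "(\<Sum>j. ((6 + 4 * r) * (6 * pi) * real N powr (- r)) * (2 powr (- r)) ^ j) = kernel_const r * real N powr (- r)"
    using r by (subst suminf_mult) (auto simp: powr_less_one suminf_geometric kernel_const_def intro!: summable_geometric)
  finally show ?thesis .
qed

lemma F_kernel_eq_ramp_sum:
  assumes "0 < r" "cis x \<noteq> 1"
  shows "F_kernel r \<alpha> x = 1 + 2 * Re (cis (- (\<alpha> * pi / 2)) * ramp_sum r 1 x)"
proof -
  let ?\<beta> = "\<alpha> * pi / 2"
  have "(\<lambda>k. of_real (ramp_coeff r 1 k) * cis x ^ k) sums ramp_sum r 1 x"
    using assms by (intro ramp_sum_sums) auto
  then have "(\<lambda>k. of_real (ramp_coeff r 1 (Suc k)) * cis x ^ Suc k) sums ramp_sum r 1 x"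
    by (subst sums_Suc_iff) (simp add: ramp_coeff_def)
  then have "(\<lambda>k. Re (cis (- ?\<beta>) * (of_real (ramp_coeff r 1 (Suc k)) * cis x ^ Suc k))) sums Re (cis (- ?\<beta>) * ramp_sum r 1 x)"
    by (intro sums_Re sums_mult)
  moreover have "Re (cis (- ?\<beta>) * (of_real (ramp_coeff r 1 (Suc k)) * cis x ^ Suc k)) =
      real (Suc k) powr (- r) * cos (real (Suc k) * x - ?\<beta>)" for k
  proof -
    have "ramp_coeff r 1 (Suc k) = real (Suc k) powr (- r)"
      by (cases k) (simp_all add: ramp_coeff_def)
    moreover have "cis (- ?\<beta>) * (of_real a * cis x ^ Suc k) = of_real a * cis (real (Suc k) * x - ?\<beta>)" for a
      by (simp only: Complex.DeMoivre mult.left_commute cis_mult) (simp add: add.commute)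
    ultimately show ?thesis by (simp only:) simp
  qed
  ultimately have "(\<Sum>k. real (Suc k) powr (- r) * cos (real (Suc k) * x - ?\<beta>)) = Re (cis (- ?\<beta>) * ramp_sum r 1 x)"
    by (simp only: sums_iff)
  then show ?thesis by (simp only: F_kernel_def)
qed

text \<open>Replacing the coefficients below \<open>N\<close> by the ramp changes the kernel by a polynomial of degree less
than \<open>N\<close>. The phase \<open>\<alpha>\<close> enters only through a factor of modulus 1, so all estimates are uniform in
\<open>\<alpha>\<close>.\<close>

lemma F_kernel_near_trig_poly:
  assumes r: "0 < r" and N: "1 \<le> N"
  shows "\<exists>P\<in>trig_polys (freqs N). \<forall>x. cis x \<noteq> 1 \<longrightarrow>
    cmod (of_real (F_kernel r \<alpha> x) - P x) \<le> 2 * cmod (ramp_sum r N x)"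
proof -
  define u where "u k = cis (- (\<alpha> * pi / 2)) * of_real (ramp_coeff r 1 k - ramp_coeff r N k)" for k
  define P where "P x = 1 * character 0 x + ((\<Sum>k<N. u k * character (real k) x) + (\<Sum>k<N. cnj (u k) * character (- real k) x))" for x
  have k: "real k \<in> freqs N" "- real k \<in> freqs N" if "k < N" for k
    using that imageI[of "int k" "{- int N..int N}" real_of_int] imageI[of "- int k" "{- int N..int N}" real_of_int]
    by (auto simp: freqs_def)
  have ch: "(\<lambda>x. character (real k) x) \<in> trig_polys (freqs N)"
    "(\<lambda>x. character (- real k) x) \<in> trig_polys (freqs N)" if "k < N" for k
    using character_in_trig_polys[OF finite_freqs k(1)[OF that], of 1]
      character_in_trig_polys[OF finite_freqs k(2)[OF that], of 1] by simp_all
  have "P \<in> trig_polys (freqs N)"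
    unfolding P_def[abs_def]
    by (intro trig_polys_add character_in_trig_polys zero_in_freqs finite_freqs trig_polys_sum) (simp_all only: lessThan_iff ch)
  moreover have "cmod (of_real (F_kernel r \<alpha> x) - P x) \<le> 2 * cmod (ramp_sum r N x)" if x: "cis x \<noteq> 1" for x
  proof -
    let ?e = "cis (- (\<alpha> * pi / 2))"
    have "(\<Sum>k<N. u k * character (real k) x) = ?e * (\<Sum>k<N. of_real (ramp_coeff r 1 k - ramp_coeff r N k) * cis x ^ k)"
      by (simp only: u_def sum_distrib_left Complex.DeMoivre inner_real_def mult.assoc)
    also have "\<dots> = ?e * (ramp_sum r 1 x - ramp_sum r N x)"
      using ramp_sum_diff[OF r _ N x] by simp
    finally have S: "(\<Sum>k<N. u k * character (real k) x) = ?e * (ramp_sum r 1 x - ramp_sum r N x)" .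
    have "(\<Sum>k<N. cnj (u k) * character (- real k) x) = cnj (\<Sum>k<N. u k * character (real k) x)"
      by (simp add: cis_cnj)
    then have "P x = 1 + (?e * (ramp_sum r 1 x - ramp_sum r N x) + cnj (?e * (ramp_sum r 1 x - ramp_sum r N x)))"
      unfolding P_def S by simp
    also have "\<dots> = of_real (1 + 2 * Re (?e * (ramp_sum r 1 x - ramp_sum r N x)))"
      by (simp only: complex_add_cnj of_real_add of_real_1)
    finally have "of_real (F_kernel r \<alpha> x) - P x = of_real (2 * Re (?e * ramp_sum r N x))"
      unfolding F_kernel_eq_ramp_sum[OF r x] by (simp add: right_diff_distrib)
    then have "cmod (of_real (F_kernel r \<alpha> x) - P x) = 2 * \<bar>Re (?e * ramp_sum r N x)\<bar>"
      by (simp only: norm_of_real abs_mult abs_numeral)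
    also have "\<dots> \<le> 2 * cmod (?e * ramp_sum r N x)" by (intro mult_left_mono abs_Re_le_cmod) auto
    finally show ?thesis by (simp add: norm_mult)
  qed
  ultimately show ?thesis by blast
qed

section \<open>Sections of functions of the Sobolev class\<close>

lemma AE_closed_cbox:
  fixes a c :: "'a::euclidean_space"
  assumes "AE x in lebesgue_on (cbox a c). x \<in> C" "closed C" "box a c \<noteq> {}"
  shows "cbox a c \<subseteq> C"
proof -
  have "AE x in lebesgue. x \<in> cbox a c \<longrightarrow> x \<in> C"
    using assms(1) by (simp add: AE_restrict_space_iff)
  then have "AE x in lebesgue. x \<in> box a c \<longrightarrow> x \<in> C"
    by eventually_elim (use box_subset_cbox in blast)
  then have "box a c \<subseteq> C"
    using mem_closed_if_AE_lebesgue_open[OF open_box assms(2)] by blast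
  then have "closure (box a c) \<subseteq> C" using assms(2) by (rule closure_minimal)
  then show ?thesis using closure_box[OF assms(3)] by simp
qed

lemma AE_closed_interval:
  assumes "AE x in lebesgue_on {0..2 * pi}. x \<in> C" "closed C"
  shows "{0..2 * pi} \<subseteq> C"
  using AE_closed_cbox[where a=0 and c="2 * pi" and C=C, unfolded cbox_interval] assms pi_gt_zero by simp

lemma T2_eq_cbox: "T2 = cbox (0, 0) (2 * pi, 2 * pi)"
  by (simp add: T2_def cbox_Pair_eq)

text \<open>Lebesgue null sets of the plane are covered by Borel null sets, to which Fubini's theorem for the
product of the Borel measures applies.\<close>

lemma AE_T2_imp_AE_sections:
  assumes "AE x in lebesgue_on T2. P x"
  shows "AE y in lborel. y \<in> {0..2 * pi} \<longrightarrow> (AE x in lebesgue_on {0..2 * pi}. P (x, y))"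
    and "AE y in lborel. y \<in> {0..2 * pi} \<longrightarrow> (AE x in lebesgue_on {0..2 * pi}. P (y, x))"
proof -
  have "AE x in lborel. x \<in> T2 \<longrightarrow> P x"
    using assms by (simp add: T2_eq_cbox AE_restrict_space_iff AE_completion_iff)
  then obtain Z where Z: "{x \<in> space lborel. \<not> (x \<in> T2 \<longrightarrow> P x)} \<subseteq> Z" "emeasure lborel Z = 0" "Z \<in> sets lborel"
    by (rule AE_E)
  have ZP: "P x" if "x \<in> T2" "x \<notin> Z" for x using Z(1) that by auto
  have ae: "AE x in lborel \<Otimes>\<^sub>M lborel. x \<notin> Z"
    unfolding lborel_prod using Z by (intro AE_not_in) auto
  have "AE x in lborel. AE y in lborel. (x, y) \<notin> Z"
    using lborel_pair.AE_pair[OF ae] .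
  moreover have "{x \<in> space (lborel \<Otimes>\<^sub>M lborel). (fst x, snd x) \<notin> Z} \<in> sets (lborel \<Otimes>\<^sub>M lborel)"
  proof -
    have "{x \<in> space (lborel \<Otimes>\<^sub>M lborel). (fst x, snd x) \<notin> Z} = space (lborel \<Otimes>\<^sub>M lborel) - Z" by auto
    then show ?thesis using Z(3) unfolding lborel_prod by (simp only:) auto
  qed
  ultimately have "AE y in lborel. AE x in lborel. (x, y) \<notin> Z"
    using lborel_pair.AE_commute[of "\<lambda>x y. (x, y) \<notin> Z"] by simp
  then show "AE y in lborel. y \<in> {0..2 * pi} \<longrightarrow> (AE x in lebesgue_on {0..2 * pi}. P (x, y))"
  proof eventually_elim
    case (elim y)
    have "AE x in lborel. x \<in> {0..2 * pi} \<longrightarrow> P (x, y)" if "y \<in> {0..2 * pi}"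
      using elim by eventually_elim (use that in \<open>auto simp: T2_def intro!: ZP\<close>)
    then show ?case by (simp add: AE_restrict_space_iff AE_completion_iff)
  qed
  show "AE y in lborel. y \<in> {0..2 * pi} \<longrightarrow> (AE x in lebesgue_on {0..2 * pi}. P (y, x))"
    using \<open>AE x in lborel. AE y in lborel. (x, y) \<notin> Z\<close>
  proof eventually_elim
    case (elim y)
    have "AE x in lborel. x \<in> {0..2 * pi} \<longrightarrow> P (y, x)" if "y \<in> {0..2 * pi}"
      using elim by eventually_elim (use that in \<open>auto simp: T2_def intro!: ZP\<close>)
    then show ?case by (simp add: AE_restrict_space_iff AE_completion_iff)
  qed
qed

lemma borel_measurable_lebesgue_on_AE_eq:
  fixes f h :: "'a::euclidean_space \<Rightarrow> 'b::euclidean_space"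
  assumes h: "h \<in> borel_measurable (lebesgue_on S)" and S: "S \<in> sets lebesgue"
    and ae: "AE x in lebesgue_on S. f x = h x"
  shows "f \<in> borel_measurable (lebesgue_on S)"
proof -
  let ?f = "\<lambda>x. if x \<in> S then f x else 0" and ?h = "\<lambda>x. if x \<in> S then h x else 0"
  have h': "?h \<in> borel_measurable lebesgue" by (rule borel_measurable_if_I[OF h S])
  have "AE x in lebesgue. x \<in> S \<longrightarrow> f x = h x" using ae S by (simp add: AE_restrict_space_iff)
  then have ae': "AE x in lebesgue. ?f x = ?h x" by eventually_elim auto
  have "?f \<in> borel_measurable lebesgue"
  proof (rule measurableI)
    fix A :: "'b set" assume A: "A \<in> sets borel"
    show "?f -` A \<inter> space lebesgue \<in> sets lebesgue"
    proof (rule completion.in_sets_AE)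
      show "AE x in lebesgue. (x \<in> ?h -` A \<inter> space lebesgue) = (x \<in> ?f -` A \<inter> space lebesgue)"
        using ae' by eventually_elim simp
      show "?h -` A \<inter> space lebesgue \<in> sets lebesgue" by (rule measurable_sets[OF h' A])
    qed auto
  qed simp
  then show ?thesis using borel_measurable_if[OF S] by blast
qed

lemma lebesgue_on_AE_borel_complex:
  fixes \<phi> :: "'a::euclidean_space \<Rightarrow> complex"
  assumes \<phi>: "\<phi> \<in> borel_measurable (lebesgue_on S)" and S: "S \<in> sets lebesgue"
  obtains \<psi> where "\<psi> \<in> borel_measurable borel" "AE x in lebesgue_on S. \<phi> x = \<psi> x"
proof -
  let ?f = "\<lambda>x. if x \<in> S then \<phi> x else 0"
  have f: "?f \<in> borel_measurable lebesgue" by (rule borel_measurable_if_I[OF \<phi> S])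
  have "(\<lambda>x. Re (?f x)) \<in> borel_measurable lebesgue" "(\<lambda>x. Im (?f x)) \<in> borel_measurable lebesgue"
    by (rule measurable_compose[OF f borel_measurable_Re] measurable_compose[OF f borel_measurable_Im])+
  from this[THEN completion_ex_borel_measurable_real]
  obtain p q where p: "p \<in> borel_measurable lborel" "AE x in lborel. Re (?f x) = p x"
    and q: "q \<in> borel_measurable lborel" "AE x in lborel. Im (?f x) = q x"
    by blast
  have "(\<lambda>x. complex_of_real (p x) + \<i> * complex_of_real (q x)) \<in> borel_measurable borel"
    using p(1) q(1) by simp
  moreover have "AE x in lborel. x \<in> S \<longrightarrow> \<phi> x = complex_of_real (p x) + \<i> * complex_of_real (q x)"
    using p(2) q(2) by eventually_elim (auto simp: complex_eq_iff)
  then have "AE x in lebesgue_on S. \<phi> x = complex_of_real (p x) + \<i> * complex_of_real (q x)"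
    using S by (simp add: AE_restrict_space_iff AE_completion_iff)
  ultimately show ?thesis by (rule that)
qed

lemma borel_measurable_imp_lebesgue_on:
  "h \<in> borel_measurable borel \<Longrightarrow> h \<in> borel_measurable (lebesgue_on S)"
  by (simp add: measurable_completion measurable_restrict_space1)

text \<open>A section of a Lebesgue measurable function need not be measurable; almost all sections agree almost
everywhere with sections of a Borel function.\<close>

lemma borel_measurable_sections:
  fixes \<phi> :: "real \<times> real \<Rightarrow> complex"
  assumes "\<phi> \<in> borel_measurable (lebesgue_on T2)"
  shows "AE y in lborel. y \<in> {0..2 * pi} \<longrightarrow> (\<lambda>x. \<phi> (x, y)) \<in> borel_measurable (lebesgue_on {0..2 * pi})"
    and "AE y in lborel. y \<in> {0..2 * pi} \<longrightarrow> (\<lambda>x. \<phi> (y, x)) \<in> borel_measurable (lebesgue_on {0..2 * pi})"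
proof -
  obtain \<psi> where \<psi>: "\<psi> \<in> borel_measurable borel" "AE x in lebesgue_on T2. \<phi> x = \<psi> x"
    using lebesgue_on_AE_borel_complex[OF assms] by (auto simp: T2_eq_cbox)
  have m: "(\<lambda>x. \<psi> (x, y)) \<in> borel_measurable borel" "(\<lambda>x. \<psi> (y, x)) \<in> borel_measurable borel" for y
    using \<psi>(1) by (auto intro!: measurable_compose[OF _ \<psi>(1)] borel_measurable_Pair)
  show "AE y in lborel. y \<in> {0..2 * pi} \<longrightarrow> (\<lambda>x. \<phi> (x, y)) \<in> borel_measurable (lebesgue_on {0..2 * pi})"
    using AE_T2_imp_AE_sections(1)[OF \<psi>(2)]
    by eventually_elim (auto intro: borel_measurable_lebesgue_on_AE_eq[OF borel_measurable_imp_lebesgue_on[OF m(1)]])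
  show "AE y in lborel. y \<in> {0..2 * pi} \<longrightarrow> (\<lambda>x. \<phi> (y, x)) \<in> borel_measurable (lebesgue_on {0..2 * pi})"
    using AE_T2_imp_AE_sections(2)[OF \<psi>(2)]
    by eventually_elim (auto intro: borel_measurable_lebesgue_on_AE_eq[OF borel_measurable_imp_lebesgue_on[OF m(2)]])
qed

lemma trig_poly_convolution:
  fixes \<phi> :: "real \<Rightarrow> complex"
  assumes P: "P \<in> trig_polys (freqs N)" and int: "\<And>m. integrable M (\<lambda>y. \<phi> y * cis (m * y))"
  shows "(\<lambda>x. (LINT y|M. \<phi> y * P (x - y)) / c) \<in> trig_polys (freqs N)"
    and "integrable M (\<lambda>y. \<phi> y * P (x - y))"
proof -
  obtain v where v: "P = (\<lambda>x. \<Sum>m\<in>freqs N. v m * character m x)" using P by (rule trig_polysE)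
  have e: "\<phi> y * P (x - y) = (\<Sum>m\<in>freqs N. (v m * cis (m * x)) * (\<phi> y * cis (- m * y)))" for x y
    by (simp add: v sum_distrib_left right_diff_distrib mult_ac flip: cis_mult)
       (simp add: cis_mult mult_ac)
  show "integrable M (\<lambda>y. \<phi> y * P (x - y))"
    unfolding e by (intro Bochner_Integration.integrable_sum integrable_mult_right int)
  have "(LINT y|M. \<phi> y * P (x - y)) = (\<Sum>m\<in>freqs N. (v m * cis (m * x)) * (LINT y|M. \<phi> y * cis (- m * y)))" for x
    unfolding e
    by (subst Bochner_Integration.integral_sum, intro integrable_mult_right int, intro sum.cong refl integral_mult_right_zero)
  then have "(LINT y|M. \<phi> y * P (x - y)) / c = (\<Sum>m\<in>freqs N. (v m * (LINT y|M. \<phi> y * cis (- m * y)) / c) * character m x)" for x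
    by (simp add: sum_divide_distrib mult_ac)
  then show "(\<lambda>x. (LINT y|M. \<phi> y * P (x - y)) / c) \<in> trig_polys (freqs N)"
    by (rule trig_polysI[OF finite_freqs])
qed

lemma borel_measurable_F_kernel: "F_kernel r \<alpha> \<in> borel_measurable borel"
  unfolding F_kernel_def[abs_def] by measurable

text \<open>The approximant is the convolution of \<open>\<phi>\<close> with the polynomial near the kernel. The estimate first
holds almost everywhere and extends by continuity of \<open>f\<close>.\<close>

lemma potential_approx:
  fixes f \<phi> :: "real \<Rightarrow> complex"
  assumes r: "0 < r" and N: "1 \<le> N" and \<phi>: "\<phi> \<in> borel_measurable (lebesgue_on {0..2 * pi})"
    and \<phi>1: "AE y in lebesgue_on {0..2 * pi}. cmod (\<phi> y) \<le> 1" and f: "continuous_on UNIV f"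
    and rep: "AE x in lebesgue_on {0..2 * pi}. f x =
      (LINT y|lebesgue_on {0..2 * pi}. \<phi> y * of_real (F_kernel r \<alpha> (x - y))) / (2 * pi)"
  shows "\<exists>t\<in>trig_polys (freqs N). \<forall>x\<in>{0..2 * pi}. cmod (f x - t x) \<le> kernel_const r * real N powr (- r)"
proof -
  let ?M = "lebesgue_on {0..2 * pi}"
  obtain P where P: "P \<in> trig_polys (freqs N)"
    "\<And>x. cis x \<noteq> 1 \<Longrightarrow> cmod (of_real (F_kernel r \<alpha> x) - P x) \<le> 2 * cmod (ramp_sum r N x)"
    using F_kernel_near_trig_poly[OF r N] by blast
  have fin: "finite_measure ?M" by (rule finite_measure_lebesgue_on) simp
  have int: "integrable ?M (\<lambda>y. \<phi> y * cis (m * y))" for m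
  proof (rule finite_measure.integrable_const_bound[OF fin, where B=1])
    show "AE y in ?M. norm (\<phi> y * cis (m * y)) \<le> 1" using \<phi>1 by (simp add: norm_mult)
    have "(\<lambda>y. cis (m * y)) \<in> borel_measurable borel"
      by (intro borel_measurable_continuous_onI continuous_intros)
    then show "(\<lambda>y. \<phi> y * cis (m * y)) \<in> borel_measurable ?M"
      by (intro borel_measurable_times \<phi> borel_measurable_imp_lebesgue_on)
  qed
  define t where "t x = (LINT y|?M. \<phi> y * P (x - y)) / (2 * pi)" for x
  have t: "t \<in> trig_polys (freqs N)"
    unfolding t_def[abs_def] by (rule trig_poly_convolution(1)[OF P(1) int])
  have err: "cmod (f x - t x) \<le> kernel_const r * real N powr (- r)"
    if x: "x \<in> {0..2 * pi}" and fx: "f x = (LINT y|?M. \<phi> y * of_real (F_kernel r \<alpha> (x - y))) / (2 * pi)" for x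
  proof -
    define G where "G y = \<phi> y * (of_real (F_kernel r \<alpha> (x - y)) - P (x - y))" for y
    have Pm: "P \<in> borel_measurable borel"
      by (intro borel_measurable_continuous_onI continuous_on_trig_polys[OF P(1)])
    have Gm: "G \<in> borel_measurable ?M"
      unfolding G_def[abs_def]
    proof (intro borel_measurable_times \<phi> borel_measurable_imp_lebesgue_on borel_measurable_diff)
      show "(\<lambda>y. complex_of_real (F_kernel r \<alpha> (x - y))) \<in> borel_measurable borel"
        using borel_measurable_F_kernel[of r \<alpha>] by measurable
      show "(\<lambda>y. P (x - y)) \<in> borel_measurable borel"
        by (intro measurable_compose[OF _ Pm]) simp
    qed
    have nn: "(\<integral>\<^sup>+y. ennreal (cmod (G y)) \<partial>?M) \<le> ennreal (2 * (kernel_const r * real N powr (- r)))"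
    proof -
      have "AE y in ?M. cis (x - y) \<noteq> 1"
        using AE_cis_neq_1[OF x] by (simp add: AE_restrict_space_iff AE_completion_iff)
      then have "AE y in ?M. ennreal (cmod (G y)) \<le> ennreal 2 * ennreal (cmod (ramp_sum r N (x - y)))"
        using \<phi>1
      proof eventually_elim
        case (elim y)
        have "cmod (G y) \<le> 1 * (2 * cmod (ramp_sum r N (x - y)))"
          unfolding G_def norm_mult by (intro mult_mono elim P(2)) auto
        then show ?case by (simp add: ennreal_mult[symmetric] ennreal_leI del: ennreal_numeral)
      qed
      then have "(\<integral>\<^sup>+y. ennreal (cmod (G y)) \<partial>?M) \<le> (\<integral>\<^sup>+y. ennreal 2 * ennreal (cmod (ramp_sum r N (x - y))) \<partial>?M)"
        by (rule nn_integral_mono_AE)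
      also have "\<dots> = (\<integral>\<^sup>+y. ennreal 2 * (ennreal (cmod (ramp_sum r N (x - y))) * indicator {0..2 * pi} y) \<partial>lborel)"
        by (simp add: nn_integral_restrict_space nn_integral_completion mult.assoc)
      also have "\<dots> = ennreal 2 * (\<integral>\<^sup>+y\<in>{0..2 * pi}. ennreal (cmod (ramp_sum r N (x - y))) \<partial>lborel)"
      proof (rule nn_integral_cmult)
        have [measurable]: "cis \<in> borel_measurable borel"
          by (intro borel_measurable_continuous_onI continuous_intros)
        show "(\<lambda>y. ennreal (cmod (ramp_sum r N (x - y))) * indicator {0..2 * pi} y) \<in> borel_measurable lborel"
          unfolding ramp_sum_def by measurable
      qed
      also have "\<dots> \<le> ennreal 2 * ennreal (kernel_const r * real N powr (- r))"
        by (intro mult_left_mono nn_integral_ramp_sum r N x) auto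
      also have "\<dots> = ennreal (2 * (kernel_const r * real N powr (- r)))"
        using kernel_const_pos[OF r] by (intro ennreal_mult[symmetric]) auto
      finally show ?thesis .
    qed
    have Gi: "integrable ?M G"
      by (rule integrableI_bounded[OF Gm]) (use nn in \<open>simp add: order_le_less_trans\<close>)
    have "f x - t x = (LINT y|?M. G y) / (2 * pi)"
    proof -
      have "(LINT y|?M. \<phi> y * of_real (F_kernel r \<alpha> (x - y))) = (LINT y|?M. G y + \<phi> y * P (x - y))"
        by (simp add: G_def algebra_simps)
      also have "\<dots> = (LINT y|?M. G y) + (LINT y|?M. \<phi> y * P (x - y))"
        by (intro Bochner_Integration.integral_add Gi trig_poly_convolution(2)[OF P(1) int])
      finally show ?thesis unfolding fx t_def by (simp add: add_divide_distrib)
    qed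
    then have "cmod (f x - t x) = cmod (LINT y|?M. G y) / (2 * pi)"
      by (simp add: norm_divide norm_mult)
    also have "\<dots> \<le> (2 * (kernel_const r * real N powr (- r))) / (2 * pi)"
    proof (rule divide_right_mono)
      have "ennreal (cmod (LINT y|?M. G y)) \<le> ennreal (2 * (kernel_const r * real N powr (- r)))"
        using integral_norm_bound_ennreal[OF Gi] nn by (rule order_trans)
      then show "cmod (LINT y|?M. G y) \<le> 2 * (kernel_const r * real N powr (- r))"
        using kernel_const_pos[OF r] by (subst (asm) ennreal_le_iff) auto
    qed simp
    also have "\<dots> = kernel_const r * real N powr (- r) / pi" by simp
    also have "\<dots> \<le> kernel_const r * real N powr (- r) / 1"
      using kernel_const_pos[OF r] pi_gt3 by (intro divide_left_mono) auto
    finally show ?thesis by simp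
  qed
  let ?C = "{x. cmod (f x - t x) \<le> kernel_const r * real N powr (- r)}"
  have "closed ?C"
    by (intro closed_Collect_le continuous_intros f continuous_on_trig_polys[OF t])
  moreover have "AE x in ?M. x \<in> ?C"
  proof -
    have "AE x in ?M. x \<in> {0..2 * pi}" by (rule AE_I2) simp
    with rep show ?thesis by eventually_elim (use err in auto)
  qed
  ultimately have "{0..2 * pi} \<subseteq> ?C" by (intro AE_closed_interval)
  then show ?thesis using t by blast
qed

lemma slices_approxI_AE:
  assumes "AE y in lborel. y \<in> {0..2 * pi} \<longrightarrow>
    (\<exists>t\<in>trig_polys (freqs j). \<forall>x\<in>{0..2 * pi}. cmod (F y x - t x) \<le> e)"
  shows "slices_approx j e F"
  unfolding slices_approx_def
proof (rule AE_closed_interval)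
  let ?S = "{y \<in> {0..2 * pi}. \<exists>t\<in>trig_polys (freqs j). \<forall>x\<in>{0..2 * pi}. cmod (F y x - t x) \<le> e}"
  have "AE y in lborel. y \<in> {0..2 * pi} \<longrightarrow> y \<in> closure ?S"
    using assms by eventually_elim (use closure_subset[of ?S] in auto)
  then show "AE y in lebesgue_on {0..2 * pi}. y \<in> closure ?S"
    by (simp add: AE_restrict_space_iff AE_completion_iff)
qed simp

lemma Linf_norm_AE:
  assumes "Linf_norm \<phi> \<le> ereal c"
  shows "AE x in lebesgue_on T2. cmod (\<phi> x) \<le> c"
proof -
  have "AE x in lebesgue_on T2. ereal (cmod (\<phi> x)) \<le> Linf_norm \<phi>"
    unfolding Linf_norm_def by (rule esssup_AE)
  then show ?thesis
    by eventually_elim (use assms in \<open>metis ereal_less_eq(3) order_trans\<close>)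
qed

lemma continuous_sections:
  assumes "f \<in> C_T2"
  shows "continuous_on UNIV (\<lambda>x. f (x, y))" "continuous_on UNIV (\<lambda>x. f (y, x))"
proof -
  have f: "continuous_on UNIV f" using assms by (simp add: C_T2_def)
  show "continuous_on UNIV (\<lambda>x. f (x, y))" "continuous_on UNIV (\<lambda>x. f (y, x))"
    by (rule continuous_on_compose2[OF f], auto intro!: continuous_intros)+
qed

lemma W_class_slices:
  assumes f: "f \<in> C_T2" "f \<in> W_class r \<alpha>" and r: "0 < fst r" "0 < snd r" and j: "1 \<le> j"
  shows "slices_approx j (kernel_const (fst r) * real j powr (- fst r)) (\<lambda>y x. f (x, y))"
    and "slices_approx j (kernel_const (snd r) * real j powr (- snd r)) (\<lambda>y x. f (y, x))"
proof -
  obtain \<phi> where \<phi>: "\<phi> \<in> Linf" "Linf_norm \<phi> \<le> 1" "AE x in lebesgue_on T2. f x =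
           (LINT y|lebesgue_on {0..2 * pi}. \<phi> (y, snd x) * of_real (F_kernel (fst r) (fst \<alpha>) (fst x - y))) / (2 * pi)"
    using f(2) by (auto simp: W_class_def)
  have "\<phi> \<in> borel_measurable (lebesgue_on T2)" using \<phi>(1) by (simp add: Linf_def)
  note meas = borel_measurable_sections(1)[OF this]
  have bound: "AE x in lebesgue_on T2. cmod (\<phi> x) \<le> 1"
    using \<phi>(2) by (intro Linf_norm_AE) (simp add: one_ereal_def)
  from meas AE_T2_imp_AE_sections(1)[OF \<phi>(3)] AE_T2_imp_AE_sections(1)[OF bound]
  have "AE y in lborel. y \<in> {0..2 * pi} \<longrightarrow> (\<exists>t\<in>trig_polys (freqs j). \<forall>x\<in>{0..2 * pi}.
      cmod (f (x, y) - t x) \<le> kernel_const (fst r) * real j powr (- fst r))"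
  proof eventually_elim
    case (elim y)
    show ?case
    proof
      assume y: "y \<in> {0..2 * pi}"
      from elim y have "AE x in lebesgue_on {0..2 * pi}. f (x, y) = (LINT v|lebesgue_on {0..2 * pi}. \<phi> (v, y) *
          of_real (F_kernel (fst r) (fst \<alpha>) (x - v))) / (2 * pi)"
        by simp
      with elim y show "\<exists>t\<in>trig_polys (freqs j). \<forall>x\<in>{0..2 * pi}.
          cmod (f (x, y) - t x) \<le> kernel_const (fst r) * real j powr (- fst r)"
        by (intro potential_approx[where \<phi>="\<lambda>x. \<phi> (x, y)" and \<alpha>="fst \<alpha>"] r j continuous_sections f(1)) auto
    qed
  qed
  then show "slices_approx j (kernel_const (fst r) * real j powr (- fst r)) (\<lambda>y x. f (x, y))"
    by (rule slices_approxI_AE)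
next
  obtain \<phi> where \<phi>: "\<phi> \<in> Linf" "Linf_norm \<phi> \<le> 1" "AE x in lebesgue_on T2. f x =
           (LINT y|lebesgue_on {0..2 * pi}. \<phi> (fst x, y) * of_real (F_kernel (snd r) (snd \<alpha>) (snd x - y))) / (2 * pi)"
    using f(2) by (auto simp: W_class_def)
  have "\<phi> \<in> borel_measurable (lebesgue_on T2)" using \<phi>(1) by (simp add: Linf_def)
  note meas = borel_measurable_sections(2)[OF this]
  have bound: "AE x in lebesgue_on T2. cmod (\<phi> x) \<le> 1"
    using \<phi>(2) by (intro Linf_norm_AE) (simp add: one_ereal_def)
  from meas AE_T2_imp_AE_sections(2)[OF \<phi>(3)] AE_T2_imp_AE_sections(2)[OF bound]
  have "AE y in lborel. y \<in> {0..2 * pi} \<longrightarrow> (\<exists>t\<in>trig_polys (freqs j). \<forall>x\<in>{0..2 * pi}.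
      cmod (f (y, x) - t x) \<le> kernel_const (snd r) * real j powr (- snd r))"
  proof eventually_elim
    case (elim y)
    show ?case
    proof
      assume y: "y \<in> {0..2 * pi}"
      from elim y have "AE x in lebesgue_on {0..2 * pi}. f (y, x) = (LINT v|lebesgue_on {0..2 * pi}. \<phi> (y, v) *
          of_real (F_kernel (snd r) (snd \<alpha>) (x - v))) / (2 * pi)"
        by simp
      with elim y show "\<exists>t\<in>trig_polys (freqs j). \<forall>x\<in>{0..2 * pi}.
          cmod (f (y, x) - t x) \<le> kernel_const (snd r) * real j powr (- snd r)"
        by (intro potential_approx[where \<phi>="\<lambda>x. \<phi> (y, x)" and \<alpha>="snd \<alpha>"] r j continuous_sections f(1)) auto
    qed
  qed
  then show "slices_approx j (kernel_const (snd r) * real j powr (- snd r)) (\<lambda>y x. f (y, x))"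
    by (rule slices_approxI_AE)
qed

section \<open>Sections of functions of the Nikol'skii class\<close>

text \<open>Only the modulus of the leading coefficient matters, so the binomial form of the coefficients
is left implicit.\<close>

lemma diff_step_iterate:
  "\<exists>c::nat \<Rightarrow> complex. cmod (c 0) = 1 \<and>
    (\<forall>v f x. (diff_step v ^^ l) f x = (\<Sum>i\<le>l. c i * f (x + real i *\<^sub>R v)))"
proof (induction l)
  case 0 then show ?case by (intro exI[of _ "\<lambda>_. 1"]) simp
next
  case (Suc l)
  then obtain c :: "nat \<Rightarrow> complex" where c: "cmod (c 0) = 1"
    "\<And>v f x. (diff_step v ^^ l) f x = (\<Sum>i\<le>l. c i * f (x + real i *\<^sub>R v))" by blast
  define c' where "c' i = (if i = 0 then 0 else c (i - 1)) - (if i \<le> l then c i else 0)" for i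
  have "(diff_step v ^^ Suc l) f x = (\<Sum>i\<le>Suc l. c' i * f (x + real i *\<^sub>R v))" for v f x
  proof -
    have 1: "(\<Sum>i\<le>Suc l. (if i = 0 then 0 else c (i - 1)) * f (x + real i *\<^sub>R v)) =
        (\<Sum>i\<le>l. c i * f (x + v + real i *\<^sub>R v))"
      by (simp add: sum.atMost_Suc_shift scaleR_left_distrib add.assoc del: sum.atMost_Suc)
    have 2: "(\<Sum>i\<le>Suc l. (if i \<le> l then c i else 0) * f (x + real i *\<^sub>R v)) = (\<Sum>i\<le>l. c i * f (x + real i *\<^sub>R v))"
      by simp
    show ?thesis
      unfolding c'_def left_diff_distrib sum_subtractf 1 2 by (simp add: diff_step_def c(2))
  qed
  moreover have "cmod (c' 0) = 1" using c(1) by (simp add: c'_def)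
  ultimately show ?case by blast
qed

lemma periodic2_representative:
  assumes "periodic2 f"
  shows "\<exists>y\<in>T2. f x = f y"
proof -
  have p1: "f (u + 2 * pi * of_int k, v) = f (u, v)" for u v k
    using periodic_shift_int[of "\<lambda>u. f (u, v)"] assms by (simp add: periodic2_def)
  have p2: "f (u, v + 2 * pi * of_int k) = f (u, v)" for u v k
    using periodic_shift_int[of "\<lambda>v. f (u, v)"] assms by (simp add: periodic2_def)
  obtain k where k: "\<bar>(fst x - pi) - 2 * pi * of_int k\<bar> \<le> pi" using periodic_representative by blast
  obtain l where l: "\<bar>(snd x - pi) - 2 * pi * of_int l\<bar> \<le> pi" using periodic_representative by blast
  let ?y = "(fst x - 2 * pi * of_int k, snd x - 2 * pi * of_int l)"
  have "f (fst x, snd x) = f ?y"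
    using p1[of "fst x - 2 * pi * of_int k" k "snd x"] p2[of "fst x - 2 * pi * of_int k" "snd x - 2 * pi * of_int l" l] by simp
  moreover have "?y \<in> T2" using k l by (auto simp: T2_def abs_le_iff)
  ultimately show ?thesis by (metis prod.collapse)
qed

text \<open>A closed set of full measure in the square is the whole square.\<close>

lemma Linf_norm_bound_pointwise:
  assumes h: "continuous_on UNIV h" "periodic2 h" and c: "Linf_norm h \<le> ereal c"
  shows "cmod (h x) \<le> c"
proof -
  have "T2 \<subseteq> {x. cmod (h x) \<le> c}"
    unfolding T2_eq_cbox
  proof (rule AE_closed_cbox)
    show "closed {x. cmod (h x) \<le> c}" by (intro closed_Collect_le continuous_intros h)
    show "box (0, 0) (2 * pi, 2 * pi) \<noteq> {}" by (simp add: box_ne_empty Basis_prod_def)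
    show "AE x in lebesgue_on (cbox (0, 0) (2 * pi, 2 * pi)). x \<in> {x. cmod (h x) \<le> c}"
      using Linf_norm_AE[OF c] unfolding T2_eq_cbox mem_Collect_eq .
  qed
  moreover obtain y where "y \<in> T2" "h x = h y" using periodic2_representative[OF h(2)] by blast
  ultimately show ?thesis by auto
qed

lemma periodic2_diff_step:
  assumes "periodic2 h" shows "periodic2 (diff_step v h)"
proof -
  obtain v1 v2 where v: "v = (v1, v2)" by fastforce
  have h: "h (x + 2 * pi, y) = h (x, y)" "h (x, y + 2 * pi) = h (x, y)" for x y
    using assms by (auto simp: periodic2_def)
  have "h (x + 2 * pi + v1, y + v2) = h (x + v1, y + v2)" "h (x + v1, y + 2 * pi + v2) = h (x + v1, y + v2)" for x y
    using h(1)[of "x + v1" "y + v2"] h(2)[of "x + v1" "y + v2"] by (metis add.commute add.left_commute)+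
  then show ?thesis using h by (simp add: periodic2_def diff_step_def v)
qed

lemma diff_step_iterate_C_T2:
  assumes "f \<in> C_T2" shows "(diff_step v ^^ l) f \<in> C_T2"
proof (induction l)
  case (Suc l)
  have "continuous_on UNIV (\<lambda>x. (diff_step v ^^ l) f (x + v))"
    by (rule continuous_on_compose2[of UNIV "(diff_step v ^^ l) f"]) (use Suc in \<open>auto simp: C_T2_def intro!: continuous_intros\<close>)
  moreover have "periodic2 (diff_step v ((diff_step v ^^ l) f))"
    using Suc by (intro periodic2_diff_step) (simp add: C_T2_def)
  ultimately show ?case
    using Suc by (auto simp: C_T2_def diff_step_def[abs_def] intro!: continuous_on_diff)
qed (simp add: assms)

text \<open>The Jackson kernel of order \<open>q \<ge> r\<close> has moments of order \<open>2 * q \<ge> r\<close>; its degree is \<open>Suc q\<close> times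
its concentration parameter, which costs the factor \<open>Suc q powr r\<close>.\<close>

definition difference_const :: "real \<Rightarrow> real" where
  "difference_const r = (let q = nat \<lceil>r\<rceil> in (2 + real (Suc q) * 16 ^ q) * real (Suc q) powr r)"

lemma difference_const_pos: "0 < difference_const r"
  unfolding difference_const_def Let_def by (intro mult_pos_pos add_pos_nonneg) auto

lemma differences_approx:
  fixes f :: "real \<Rightarrow> complex" and c :: "nat \<Rightarrow> complex"
  assumes f: "continuous_on UNIV f" and per: "\<And>x. f (x + 2 * pi) = f x"
    and c: "cmod (c 0) = 1" and r: "0 < r" and j: "1 \<le> j"
    and diff: "\<And>x h. cmod (\<Sum>i\<le>l. c i * f (x + real i * h)) \<le> \<bar>h\<bar> powr r"
  shows "\<exists>t\<in>trig_polys (freqs j). \<forall>x. cmod (f x - t x) \<le> difference_const r * real j powr (- r)"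
proof -
  define q where "q = nat \<lceil>r\<rceil>"
  define N where "N = j div Suc q + 1"
  have rq: "r \<le> real (2 * q)"
    using real_nat_ceiling_ge[of r] of_nat_0_le_iff[of q, where ?'a=real] by (simp add: q_def)
  obtain t where t: "t \<in> trig_polys (freqs (Suc q * (N - 1)))"
    "\<And>x. cmod (f x - t x) \<le> (2 + real (Suc q) * 16 ^ q) * real N powr (- r)"
    using jackson_differences[OF f per c r rq _ diff, of N] by (auto simp: N_def)
  have "Suc q * (N - 1) \<le> j" by (simp only: N_def add_diff_cancel_right' times_div_less_eq_dividend)
  then have "t \<in> trig_polys (freqs j)" using trig_polys_mono[OF t(1) freqs_mono] by simp
  moreover have "real N powr (- r) \<le> real (Suc q) powr r * real j powr (- r)"
  proof -
    have "j < Suc q * N" using dividend_less_times_div[of "Suc q" j] by (simp add: N_def)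
    then have "real j < real (Suc q * N)" by (simp only: of_nat_less_iff)
    then have "real j / real (Suc q) \<le> real N" by (simp add: divide_le_eq algebra_simps)
    then have "real N powr (- r) \<le> (real j / real (Suc q)) powr (- r)"
      using r j by (intro powr_mono2') auto
    also have "\<dots> = real (Suc q) powr r * real j powr (- r)"
      by (simp add: powr_divide powr_minus field_simps)
    finally show ?thesis .
  qed
  then have "(2 + real (Suc q) * 16 ^ q) * real N powr (- r) \<le> difference_const r * real j powr (- r)"
    unfolding difference_const_def Let_def q_def[symmetric] mult.assoc by (intro mult_left_mono) auto
  ultimately show ?thesis using t(2) order_trans by blast
qed

lemma slices_approxI:
  assumes "\<And>y. \<exists>t\<in>trig_polys (freqs j). \<forall>x. cmod (F y x - t x) \<le> e"
  shows "slices_approx j e F"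
proof (intro slices_approxI_AE AE_I2 impI)
  fix y
  obtain t where "t \<in> trig_polys (freqs j)" "\<forall>x. cmod (F y x - t x) \<le> e"
    using assms[of y] by blast
  then show "\<exists>t\<in>trig_polys (freqs j). \<forall>x\<in>{0..2 * pi}. cmod (F y x - t x) \<le> e" by blast
qed

lemma H_class_slices:
  assumes f: "f \<in> C_T2" "f \<in> H_class r" and r: "0 < fst r" "0 < snd r" and j: "1 \<le> j"
  shows "slices_approx j (difference_const (fst r) * real j powr (- fst r)) (\<lambda>y x. f (x, y))"
    and "slices_approx j (difference_const (snd r) * real j powr (- snd r)) (\<lambda>y x. f (y, x))"
proof -
  have per: "f (x + 2 * pi, y) = f (x, y)" "f (y, x + 2 * pi) = f (y, x)" for x y
    using f(1) by (simp_all add: C_T2_def periodic2_def)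
  have pw: "cmod ((diff_step v ^^ l) f x) \<le> a" if "Linf_norm ((diff_step v ^^ l) f) \<le> ereal a" for v l x a
    using diff_step_iterate_C_T2[OF f(1), of l v] that by (intro Linf_norm_bound_pointwise) (auto simp: C_T2_def)
  define l1 l2 where "l1 = nat \<lfloor>fst r\<rfloor> + 1" and "l2 = nat \<lfloor>snd r\<rfloor> + 1"
  obtain c1 where c1: "cmod (c1 0) = 1" "\<And>v f x. (diff_step v ^^ l1) f x = (\<Sum>i\<le>l1. c1 i * f (x + real i *\<^sub>R v))"
    using diff_step_iterate by blast
  obtain c2 where c2: "cmod (c2 0) = 1" "\<And>v f x. (diff_step v ^^ l2) f x = (\<Sum>i\<le>l2. c2 i * f (x + real i *\<^sub>R v))"
    using diff_step_iterate by blast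
  have d1: "cmod (\<Sum>i\<le>l1. c1 i * f (x + real i * h, y)) \<le> \<bar>h\<bar> powr fst r" for x y h
  proof -
    have "Linf_norm ((diff_step (h, 0) ^^ l1) f) \<le> ereal (\<bar>h\<bar> powr fst r)"
      using f(2) by (simp add: H_class_def l1_def)
    from pw[OF this, of "(x, y)"] show ?thesis by (simp add: c1(2))
  qed
  have d2: "cmod (\<Sum>i\<le>l2. c2 i * f (y, x + real i * h)) \<le> \<bar>h\<bar> powr snd r" for x y h
  proof -
    have "Linf_norm ((diff_step (0, h) ^^ l2) f) \<le> ereal (\<bar>h\<bar> powr snd r)"
      using f(2) by (simp add: H_class_def l2_def)
    from pw[OF this, of "(y, x)"] show ?thesis by (simp add: c2(2))
  qed
  show "slices_approx j (difference_const (fst r) * real j powr (- fst r)) (\<lambda>y x. f (x, y))"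
  proof (rule slices_approxI)
    fix y
    show "\<exists>t\<in>trig_polys (freqs j). \<forall>x. cmod (f (x, y) - t x) \<le> difference_const (fst r) * real j powr (- fst r)"
      by (rule differences_approx[where f="\<lambda>x. f (x, y)" and c=c1 and l=l1])
         (rule continuous_sections(1)[OF f(1)] per(1) c1(1) r(1) j d1)+
  qed
  show "slices_approx j (difference_const (snd r) * real j powr (- snd r)) (\<lambda>y x. f (y, x))"
  proof (rule slices_approxI)
    fix y
    show "\<exists>t\<in>trig_polys (freqs j). \<forall>x. cmod (f (y, x) - t x) \<le> difference_const (snd r) * real j powr (- snd r)"
      by (rule differences_approx[where f="\<lambda>x. f (y, x)" and c=c2 and l=l2])
         (rule continuous_sections(2)[OF f(1)] per(2) c2(1) r(2) j d2)+
  qed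
qed

section \<open>The error of the adaptive recovery\<close>

lemma slices_approx_mono:
  assumes "slices_approx j e F" "e \<le> e'" shows "slices_approx j e' F"
proof -
  have "{y \<in> {0..2 * pi}. \<exists>t\<in>trig_polys (freqs j). \<forall>x\<in>{0..2 * pi}. cmod (F y x - t x) \<le> e}
     \<subseteq> {y \<in> {0..2 * pi}. \<exists>t\<in>trig_polys (freqs j). \<forall>x\<in>{0..2 * pi}. cmod (F y x - t x) \<le> e'}"
    using assms(2) order_trans by blast
  then show ?thesis using assms(1) closure_mono unfolding slices_approx_def by blast
qed

lemma smoothness_slices:
  assumes r: "0 < fst r" "0 < snd r"
  obtains C where "0 < C" "\<And>f j. f \<in> C_T2 \<Longrightarrow> (\<exists>\<alpha>. f \<in> W_class r \<alpha>) \<or> f \<in> H_class r \<Longrightarrow> 1 \<le> j \<Longrightarrow>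
      slices_approx j (C * real j powr (- fst r)) (\<lambda>y x. f (x, y)) \<and>
      slices_approx j (C * real j powr (- snd r)) (\<lambda>y x. f (y, x))"
proof -
  let ?C = "kernel_const (fst r) + kernel_const (snd r) + difference_const (fst r) + difference_const (snd r)"
  have pos: "0 < kernel_const (fst r)" "0 < kernel_const (snd r)" "0 < difference_const (fst r)" "0 < difference_const (snd r)"
    using r by (auto intro: kernel_const_pos difference_const_pos)
  show thesis
  proof (rule that[of ?C])
    show "0 < ?C" using pos by linarith
    fix f j assume f: "f \<in> C_T2" "(\<exists>\<alpha>. f \<in> W_class r \<alpha>) \<or> f \<in> H_class r" and j: "1 \<le> (j::nat)"
    have le: "K * real j powr s \<le> ?C * real j powr s" if "K \<le> ?C" for K s
      using that by (intro mult_right_mono) auto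
    from f(2) show "slices_approx j (?C * real j powr (- fst r)) (\<lambda>y x. f (x, y)) \<and>
      slices_approx j (?C * real j powr (- snd r)) (\<lambda>y x. f (y, x))"
    proof
      assume "\<exists>\<alpha>. f \<in> W_class r \<alpha>"
      then obtain \<alpha> where "f \<in> W_class r \<alpha>" by blast
      from W_class_slices[OF f(1) this r j] show ?thesis
        using pos by (intro conjI; elim slices_approx_mono) (auto intro!: le)
    next
      assume "f \<in> H_class r"
      from H_class_slices[OF f(1) this r j] show ?thesis
        using pos by (intro conjI; elim slices_approx_mono) (auto intro!: le)
    qed
  qed
qed

text \<open>The level of the one-dimensional operators must satisfy \<open>2 * j - 1 \<le> 2 ^ s\<close>, which \<open>2 ^ (s - 1)\<close>
does for \<open>s > 0\<close>. The rounding makes it 1 for \<open>s = 0\<close>.\<close>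

lemma half_power_level:
  fixes s :: nat
  defines "j \<equiv> (2 ^ s + 1) div 2"
  shows "1 \<le> j" "2 * j - 1 \<le> 2 ^ s" "2 ^ s / 2 \<le> real j"
proof -
  have "2 ^ s = (1::nat) \<or> even (2 ^ s :: nat)" by (cases s) auto
  then have "2 ^ s \<le> 2 * j" "2 * j \<le> 2 ^ s + 1" unfolding j_def by auto
  moreover have "1 \<le> (2::nat) ^ s" by simp
  ultimately show "1 \<le> j" "2 * j - 1 \<le> 2 ^ s" by linarith+
  have "real (2 ^ s) \<le> real (2 * j)" using \<open>2 ^ s \<le> 2 * j\<close> by (simp only: of_nat_le_iff)
  then show "2 ^ s / 2 \<le> real j" by simp
qed

lemma half_power_level_powr:
  fixes s :: nat and \<rho> :: real
  assumes "0 < \<rho>"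
  shows "real ((2 ^ s + 1) div 2) powr (- \<rho>) \<le> 2 powr (\<rho> - \<rho> * real s)"
proof -
  have "real ((2 ^ s + 1) div 2) powr (- \<rho>) \<le> (2 ^ s / 2) powr (- \<rho>)"
    using assms half_power_level(3)[of s] by (intro powr_mono2') auto
  also have "(2 ^ s / 2 :: real) = 2 powr (real s - 1)"
    by (simp add: powr_diff powr_realpow)
  also have "(2 powr (real s - 1)) powr (- \<rho>) = 2 powr (\<rho> - \<rho> * real s)"
    by (simp add: powr_powr algebra_simps)
  finally show ?thesis .
qed

text \<open>The real solution of \<open>r\<^sub>1 * s\<^sub>1 = r\<^sub>2 * s\<^sub>2\<close> and \<open>s\<^sub>1 + s\<^sub>2 = m\<close> gives both products the value
\<open>g r * m\<close>; rounding \<open>s\<^sub>1\<close> down costs at most \<open>r\<^sub>1\<close>.\<close>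

lemma balanced_split:
  fixes m :: nat
  assumes r: "0 < fst r" "0 < snd r"
  obtains s1 s2 :: nat where "s1 + s2 = m" "g r * real m - fst r \<le> fst r * real s1" "g r * real m \<le> snd r * real s2"
proof -
  let ?r1 = "fst r" and ?r2 = "snd r"
  have g: "g r = ?r1 * ?r2 / (?r1 + ?r2)"
    using r by (simp add: g_def field_simps)
  define x where "x = real m * ?r2 / (?r1 + ?r2)"
  have x: "0 \<le> x" "x \<le> real m" using r by (auto simp: x_def field_simps)
  have gx: "g r * real m = ?r1 * x" by (simp add: g x_def)
  have gy: "g r * real m = ?r2 * (real m - x)" using r by (simp add: g x_def field_simps)
  define s1 where "s1 = nat \<lfloor>x\<rfloor>"
  have s1: "real s1 \<le> x" "x - 1 \<le> real s1" using x by (auto simp: s1_def)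
  then have "s1 \<le> m" using x by linarith
  show thesis
  proof (rule that[of s1 "m - s1"])
    show "s1 + (m - s1) = m" using \<open>s1 \<le> m\<close> by simp
    have "?r1 * (x - 1) \<le> ?r1 * real s1" using r s1 by (intro mult_left_mono) auto
    then show "g r * real m - ?r1 \<le> ?r1 * real s1" by (simp add: gx algebra_simps)
    show "g r * real m \<le> ?r2 * real (m - s1)"
      unfolding gy using r s1 \<open>s1 \<le> m\<close> by (intro mult_left_mono) auto
  qed
qed

theorem proposition4p2:
  fixes \<gamma> :: real
  assumes "\<gamma> > 0" and "fib_exact \<gamma>"
  shows "\<forall>r. fst r > 0 \<and> snd r > 0 \<longrightarrow>
    (\<exists>C>0. \<forall>n>2. \<gamma> * real (b n) \<ge> 18 \<longrightarrow>
      (\<forall>f\<in>C_T2. (\<exists>\<alpha>. f \<in> W_class r \<alpha>) \<or> f \<in> H_class r \<longrightarrow>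
        (\<forall>u\<in>Vn \<gamma> n f. sup_norm (\<lambda>x. f x - u x) \<le> C * real (b n) powr (- g r))))"
proof (intro allI impI)
  fix r :: "real \<times> real" assume "fst r > 0 \<and> snd r > 0"
  then have r: "0 < fst r" "0 < snd r" by auto
  have g0: "0 < g r" using r by (simp add: g_def add_pos_pos)
  obtain C0 where C0: "0 < C0" "\<And>f j. f \<in> C_T2 \<Longrightarrow> (\<exists>\<alpha>. f \<in> W_class r \<alpha>) \<or> f \<in> H_class r \<Longrightarrow> 1 \<le> j \<Longrightarrow>
      slices_approx j (C0 * real j powr (- fst r)) (\<lambda>y x. f (x, y)) \<and>
      slices_approx j (C0 * real j powr (- snd r)) (\<lambda>y x. f (y, x))"
    using smoothness_slices[OF r] by blast
  define A where "A = 10 * (4 * C0 * 2 powr (2 * fst r) + 12 * C0 * 2 powr snd r)"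
  define C where "C = A * (18 / \<gamma>) powr g r"
  have "0 < A" using C0(1) by (auto simp: A_def intro!: add_pos_pos mult_pos_pos)
  then have "0 < C" using assms(1) by (simp add: C_def)
  moreover have "sup_norm (\<lambda>x. f x - u x) \<le> C * real (b n) powr (- g r)"
    if n: "n > 2" and bn: "\<gamma> * real (b n) \<ge> 18" and f: "f \<in> C_T2" "(\<exists>\<alpha>. f \<in> W_class r \<alpha>) \<or> f \<in> H_class r"
      and u: "u \<in> Vn \<gamma> n f" for n f u
  proof -
    obtain s1 s2 where s: "s1 + s2 = n' \<gamma> n" "g r * real (n' \<gamma> n) - fst r \<le> fst r * real s1"
        "g r * real (n' \<gamma> n) \<le> snd r * real s2"
      using balanced_split[OF r] by blast
    define j1 j2 where "j1 = (2 ^ s1 + 1) div (2::nat)" and "j2 = (2 ^ s2 + 1) div (2::nat)"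
    note j = half_power_level[of s1, folded j1_def] half_power_level[of s2, folded j2_def]
    let ?e1 = "C0 * real j1 powr (- fst r)" and ?e2 = "C0 * real j2 powr (- snd r)"
    let ?m = "real (n' \<gamma> n)"
    have "continuous_on UNIV f" using f(1) by (simp add: C_T2_def)
    from approx_two_variables[OF this j(1,4)] C0(2)[OF f j(1)] C0(2)[OF f j(4)]
    obtain t where t: "t \<in> trig_polys (freqs (2 * j1 - 1) \<times> freqs (2 * j2 - 1))"
      "\<And>x. x \<in> T2 \<Longrightarrow> cmod (f x - t x) \<le> 4 * ?e1 + 12 * ?e2" by blast
    have t': "t \<in> trig_polys (freqs (2 ^ s1) \<times> freqs (2 ^ s2))"
      using freqs_mono[OF j(2)] freqs_mono[OF j(5)] by (intro trig_polys_mono[OF t(1)] Sigma_mono) auto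
    have ex: "9 * 2 ^ (s1 + s2) \<le> \<gamma> * real (b n)"
      using power_n'(1)[OF bn] by (simp add: s(1))
    have "sup_norm (\<lambda>x. f x - u x) \<le> 10 * (4 * ?e1 + 12 * ?e2)"
      by (rule sup_norm_Vn_le[OF u, of "(s1, s2)"])
         (use s(1) in simp, rule V_near_best[OF assms(2) n ex t' t(2)])
    also have "\<dots> \<le> A * 2 powr (- (g r * ?m))"
    proof -
      have "real j1 powr (- fst r) \<le> 2 powr (fst r - fst r * real s1)"
        unfolding j1_def using r(1) by (rule half_power_level_powr)
      also have "\<dots> \<le> 2 powr (2 * fst r + - (g r * ?m))" using s(2) by (intro powr_mono) auto
      finally have 1: "real j1 powr (- fst r) \<le> 2 powr (2 * fst r) * 2 powr (- (g r * ?m))" by (simp only: powr_add)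
      have "real j2 powr (- snd r) \<le> 2 powr (snd r - snd r * real s2)"
        unfolding j2_def using r(2) by (rule half_power_level_powr)
      also have "\<dots> \<le> 2 powr (snd r + - (g r * ?m))" using s(3) by (intro powr_mono) auto
      finally have 2: "real j2 powr (- snd r) \<le> 2 powr snd r * 2 powr (- (g r * ?m))" by (simp only: powr_add)
      have "4 * ?e1 + 12 * ?e2 \<le> 4 * (C0 * (2 powr (2 * fst r) * 2 powr (- (g r * ?m)))) +
          12 * (C0 * (2 powr snd r * 2 powr (- (g r * ?m))))"
        using C0(1) 1 2 by (intro add_mono mult_left_mono) auto
      then show ?thesis by (simp add: A_def algebra_simps)
    qed
    also have "\<dots> \<le> A * ((18 / \<gamma>) powr g r * real (b n) powr (- g r))"
    proof (rule mult_left_mono)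
      have "2 powr (- (g r * ?m)) = (2 ^ n' \<gamma> n) powr (- g r)"
        by (simp add: powr_realpow[symmetric] powr_powr mult.commute)
      also have "\<dots> \<le> (\<gamma> / 18 * real (b n)) powr (- g r)"
        using power_n'(2)[OF bn] bn g0 by (intro powr_mono2') auto
      also have "\<dots> = (\<gamma> / 18) powr (- g r) * real (b n) powr (- g r)"
        by (rule powr_mult)
      also have "(\<gamma> / 18) powr (- g r) = (18 / \<gamma>) powr g r"
        using assms(1) by (simp add: powr_divide powr_minus field_simps)
      finally show "2 powr (- (g r * ?m)) \<le> (18 / \<gamma>) powr g r * real (b n) powr (- g r)" .
    qed (use \<open>0 < A\<close> in simp)
    finally show ?thesis by (simp add: C_def mult.assoc)
  qed
  ultimately show "\<exists>C>0. \<forall>n>2. \<gamma> * real (b n) \<ge> 18 \<longrightarrow>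
      (\<forall>f\<in>C_T2. (\<exists>\<alpha>. f \<in> W_class r \<alpha>) \<or> f \<in> H_class r \<longrightarrow>
        (\<forall>u\<in>Vn \<gamma> n f. sup_norm (\<lambda>x. f x - u x) \<le> C * real (b n) powr (- g r)))"
    by blast
qed

end
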